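(* Let $\mathcal{C}$ be a simple closed curve of class $C^2$ on the unit sphere $\mathcal{S}\subset\mathbb{R}^3$ dividing $\mathcal{S}$ into two parts $\mathcal{S}_1$ and $\mathcal{S}_2$, and let $\vec{t}$ be the unit tangent vector field to $\mathcal{C}$, positively oriented with respect to $\mathcal{S}_2$. Then every function $u\in C^2(\mathcal{S}_2)\cap C^1(\overline{\mathcal{S}_2})$ satisfies $$\frac{1}{4\pi}\int_{\mathcal{S}_2} u(x)\,d\sigma_x-\int_{\mathcal{S}_2}U^*(x,x_0)\,\Delta_{\mathcal{S}}u(x)\,d\sigma_x-\int_{\mathcal{C}}U^*(x,x_0)\,\underline{\mathrm{curl}}_{\mathcal{S}}u(x)\cdot\vec{t}(x)\,ds_x+\int_{\mathcal{C}}u(x)\,\underline{\mathrm{curl}}_{\mathcal{S}}U^*(x,x_0)\cdot\vec{t}(x)\,ds_x$$ $$=\begin{cases}u(x_0) & \text{if } x_0\in\mathcal{S}_2,\\ 0 & \text{if } x_0\in\mathcal{S}\setminus\overline{\mathcal{S}_2},\end{cases}$$ where $\underline{\mathrm{curl}}_{\mathcal{S}}U^*(x,x_0)$ is taken with respect to the variable $x$.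
   Context: $\mathcal{S}$ is the unit sphere in $\mathbb{R}^3$, with points written $x(\varphi,\theta)=(\cos\varphi\sin\theta,\sin\varphi\sin\theta,\cos\theta)$, $\varphi\in[0,2\pi)$, $\theta\in[0,\pi]$. $\vec e_\varphi,\vec e_\theta$ are the usual spherical unit tangent vectors, $d\sigma$ is surface measure and $ds$ is arc length. $\mathcal{S}_1,\mathcal{S}_2$ are the two disjoint open connected components of $\mathcal{S}\setminus\mathcal{C}$. The Laplace–Beltrami operator is $\Delta_{\mathcal{S}}u=\frac{1}{\sin^2\theta}\frac{\partial^2u}{\partial\varphi^2}+\frac{1}{\sin\theta}\frac{\partial}{\partial\theta}\left(\sin\theta\frac{\partial u}{\partial\theta}\right)$. The vectorial surface rotation of a scalar function $f$ is $\underline{\mathrm{curl}}_{\mathcal{S}}f=-\frac{\partial f}{\partial\theta}\vec e_\varphi+\frac{1}{\sin\theta}\frac{\partial f}{\partial\varphi}\vec e_\theta$ (coordinate-free: $-x\times\nabla_{\mathcal{S}}f(x)$, which also defines it at the poles). The scalar surface rotation of a tangential field $\vec V=V_\varphi\vec e_\varphi+V_\theta\vec e_\theta$ is $\mathrm{curl}_{\mathcal{S}}\vec V=\frac{1}{\sin\theta}\left(-\frac{\partial V_\theta}{\partial\varphi}+\frac{\partial}{\partial\theta}(\sin\theta\,V_\varphi)\right)$. The positive orientation of $\vec t$ with respect to $\mathcal{S}_2$ is the one for which Stokes' theorem $\int_{\mathcal{S}_2}\mathrm{curl}_{\mathcal{S}}\vec V\,d\sigma=\int_{\mathcal{C}}\vec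 V\cdot\vec t\,ds$ holds (i.e. $\mathcal{S}_2$ lies to the left of $\vec t$ when viewed from outside the sphere). The fundamental solution is $U^*(x,x_0)=-\frac{1}{4\pi}\log|1-(x,x_0)|$ for $x\ne x_0$ in $\mathcal{S}$, where $(\cdot,\cdot)$ is the Euclidean inner product of $\mathbb{R}^3$; it satisfies $\Delta_{\mathcal{S}}U^*(\cdot,x_0)=\frac{1}{4\pi}$ on $\mathcal{S}\setminus\{x_0\}$. If $\Delta_{\mathcal{S}}u$ is not integrable up to $\mathcal{C}$, the integral $\int_{\mathcal{S}_2}U^*(x,x_0)\Delta_{\mathcal{S}}u(x)\,d\sigma_x$ is understood as the limit, as $\delta\to0^+$, of the integrals over $\{x\in\mathcal{S}_2:\mathrm{dist}(x,\mathcal{C})>\delta\}$. *)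

theory Defs
  imports "HOL-Analysis.Analysis"
begin

section \<open>The unit sphere, spherical coordinates and surface measure\<close>

abbreviation unit_sphere :: "(real^3) set" where
  "unit_sphere \<equiv> sphere 0 1"

definition sph :: "real \<Rightarrow> real \<Rightarrow> real^3" where
  "sph \<phi> \<theta> = vector [cos \<phi> * sin \<theta>, sin \<phi> * sin \<theta>, cos \<theta>]"

definition longitude :: "real^3 \<Rightarrow> real" where
  "longitude x = Arg2pi (Complex (x $ 1) (x $ 2))"

definition colatitude :: "real^3 \<Rightarrow> real" where
  "colatitude x = arccos (x $ 3)"

text \<open>The surface measure \<open>d\<sigma> = sin \<theta> d\<phi> d\<theta>\<close>, as a Borel measure on the ambient space
  that is concentrated on the sphere.\<close>

definition sphere_measure :: "(real^3) measure" where
  "sphere_measure =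
     distr
       (density lborel
         (\<lambda>(\<phi>, \<theta>). indicator ({0..<2*pi} \<times> {0..pi}) (\<phi>, \<theta>) * ennreal (sin \<theta>)))
       borel
       (\<lambda>(\<phi>, \<theta>). sph \<phi> \<theta>)"


section \<open>Differential operators on the sphere\<close>

text \<open>Scalar functions live on the ambient type, but differentiability is always taken
  within the sphere, so only their values on the sphere (near the point) matter. The surface
  gradient is the tangent vector representing the derivative.\<close>

definition has_surface_gradient :: "(real^3 \<Rightarrow> real) \<Rightarrow> real^3 \<Rightarrow> real^3 \<Rightarrow> bool" where
  "has_surface_gradient f g x \<longleftrightarrow>
     g \<bullet> x = 0 \<and> (f has_derivative (\<lambda>h. g \<bullet> h)) (at x within unit_sphere)"

definition surface_gradient :: "(real^3 \<Rightarrow> real) \<Rightarrow> real^3 \<Rightarrow> real^3" where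
  "surface_gradient f x = (SOME g. has_surface_gradient f g x)"

definition surface_curl :: "(real^3 \<Rightarrow> real) \<Rightarrow> real^3 \<Rightarrow> real^3" where
  "surface_curl f x = - cross3 x (surface_gradient f x)"

text \<open>The coordinate expression of the Laplace--Beltrami operator has no meaning at the two poles,
  where the division convention makes the value 0. The poles form a null set of the surface
  measure, and the operator is only used under surface integrals.\<close>

definition laplace_beltrami :: "(real^3 \<Rightarrow> real) \<Rightarrow> real^3 \<Rightarrow> real" where
  "laplace_beltrami u x =
     (let \<phi> = longitude x; \<theta> = colatitude x in
        1 / (sin \<theta>)\<^sup>2 * deriv (deriv (\<lambda>p. u (sph p \<theta>))) \<phi> +
        1 / sin \<theta> * deriv (\<lambda>q. sin q * deriv (\<lambda>r. u (sph \<phi> r)) q) \<theta>)"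


section \<open>Smoothness classes\<close>

text \<open>For a relatively open subset \<open>\<Omega>\<close> of the sphere. A function is \<open>C\<^sup>2\<close> if it is differentiable
  and the Cartesian components of its surface gradient are \<open>C\<^sup>1\<close> functions on \<open>\<Omega>\<close>.\<close>

definition C1_on_surface :: "(real^3) set \<Rightarrow> (real^3 \<Rightarrow> real) \<Rightarrow> bool" where
  "C1_on_surface \<Omega> u \<longleftrightarrow>
     (\<exists>G. (\<forall>x\<in>\<Omega>. has_surface_gradient u (G x) x) \<and> continuous_on \<Omega> G)"

definition C2_on_surface :: "(real^3) set \<Rightarrow> (real^3 \<Rightarrow> real) \<Rightarrow> bool" where
  "C2_on_surface \<Omega> u \<longleftrightarrow>
     (\<exists>G. (\<forall>x\<in>\<Omega>. has_surface_gradient u (G x) x) \<and>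
          (\<forall>i. C1_on_surface \<Omega> (\<lambda>x. G x $ i)))"

text \<open>\<open>C\<^sup>1\<close> up to the boundary: the function and its surface gradient on \<open>\<Omega>\<close> extend continuously
  to the closure, the extension of the function being the function itself.\<close>

definition C1_on_closure :: "(real^3) set \<Rightarrow> (real^3 \<Rightarrow> real) \<Rightarrow> bool" where
  "C1_on_closure \<Omega> u \<longleftrightarrow>
     continuous_on (closure \<Omega>) u \<and>
     (\<exists>G. (\<forall>x\<in>\<Omega>. has_surface_gradient u (G x) x) \<and> continuous_on (closure \<Omega>) G)"

text \<open>The value at a boundary point of a field given on \<open>\<Omega>\<close>, by continuous extension.\<close>

definition boundary_value :: "(real^3) set \<Rightarrow> (real^3 \<Rightarrow> real^3) \<Rightarrow> real^3 \<Rightarrow> real^3" where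
  "boundary_value \<Omega> V x = Lim (at x within \<Omega>) V"


section \<open>Curves\<close>

definition C2_periodic_regular :: "(real \<Rightarrow> real^3) \<Rightarrow> bool" where
  "C2_periodic_regular \<gamma> \<longleftrightarrow>
     (\<forall>s. \<gamma> (s + 1) = \<gamma> s) \<and>
     (\<exists>\<gamma>' \<gamma>''.
        (\<forall>s. (\<gamma> has_vector_derivative \<gamma>' s) (at s) \<and>
             (\<gamma>' has_vector_derivative \<gamma>'' s) (at s) \<and> \<gamma>' s \<noteq> 0) \<and>
        continuous_on UNIV \<gamma>'')"

text \<open>\<open>\<gamma>\<close> parametrizes the simple closed curve \<open>C\<close> of class \<open>C\<^sup>2\<close>, in either direction.\<close>

definition parametrizes_C2_curve :: "(real \<Rightarrow> real^3) \<Rightarrow> (real^3) set \<Rightarrow> bool" where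
  "parametrizes_C2_curve \<gamma> C \<longleftrightarrow>
     C2_periodic_regular \<gamma> \<and> simple_path \<gamma> \<and> path_image \<gamma> = C"

definition arc_length_integral :: "(real \<Rightarrow> real^3) \<Rightarrow> (real^3 \<Rightarrow> real) \<Rightarrow> real" where
  "arc_length_integral \<gamma> f =
     integral {0..1} (\<lambda>s. f (\<gamma> s) * norm (vector_derivative \<gamma> (at s)))"

definition unit_tangent_field :: "(real \<Rightarrow> real^3) \<Rightarrow> (real^3 \<Rightarrow> real^3) \<Rightarrow> bool" where
  "unit_tangent_field \<gamma> t \<longleftrightarrow>
     (\<forall>s. norm (t (\<gamma> s)) = 1 \<and> (\<exists>c. t (\<gamma> s) = c *\<^sub>R vector_derivative \<gamma> (at s)))"

text \<open>Seen from outside the sphere, the direction to the left of \<open>t\<close> at \<open>x\<close> is \<open>x \<times> t\<close>. The region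
  \<open>\<Omega>\<close> lies to the left of \<open>t\<close> if the great circle leaving \<open>x\<close> in that direction initially runs
  in \<open>\<Omega>\<close>.\<close>

definition positively_oriented ::
    "(real^3) set \<Rightarrow> (real^3 \<Rightarrow> real^3) \<Rightarrow> (real^3) set \<Rightarrow> bool" where
  "positively_oriented C t \<Omega> \<longleftrightarrow>
     (\<forall>x\<in>C. \<forall>\<^sub>F \<epsilon> in at_right 0. cos \<epsilon> *\<^sub>R x + sin \<epsilon> *\<^sub>R cross3 x (t x) \<in> \<Omega>)"


section \<open>Fundamental solution and integrals up to the curve\<close>

definition Ustar :: "real^3 \<Rightarrow> real^3 \<Rightarrow> real" where
  "Ustar x x0 = - (1 / (4 * pi)) * ln \<bar>1 - x \<bullet> x0\<bar>"

text \<open>\<open>I\<close> is the integral of \<open>f\<close> over \<open>\<Omega>\<close>: the Lebesgue integral if \<open>f\<close> is integrable on \<open>\<Omega>\<close>, and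
  otherwise the limit of the integrals over the points of \<open>\<Omega>\<close> farther than \<open>\<delta>\<close> from \<open>C\<close>.\<close>

definition has_surface_integral_upto ::
    "(real^3 \<Rightarrow> real) \<Rightarrow> real \<Rightarrow> (real^3) set \<Rightarrow> (real^3) set \<Rightarrow> bool" where
  "has_surface_integral_upto f I \<Omega> C \<longleftrightarrow>
     (if set_integrable sphere_measure \<Omega> f
      then I = (LINT x:\<Omega>|sphere_measure. f x)
      else (\<forall>\<delta>>0. set_integrable sphere_measure {x \<in> \<Omega>. infdist x C > \<delta>} f) \<and>
           ((\<lambda>\<delta>. LINT x:{x \<in> \<Omega>. infdist x C > \<delta>}|sphere_measure. f x) \<longlongrightarrow> I) (at_right 0))"

end

theory Submission
  imports Defs
begin

text \<open>
  Let \<open>\<tau> = (x, x\<^sub>0)\<close>. Replacing \<open>U\<^sup>*\<close> by \<open>U\<^sub>a = -(1/4\<pi>) ln (a - \<tau>)\<close> with \<open>a > 1\<close> removes the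
  singularity: \<open>U\<^sub>a\<close> is smooth on the whole sphere and
  \<open>\<Delta> U\<^sub>a = 1/(4\<pi>) - (a\<^sup>2 - 1) / (4\<pi> (a - \<tau>)\<^sup>2)\<close>, where the subtracted kernel is positive, has total
  mass 1 (the integral of \<open>\<Delta> U\<^sub>a\<close> over the closed sphere vanishes) and concentrates at \<open>x\<^sub>0\<close> as
  \<open>a \<rightarrow> 1\<close>. So Green's second identity for \<open>u\<close> and \<open>U\<^sub>a\<close> on the points of \<open>S\<^sub>2\<close> at distance
  more than \<open>\<delta>\<close> from the curve gives the formula, first letting \<open>a \<rightarrow> 1\<close> and then \<open>\<delta> \<rightarrow> 0\<close>.

  Green's identity is the divergence theorem for a tangential field \<open>W\<close>, split by a cutoff into a part
  vanishing near the curve and a part supported near it. The first extends by zero to the closed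
  sphere, and homogeneously to a compactly supported field on the ambient space, where the integral
  of each partial derivative is zero by translation invariance. For the second, the coordinates
  \<open>(s, r) \<mapsto> cos r \<gamma>(s) + sin r n(s)\<close> along the geodesics normal to the curve have the parallel curves
  as coordinate lines, and the statement is Fubini's theorem with the fundamental theorem of calculus.
\<close>

section \<open>Surface gradients\<close>

text \<open>Integrals of functions of \<open>x \<bullet> x0\<close> are therefore not reduced to one
  variable; the mass of the kernel, the nullity of points and the integrability of
  \<open>Ustar\<close> all come from the vanishing integral of a divergence, applied to zonal
  fields. A change of variables on cones ties the surface measure to Lebesgue measure, for spherical
  and tubular coordinates alike. Derivatives are extrinsic for the same reason: the Laplacian is the
  trace of the gradients of the components of the gradient, which has no poles. The order of the
  limits is forced by the hypotheses. The Laplacian need not be integrable up to the curve, so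
  \<open>a \<rightarrow> 1\<close> is taken at a fixed distance from it, where the Laplacian is
  bounded; afterwards only \<open>u\<close> and its gradient have to extend to the curve.\<close>

lemma has_surface_gradient_ambient:
  assumes "norm x = 1" and f: "(f has_derivative (\<lambda>h. g \<bullet> h)) (at x)"
  shows "has_surface_gradient f (g - (g \<bullet> x) *\<^sub>R x) x"
proof -
  let ?c = "g \<bullet> x"
  \<comment> \<open>The subtracted function vanishes on the sphere and has gradient
    \<open>?c *\<^sub>R x\<close> at \<open>x\<close>, so it removes the normal part of
    \<open>g\<close> without changing \<open>f\<close> there.\<close>
  have "((\<lambda>y. f y - ?c * (y \<bullet> y - 1) / 2) has_derivative (\<lambda>h. (g - ?c *\<^sub>R x) \<bullet> h)) (at x within unit_sphere)"
    by (rule has_derivative_eq_rhs, (rule derivative_eq_intros has_derivative_at_withinI[OF f] refl)+)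
       (auto simp: inner_diff_left inner_diff_right fun_eq_iff inner_commute)
  moreover have "f y = f y - ?c * (y \<bullet> y - 1) / 2" if "y \<in> unit_sphere" for y
    using that by (simp add: dot_square_norm)
  ultimately have "(f has_derivative (\<lambda>h. (g - ?c *\<^sub>R x) \<bullet> h)) (at x within unit_sphere)"
    using assms(1) by (intro has_derivative_transform[of x unit_sphere f "\<lambda>y. f y - ?c * (y \<bullet> y - 1) / 2"]) (simp_all only: mem_sphere_0)
  then show ?thesis
    using assms by (simp add: has_surface_gradient_def inner_diff_left dot_square_norm)
qed

lemma surface_gradient_along_map:
  assumes f: "has_surface_gradient f g (c a)" and c: "(c has_derivative c') (at a within T)"
    and T: "c ` T \<subseteq> unit_sphere"
  shows "((\<lambda>z. f (c z)) has_derivative (\<lambda>h. g \<bullet> c' h)) (at a within T)"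
proof -
  have "(f has_derivative (\<lambda>h. g \<bullet> h)) (at (c a) within c ` T)"
    using f T unfolding has_surface_gradient_def by (blast intro: has_derivative_subset)
  from has_derivative_in_compose[OF c this] show ?thesis .
qed

lemma surface_gradient_along_curve:
  assumes f: "has_surface_gradient f g (c a)" and c: "(c has_vector_derivative c') (at a)"
    and "\<And>z. c z \<in> unit_sphere"
  shows "((\<lambda>z. f (c z)) has_real_derivative g \<bullet> c') (at a)"
  using surface_gradient_along_map[OF f c[unfolded has_vector_derivative_def]] assms(3)
  by (auto simp: has_field_derivative_def image_subset_iff mult.commute[of "g \<bullet> c'"] mult_commute_abs)

lemma has_derivative_sgn:
  fixes y :: "'a::real_inner"
  assumes "y \<noteq> 0"
  shows "(sgn has_derivative (\<lambda>h. (1 / norm y) *\<^sub>R (h - ((y \<bullet> h) / (norm y)\<^sup>2) *\<^sub>R y))) (at y)"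
proof -
  have "((\<lambda>y. inverse (norm y) *\<^sub>R y) has_derivative
      (\<lambda>h. (1 / norm y) *\<^sub>R (h - ((y \<bullet> h) / (norm y)\<^sup>2) *\<^sub>R y))) (at y)"
    apply (rule has_derivative_eq_rhs)
     apply (rule derivative_intros has_derivative_norm[THEN has_derivative_compose] assms | simp add: assms)+
    apply (simp add: fun_eq_iff sgn_div_norm scaleR_diff_right power2_eq_square divide_simps inner_commute)
    done
  then show ?thesis by (simp add: sgn_div_norm[abs_def])
qed

lemma sgn_in_unit_sphere: "y \<noteq> 0 \<Longrightarrow> sgn y \<in> unit_sphere"
  by (simp add: norm_sgn)

text \<open>The derivative of \<open>sgn\<close> at \<open>y\<close> is the tangential projection
  divided by \<open>norm y\<close>, and the projection is invisible to \<open>g\<close>, which is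
  orthogonal to \<open>y\<close>. This turns derivatives within the sphere into derivatives on an
  open set.\<close>

lemma has_derivative_radial_extension:
  assumes f: "has_surface_gradient f g (sgn y)" and y: "y \<noteq> 0"
  shows "((\<lambda>y. f (sgn y)) has_derivative (\<lambda>h. (g \<bullet> h) / norm y)) (at y)"
proof -
  have "((\<lambda>y. f (sgn y)) has_derivative (\<lambda>h. g \<bullet> ((1 / norm y) *\<^sub>R (h - ((y \<bullet> h) / (norm y)\<^sup>2) *\<^sub>R y))))
      (at y within - {0})"
    by (rule surface_gradient_along_map[OF f has_derivative_at_withinI[OF has_derivative_sgn[OF y]]])
       (auto simp: norm_sgn split: if_splits)
  moreover have "g \<bullet> y = 0"
    using f y by (simp add: has_surface_gradient_def sgn_div_norm)
  moreover have "at y within - {0} = at y"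
    using y by (intro at_within_open) auto
  ultimately show ?thesis
    by (simp add: inner_diff_right)
qed

text \<open>Both candidates give the full derivative of the same radial extension, and full
  derivatives are unique. This pins down the choice in \<open>surface_gradient\<close>.\<close>

lemma has_surface_gradient_unique:
  assumes "has_surface_gradient f g x" "has_surface_gradient f g' x" "x \<in> unit_sphere"
  shows "g = g'"
proof -
  have x: "sgn x = x" "x \<noteq> 0" "norm x = 1"
    using assms(3) by (auto simp: sgn_div_norm)
  have "(\<lambda>h. (g \<bullet> h) / norm x) = (\<lambda>h. (g' \<bullet> h) / norm x)"
    using has_derivative_radial_extension[of f _ x] assms x
    by (intro has_derivative_unique[of "\<lambda>y. f (sgn y)" _ x]) auto
  then have "g \<bullet> h = g' \<bullet> h" for h
    using x by (simp add: fun_eq_iff)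
  then show ?thesis
    by (metis vector_eq_rdot)
qed

lemma surface_gradient_eq:
  "has_surface_gradient f g x \<Longrightarrow> x \<in> unit_sphere \<Longrightarrow> surface_gradient f x = g"
  unfolding surface_gradient_def by (rule some_equality) (auto intro: has_surface_gradient_unique)

lemma has_surface_gradient_const: "has_surface_gradient (\<lambda>_. c) 0 x"
  by (simp add: has_surface_gradient_def)

lemma has_surface_gradient_diff:
  "has_surface_gradient f a x \<Longrightarrow> has_surface_gradient g b x \<Longrightarrow>
   has_surface_gradient (\<lambda>y. f y - g y) (a - b) x"
  by (auto simp: has_surface_gradient_def inner_diff_left intro!: has_derivative_diff)

lemma has_surface_gradient_mult:
  assumes "has_surface_gradient f a x" "has_surface_gradient g b x"
  shows "has_surface_gradient (\<lambda>y. f y * g y) (f x *\<^sub>R b + g x *\<^sub>R a) x"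
proof -
  have "((\<lambda>y. f y * g y) has_derivative (\<lambda>h. f x * (b \<bullet> h) + (a \<bullet> h) * g x)) (at x within unit_sphere)"
    using assms by (intro has_derivative_mult) (auto simp: has_surface_gradient_def)
  then show ?thesis
    using assms by (auto simp: has_surface_gradient_def inner_add_left mult.commute)
qed

lemma has_surface_gradient_compose:
  assumes f: "has_surface_gradient f a x" and p: "(p has_real_derivative d) (at (f x))"
  shows "has_surface_gradient (\<lambda>y. p (f y)) (d *\<^sub>R a) x"
proof -
  have "(f has_derivative (\<lambda>h. a \<bullet> h)) (at x within unit_sphere)" "a \<bullet> x = 0"
    using f by (simp_all add: has_surface_gradient_def)
  from has_derivative_compose[OF this(1) p[unfolded has_field_derivative_def]] this(2)
  show ?thesis
    by (simp add: has_surface_gradient_def)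
qed

lemma has_surface_gradient_cong_ev:
  assumes "has_surface_gradient f a x" "x \<in> unit_sphere"
    and "openin (top_of_set unit_sphere) T" "x \<in> T" "\<And>y. y \<in> T \<Longrightarrow> f y = g y"
  shows "has_surface_gradient g a x"
proof -
  obtain d where "d > 0" and d: "\<And>y. y \<in> unit_sphere \<Longrightarrow> dist y x < d \<Longrightarrow> y \<in> T"
    using assms(3,4) by (auto simp: openin_euclidean_subtopology_iff)
  have "(g has_derivative (\<lambda>h. a \<bullet> h)) (at x within unit_sphere)"
    by (rule has_derivative_transform_within[of f _ _ _ d])
       (use assms d \<open>d > 0\<close> in \<open>auto simp: has_surface_gradient_def\<close>)
  then show ?thesis
    using assms(1) by (simp add: has_surface_gradient_def)
qed

lemma has_surface_gradient_continuous:
  "has_surface_gradient f a x \<Longrightarrow> continuous (at x within unit_sphere) f"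
  by (auto simp: has_surface_gradient_def intro: has_derivative_continuous)

lemma has_surface_gradient_continuous_on:
  assumes "\<And>x. x \<in> \<Omega> \<Longrightarrow> has_surface_gradient f (G x) x" "\<Omega> \<subseteq> unit_sphere"
  shows "continuous_on \<Omega> f"
  using assms has_surface_gradient_continuous continuous_within_subset
  unfolding continuous_on_eq_continuous_within by blast

lemma continuous_on_componentwise_vec:
  fixes G :: "'a::topological_space \<Rightarrow> real^'n"
  assumes "\<And>i. continuous_on S (\<lambda>x. G x $ i)"
  shows "continuous_on S G"
  using continuous_on_vec_lambda[of S "\<lambda>i x. G x $ i"] assms by simp

section \<open>Spherical coordinates\<close>

lemma sph_nth [simp]:
  "sph p q $ 1 = cos p * sin q" "sph p q $ 2 = sin p * sin q" "sph p q $ 3 = cos q"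
  by (simp_all add: sph_def)

lemma norm_sph [simp]: "norm (sph p q) = 1"
proof -
  have "sph p q \<bullet> sph p q = (sin q)\<^sup>2 * ((cos p)\<^sup>2 + (sin p)\<^sup>2) + (cos q)\<^sup>2"
    unfolding inner_vec_def sum_3 sph_nth inner_real_def by algebra
  then show ?thesis
    by (simp add: norm_eq_1)
qed

text \<open>The poles are included: there the sine of the colatitude vanishes, so the longitude does
  not matter.\<close>

lemma sph_longitude_colatitude:
  assumes "norm x = 1"
  shows "sph (longitude x) (colatitude x) = x"
proof -
  have n: "(x$1)\<^sup>2 + (x$2)\<^sup>2 + (x$3)\<^sup>2 = 1"
    using assms by (simp add: norm_eq_1 inner_vec_def sum_3 power2_eq_square)
  have x3: "-1 \<le> x$3" "x$3 \<le> 1"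
    using component_le_norm_cart[of x 3] assms by auto
  have c: "cos (colatitude x) = x$3"
    by (simp add: colatitude_def x3)
  have s: "sin (colatitude x) = sqrt ((x$1)\<^sup>2 + (x$2)\<^sup>2)"
    using n x3 by (simp add: colatitude_def sin_arccos algebra_simps)
  let ?z = "Complex (x$1) (x$2)"
  have "x$1 = norm ?z * cos (Arg2pi ?z)" "x$2 = norm ?z * sin (Arg2pi ?z)"
    using cos_Arg2pi[of ?z] sin_Arg2pi[of ?z] by simp_all
  moreover have "norm ?z = sin (colatitude x)"
    by (simp add: s cmod_def)
  ultimately have "sph (longitude x) (colatitude x) $ 1 = x $ 1"
      "sph (longitude x) (colatitude x) $ 2 = x $ 2" "sph (longitude x) (colatitude x) $ 3 = x $ 3"
    unfolding sph_nth longitude_def c by (simp_all only: mult.commute)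
  then show ?thesis
    unfolding vec_eq_iff forall_3 by blast
qed

section \<open>The Laplace--Beltrami operator as a divergence\<close>

lemma has_vector_derivative_componentwise:
  fixes c :: "real \<Rightarrow> real^'n"
  assumes "\<And>i. ((\<lambda>t. c t $ i) has_real_derivative c' $ i) (at a within T)"
  shows "(c has_vector_derivative c') (at a within T)"
  unfolding has_vector_derivative_def
  by (subst has_derivative_componentwise_within)
     (use assms in \<open>auto simp: Basis_vec_def inner_axis has_field_derivative_def mult_commute_abs\<close>)

definition sph_phi :: "real \<Rightarrow> real \<Rightarrow> real^3" where
  "sph_phi p q = vector [- (sin p * sin q), cos p * sin q, 0]"

definition sph_theta :: "real \<Rightarrow> real \<Rightarrow> real^3" where
  "sph_theta p q = vector [cos p * cos q, sin p * cos q, - sin q]"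

lemma sph_phi_nth [simp]:
  "sph_phi p q $ 1 = - (sin p * sin q)" "sph_phi p q $ 2 = cos p * sin q" "sph_phi p q $ 3 = 0"
  by (simp_all add: sph_phi_def)

lemma sph_theta_nth [simp]:
  "sph_theta p q $ 1 = cos p * cos q" "sph_theta p q $ 2 = sin p * cos q" "sph_theta p q $ 3 = - sin q"
  by (simp_all add: sph_theta_def)

lemma has_vector_derivative_sph:
  shows "((\<lambda>p. sph p q) has_vector_derivative sph_phi p q) (at p)"
    and "((\<lambda>q. sph p q) has_vector_derivative sph_theta p q) (at q)"
proof -
  show "((\<lambda>p. sph p q) has_vector_derivative sph_phi p q) (at p)"
  proof (rule has_vector_derivative_componentwise)
    show "((\<lambda>p. sph p q $ i) has_real_derivative sph_phi p q $ i) (at p)" for i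
      using exhaust_3[of i] by (auto intro!: derivative_eq_intros)
  qed
  show "((\<lambda>q. sph p q) has_vector_derivative sph_theta p q) (at q)"
  proof (rule has_vector_derivative_componentwise)
    show "((\<lambda>q. sph p q $ i) has_real_derivative sph_theta p q $ i) (at q)" for i
      using exhaust_3[of i] by (auto intro!: derivative_eq_intros)
  qed
qed

text \<open>With \<open>P, Q\<close> the cosine and sine of the longitude and \<open>S, T\<close>
  those of the colatitude, this expands \<open>(a, b, c)\<close> in the orthonormal frame
  \<open>(-Q, P, 0)\<close>, \<open>(P S, Q S, -T)\<close>, \<open>(P T, Q T, S)\<close>.\<close>

lemma frame_algebra:
  fixes a b c P Q S T :: real
  shows "P\<^sup>2 + Q\<^sup>2 = 1 \<Longrightarrow> S\<^sup>2 + T\<^sup>2 = 1 \<Longrightarrow> (- a * Q + b * P) * (- Q)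
      + (a * (P * S) + b * (Q * S) + c * - T) * (P * S) + (a * (P * T) + b * (Q * T) + c * S) * (P * T) = a"
    and "P\<^sup>2 + Q\<^sup>2 = 1 \<Longrightarrow> S\<^sup>2 + T\<^sup>2 = 1 \<Longrightarrow> (- a * Q + b * P) * P
      + (a * (P * S) + b * (Q * S) + c * - T) * (Q * S) + (a * (P * T) + b * (Q * T) + c * S) * (Q * T) = b"
    and "S\<^sup>2 + T\<^sup>2 = 1 \<Longrightarrow>
      (a * (P * S) + b * (Q * S) + c * - T) * - T + (a * (P * T) + b * (Q * T) + c * S) * S = c"
  by algebra+

text \<open>Expansion in the orthogonal frame of coordinate vectors and position;
  \<open>sph_phi\<close> has length \<open>\<bar>sin q\<bar>\<close>, whence the
  denominator.\<close>

lemma sph_frame: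
  assumes "sin q \<noteq> 0"
  shows "(v \<bullet> sph_phi p q) * sph_phi p q $ i / (sin q)\<^sup>2 + (v \<bullet> sph_theta p q) * sph_theta p q $ i
     + (v \<bullet> sph p q) * sph p q $ i = v $ i"
proof -
  have p: "(cos p)\<^sup>2 + (sin p)\<^sup>2 = 1" and q: "(cos q)\<^sup>2 + (sin q)\<^sup>2 = 1"
    by simp_all
  have e: "(v \<bullet> sph_phi p q) * sph_phi p q $ i / (sin q)\<^sup>2 =
    (- v $ 1 * sin p + v $ 2 * cos p) * (if i = 1 then - sin p else if i = 2 then cos p else 0)"
    using assms exhaust_3[of i]
    by (auto simp: inner_vec_def sum_3 field_simps power2_eq_square)
  have "(- v $ 1 * sin p + v $ 2 * cos p) * (if i = 1 then - sin p else if i = 2 then cos p else 0)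
      + (v \<bullet> sph_theta p q) * sph_theta p q $ i + (v \<bullet> sph p q) * sph p q $ i = v $ i"
    unfolding inner_vec_def sum_3 inner_real_def sph_nth sph_theta_nth
  proof -
    consider "i = 1" | "i = 2" | "i = 3"
      using exhaust_3[of i] by blast
    then show "(- v $ 1 * sin p + v $ 2 * cos p) * (if i = 1 then - sin p else if i = 2 then cos p else 0) +
      (v $ 1 * (cos p * cos q) + v $ 2 * (sin p * cos q) + v $ 3 * - sin q) * sph_theta p q $ i +
      (v $ 1 * (cos p * sin q) + v $ 2 * (sin p * sin q) + v $ 3 * cos q) * sph p q $ i = v $ i"
    proof cases
      case 1
      then show ?thesis using frame_algebra(1)[OF p q, of "v $ 1" "v $ 2" "v $ 3"] by simp
    next
      case 2
      then show ?thesis using frame_algebra(2)[OF p q, of "v $ 1" "v $ 2" "v $ 3"] by simp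
    next
      case 3
      then show ?thesis using frame_algebra(3)[OF q, of "v $ 1" "cos p" "v $ 2" "sin p" "v $ 3"] by simp
    qed
  qed
  then show ?thesis
    by (simp only: e)
qed

text \<open>An equation at the single parameter \<open>a\<close> would not suffice: the first
  derivative is to be replaced under a second \<open>deriv\<close>, which needs a
  neighbourhood.\<close>

lemma deriv_along_open:
  assumes \<Omega>: "openin (top_of_set unit_sphere) \<Omega>" and c0: "c a \<in> \<Omega>"
    and c: "\<And>z. (c has_vector_derivative c' z) (at z)" and sph: "\<And>z. c z \<in> unit_sphere"
    and u: "\<And>y. y \<in> \<Omega> \<Longrightarrow> has_surface_gradient u (G y) y"
  shows "\<forall>\<^sub>F z in nhds a. c z \<in> \<Omega> \<and> deriv (\<lambda>z. u (c z)) z = G (c z) \<bullet> c' z"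
proof -
  obtain T where T: "open T" "\<Omega> = unit_sphere \<inter> T"
    using \<Omega> by (auto simp: openin_open)
  have "continuous (at a) c"
    by (rule has_vector_derivative_continuous[OF c])
  then have "(c \<longlongrightarrow> c a) (nhds a)"
    by (simp add: continuous_at tendsto_at_iff_tendsto_nhds)
  then have "\<forall>\<^sub>F z in nhds a. c z \<in> T"
    using T c0 by (intro topological_tendstoD) auto
  then show ?thesis
  proof eventually_elim
    case (elim z)
    then have "c z \<in> \<Omega>" using T sph by auto
    from surface_gradient_along_curve[OF u[OF this] c sph] this
    show ?case by (auto intro: DERIV_imp_deriv)
  qed
qed

text \<open>The coordinate formula is the trace of the derivative of \<open>G\<close>, computed in
  the frame of parallels and meridians. The normal direction contributes nothing because each
  \<open>H i x\<close> is tangential, and the first-order terms cancel. At the poles the frame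
  degenerates.\<close>

lemma laplace_beltrami_eq_divergence:
  assumes \<Omega>: "openin (top_of_set unit_sphere) \<Omega>" "x \<in> \<Omega>" and np: "x $ 1 \<noteq> 0 \<or> x $ 2 \<noteq> 0"
    and G: "\<And>y. y \<in> \<Omega> \<Longrightarrow> has_surface_gradient u (G y) y"
    and H: "\<And>i y. y \<in> \<Omega> \<Longrightarrow> has_surface_gradient (\<lambda>y. G y $ i) (H i y) y"
  shows "laplace_beltrami u x = (\<Sum>i\<in>UNIV. H i x $ i)"
proof -
  define p q where "p = longitude x" and "q = colatitude x"
  have nx: "norm x = 1"
    using \<Omega> openin_imp_subset by fastforce
  have x: "x = sph p q"
    unfolding p_def q_def by (rule sph_longitude_colatitude[OF nx, symmetric])
  have sq: "sin q \<noteq> 0"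
    using np unfolding x by auto
  have curve: "((\<lambda>t. G (c t) \<bullet> v t) has_real_derivative
      (\<Sum>i\<in>UNIV. (H i (c a) \<bullet> c' a) * v a $ i) + G (c a) \<bullet> v') (at a)"
    if "c a = x" and c: "\<And>t. (c has_vector_derivative c' t) (at t)" "\<And>t. c t \<in> unit_sphere"
      and v: "(v has_vector_derivative v') (at a)" for c :: "real \<Rightarrow> real^3" and c' v v' a
  proof -
    have 1: "((\<lambda>t. G (c t) $ i) has_real_derivative H i (c a) \<bullet> c' a) (at a)" for i
      by (rule surface_gradient_along_curve[OF H c]) (use that \<Omega> in auto)
    have 2: "((\<lambda>t. v t $ i) has_real_derivative v' $ i) (at a)" for i
      using bounded_linear.has_vector_derivative[OF bounded_linear_vec_nth v]
      by (simp add: has_real_derivative_iff_has_vector_derivative)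
    have "((\<lambda>t. \<Sum>i\<in>UNIV. G (c t) $ i * v t $ i) has_real_derivative
        (\<Sum>i\<in>UNIV. G (c a) $ i * v' $ i + (H i (c a) \<bullet> c' a) * v a $ i)) (at a)"
      by (rule DERIV_sum, rule DERIV_mult'[OF 1 2])
    then show ?thesis
      by (simp add: inner_vec_def[of "G _"] sum.distrib add.commute)
  qed
  \<comment> \<open>The last term pairs \<open>G\<close> with the acceleration of the parallel,
    which is not a geodesic away from the equator.\<close>
  have d1: "deriv (deriv (\<lambda>p. u (sph p q))) p =
      (\<Sum>i\<in>UNIV. (H i x \<bullet> sph_phi p q) * sph_phi p q $ i) - sin q * (cos p * G x $ 1 + sin p * G x $ 2)"
  proof -
    have "deriv (deriv (\<lambda>p. u (sph p q))) p = deriv (\<lambda>p. G (sph p q) \<bullet> sph_phi p q) p"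
      by (rule deriv_cong_ev[OF eventually_mono[OF deriv_along_open[OF \<Omega>(1), where u = u and G = G]]])
         (use x \<Omega> G has_vector_derivative_sph in auto)
    also have "\<dots> = (\<Sum>i\<in>UNIV. (H i (sph p q) \<bullet> sph_phi p q) * sph_phi p q $ i)
        + G (sph p q) \<bullet> vector [- (cos p * sin q), - (sin p * sin q), 0]"
    proof (rule DERIV_imp_deriv, rule curve)
      show "((\<lambda>p. sph_phi p q) has_vector_derivative vector [- (cos p * sin q), - (sin p * sin q), 0]) (at p)"
      proof (rule has_vector_derivative_componentwise)
        show "((\<lambda>p. sph_phi p q $ i) has_real_derivative
            vector [- (cos p * sin q), - (sin p * sin q), 0] $ i) (at p)" for i
          using exhaust_3[of i] by (auto intro!: derivative_eq_intros)
      qed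
    qed (use x has_vector_derivative_sph in auto)
    finally show ?thesis
      by (simp add: x inner_vec_def sum_3 algebra_simps)
  qed
  have d2: "deriv (\<lambda>r. sin r * deriv (\<lambda>r. u (sph p r)) r) q =
      cos q * (G x \<bullet> sph_theta p q) +
      sin q * ((\<Sum>i\<in>UNIV. (H i x \<bullet> sph_theta p q) * sph_theta p q $ i) - G x \<bullet> sph p q)"
  proof -
    have "deriv (\<lambda>r. sin r * deriv (\<lambda>r. u (sph p r)) r) q = deriv (\<lambda>r. sin r * (G (sph p r) \<bullet> sph_theta p r)) q"
      by (rule deriv_cong_ev[OF eventually_mono[OF deriv_along_open[OF \<Omega>(1), where u = u and G = G]]])
         (use x \<Omega> G has_vector_derivative_sph in auto)
    also have "\<dots> = sin q * ((\<Sum>i\<in>UNIV. (H i (sph p q) \<bullet> sph_theta p q) * sph_theta p q $ i)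
        + G (sph p q) \<bullet> (- sph p q)) + cos q * (G (sph p q) \<bullet> sph_theta p q)"
    proof (rule DERIV_imp_deriv, rule DERIV_mult'[OF DERIV_sin], rule curve)
      show "((\<lambda>r. sph_theta p r) has_vector_derivative - sph p q) (at q)"
      proof (rule has_vector_derivative_componentwise)
        show "((\<lambda>r. sph_theta p r $ i) has_real_derivative (- sph p q) $ i) (at q)" for i
          using exhaust_3[of i] by (auto intro!: derivative_eq_intros)
      qed
    qed (use x has_vector_derivative_sph in auto)
    finally show ?thesis
      by (simp add: x)
  qed
  have Gx: "G x \<bullet> sph p q = 0" and Hx: "H i x \<bullet> sph p q = 0" for i
    using G H \<Omega> by (auto simp: has_surface_gradient_def simp flip: x)
  \<comment> \<open>Tangency of \<open>G\<close> is what makes the acceleration term of the parallel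
    cancel the term that arises from differentiating \<open>sin r\<close> along the
    meridian.\<close>
  have A: "G x \<bullet> sph_theta p q * cos q = cos p * G x $ 1 + sin p * G x $ 2"
  proof -
    have "(cos p * G x $ 1 + sin p * G x $ 2) * sin q + G x $ 3 * cos q = 0"
      using Gx by (simp add: inner_vec_def sum_3 algebra_simps)
    moreover have "(cos q)\<^sup>2 + (sin q)\<^sup>2 = 1" by simp
    ultimately show ?thesis
      unfolding inner_vec_def sum_3 inner_real_def sph_theta_nth by algebra
  qed
  have "laplace_beltrami u x =
     (\<Sum>i\<in>UNIV. (H i x \<bullet> sph_phi p q) * sph_phi p q $ i / (sin q)\<^sup>2 + (H i x \<bullet> sph_theta p q) * sph_theta p q $ i)"
    unfolding laplace_beltrami_def Let_def p_def[symmetric] q_def[symmetric] d1 d2 Gx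
    using sq A by (simp add: sum.distrib sum_divide_distrib[symmetric] field_simps power2_eq_square sum_distrib_left)
  also have "\<dots> = (\<Sum>i\<in>UNIV. H i x $ i)"
    using sph_frame[OF sq, of "H _ x" p] Hx by (intro sum.cong) auto
  finally show ?thesis .
qed

section \<open>A radial bump function and product integrals\<close>

text \<open>Fubini separates the radius from the pair of surface parameters on a product type, while
  the Jacobian determinant lives on \<open>real^3\<close>; this map passes between the two.\<close>

definition vec3 :: "real \<times> real \<times> real \<Rightarrow> real^3" where
  "vec3 z = vector [fst z, fst (snd z), snd (snd z)]"

lemma vec3_nth [simp]:
  "vec3 z $ 1 = fst z" "vec3 z $ 2 = fst (snd z)" "vec3 z $ 3 = snd (snd z)"
  by (simp_all add: vec3_def)

lemma vec3_measurable [measurable]: "vec3 \<in> borel_measurable borel"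
proof -
  have "continuous_on UNIV (\<lambda>z. vec3 z $ i)" for i
    using exhaust_3[of i] by (auto simp: continuous_on_fst continuous_on_snd continuous_on_id)
  then have "continuous_on UNIV vec3"
    by (rule continuous_on_componentwise_vec)
  then show ?thesis
    by (rule borel_measurable_continuous_onI)
qed

lemma prod_Basis_3:
  fixes f :: "real^3 \<Rightarrow> 'a::comm_monoid_mult"
  shows "(\<Prod>b\<in>Basis. f b) = f (axis 1 1) * f (axis 2 1) * f (axis 3 1)"
proof -
  have "(Basis :: (real^3) set) = (\<lambda>i. axis i 1) ` UNIV"
    by (auto simp: Basis_vec_def)
  also have "prod f \<dots> = (\<Prod>i\<in>UNIV. f (axis i 1))"
    by (subst prod.reindex) (auto simp: inj_on_def axis_eq_axis)
  also have "\<dots> = f (axis 1 1) * f (axis 2 1) * f (axis 3 1)"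
    unfolding UNIV_3 by (simp add: ac_simps)
  finally show ?thesis .
qed

lemma distr_vec3: "distr lborel borel vec3 = (lborel :: (real^3) measure)"
proof (rule lborel_eqI[symmetric])
  fix l u :: "real^3"
  assume le: "\<And>b. b \<in> Basis \<Longrightarrow> l \<bullet> b \<le> u \<bullet> b"
  have le': "l $ i \<le> u $ i" for i
    using le[of "axis i 1"] by (auto simp: inner_axis Basis_vec_def)
  have "vec3 -` box l u = {l$1<..<u$1} \<times> {l$2<..<u$2} \<times> {l$3<..<u$3}"
    by (auto simp: mem_box_cart forall_3)
  then have "emeasure (distr lborel borel vec3) (box l u) =
      emeasure (lborel \<Otimes>\<^sub>M (lborel \<Otimes>\<^sub>M lborel)) ({l$1<..<u$1} \<times> {l$2<..<u$2} \<times> {l$3<..<u$3})"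
    by (simp add: emeasure_distr lborel_prod)
  also have "\<dots> = ennreal (u$1 - l$1) * (ennreal (u$2 - l$2) * ennreal (u$3 - l$3))"
    using le' by (subst sigma_finite_measure.emeasure_pair_measure_Times;
        (subst lborel.emeasure_pair_measure_Times)?) (auto simp: lborel_prod sigma_finite_lborel)
  also have "\<dots> = (\<Prod>b\<in>Basis. (u - l) \<bullet> b)"
    using le' by (simp add: prod_Basis_3 inner_axis ennreal_mult mult.assoc)
  finally show "emeasure (distr lborel borel vec3) (box l u) = (\<Prod>b\<in>Basis. (u - l) \<bullet> b)" .
qed simp

lemma integral_product_lborel:
  fixes f :: "'a::euclidean_space \<Rightarrow> real" and g :: "'b::euclidean_space \<Rightarrow> real"
  assumes f: "integrable lborel f" and g: "integrable lborel g"
  shows "integrable lborel (\<lambda>z. f (fst z) * g (snd z))"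
    and "(LINT z|lborel. f (fst z) * g (snd z)) = (LINT x|lborel. f x) * (LINT y|lborel. g y)"
proof -
  have [measurable]: "f \<in> borel_measurable borel" "g \<in> borel_measurable borel"
    using f g by auto
  have *: "integrable (lborel \<Otimes>\<^sub>M lborel) (\<lambda>z. f (fst z) * g (snd z))"
  proof (rule lborel_pair.Fubini_integrable)
    show "integrable lborel (\<lambda>x. LINT y|lborel. norm (f (fst (x, y)) * g (snd (x, y))))"
      using f by (simp add: abs_mult)
  qed (use g in auto)
  then show "integrable lborel (\<lambda>z. f (fst z) * g (snd z))"
    by (simp add: lborel_prod)
  show "(LINT z|lborel. f (fst z) * g (snd z)) = (LINT x|lborel. f x) * (LINT y|lborel. g y)"
    using lborel_pair.integral_fst'[OF *] by (simp add: lborel_prod)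
qed

section \<open>A continuously differentiable weight on the interval from 1 to 2\<close>

definition ramp :: "real \<Rightarrow> real" where
  "ramp t = (max 0 t)\<^sup>2"

lemma ramp_deriv: "(ramp has_real_derivative 2 * max 0 t) (at t)"
proof -
  have "(ramp has_real_derivative 2 * max 0 t) (at t within {..0} \<union> {0..})"
  proof (cases t "0::real" rule: linorder_cases)
    case less
    then have "((\<lambda>_. 0) has_real_derivative 2 * max 0 t) (at t)"
      by (auto simp: max_def)
    then have "(ramp has_real_derivative 2 * max 0 t) (at t)"
      by (rule has_field_derivative_transform_within_open[of _ _ _ "{..<0}"])
         (use less in \<open>auto simp: ramp_def max_def\<close>)
    then show ?thesis by (rule has_field_derivative_at_within)
  next
    case greater
    then have "((\<lambda>t. t\<^sup>2) has_real_derivative 2 * max 0 t) (at t)"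
      by (auto intro!: derivative_eq_intros simp: max_def)
    then have "(ramp has_real_derivative 2 * max 0 t) (at t)"
      by (rule has_field_derivative_transform_within_open[of _ _ _ "{0<..}"])
         (use greater in \<open>auto simp: ramp_def max_def\<close>)
    then show ?thesis by (rule has_field_derivative_at_within)
  next
    case equal
    have "((\<lambda>_. 0) has_real_derivative 0) (at 0 within {..0::real})" by simp
    then have 1: "(ramp has_real_derivative 0) (at 0 within {..0})"
      by (rule has_field_derivative_transform_within[of _ _ _ _ 1]) (auto simp: ramp_def)
    have "((\<lambda>t. t\<^sup>2) has_real_derivative 0) (at 0 within {0::real..})"
      by (auto intro!: derivative_eq_intros)
    then have 2: "(ramp has_real_derivative 0) (at 0 within {0..})"
      by (rule has_field_derivative_transform_within[of _ _ _ _ 1]) (auto simp: ramp_def)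
    show ?thesis
      using 1 2 equal unfolding has_field_derivative_iff by (auto intro: Lim_Un simp: max_def)
  qed
  moreover have "{..0} \<union> {0::real..} = UNIV" by auto
  ultimately show ?thesis by simp
qed

lemma continuous_on_ramp [continuous_intros]:
  "continuous_on S f \<Longrightarrow> continuous_on S (\<lambda>x. ramp (f x))"
  unfolding ramp_def by (intro continuous_intros)

text \<open>The profile of the radial cutoff: fields on the sphere are extended to the shell between the
  radii 1 and 2.\<close>

definition bump :: "real \<Rightarrow> real" where
  "bump t = ramp (t - 1) * ramp (2 - t)"

definition bump' :: "real \<Rightarrow> real" where
  "bump' t = 2 * max 0 (t - 1) * ramp (2 - t) - ramp (t - 1) * (2 * max 0 (2 - t))"

lemma bump_deriv: "(bump has_real_derivative bump' t) (at t)"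
proof -
  have 1: "((\<lambda>t. ramp (t - 1)) has_real_derivative 2 * max 0 (t - 1) * 1) (at t)"
    by (rule DERIV_chain'[OF _ ramp_deriv]) (auto intro!: derivative_eq_intros)
  have 2: "((\<lambda>t. ramp (2 - t)) has_real_derivative 2 * max 0 (2 - t) * (-1)) (at t)"
    by (rule DERIV_chain'[OF _ ramp_deriv]) (auto intro!: derivative_eq_intros)
  show ?thesis
    using DERIV_mult'[OF 1 2] unfolding bump_def[abs_def] bump'_def
    by (simp add: algebra_simps)
qed

lemma bump_eq_0: "t \<le> 1 \<or> 2 \<le> t \<Longrightarrow> bump t = 0"
  and bump'_eq_0: "t \<le> 1 \<or> 2 \<le> t \<Longrightarrow> bump' t = 0"
  and bump_pos: "1 < t \<Longrightarrow> t < 2 \<Longrightarrow> 0 < bump t"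
  and bump_nonneg: "0 \<le> bump t"
  by (auto simp: bump_def bump'_def ramp_def)

lemma continuous_on_bump [continuous_intros]:
  "continuous_on S f \<Longrightarrow> continuous_on S (\<lambda>x. bump (f x))"
  "continuous_on S f \<Longrightarrow> continuous_on S (\<lambda>x. bump' (f x))"
  unfolding bump_def bump'_def by (auto intro!: continuous_intros)

text \<open>Volume integrals over shells are surface integrals times such a radial constant (with
  \<open>k = 2\<close>); positivity allows the constant to be cancelled.\<close>

lemma integrable_bump_power: "integrable lborel (\<lambda>r. bump r * r ^ k)"
  and integral_bump_power: "0 < (LINT r|lborel. bump r * r ^ k)"
proof -
  have "set_integrable lborel {1..2} (\<lambda>r. bump r * r ^ k)"
    unfolding set_integrable_def by (intro borel_integrable_compact) (auto intro!: continuous_intros)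
  moreover have "(\<lambda>r. indicator {1..2} r *\<^sub>R (bump r * r ^ k)) = (\<lambda>r. bump r * r ^ k)"
    by (auto simp: fun_eq_iff indicator_def bump_eq_0)
  ultimately show int: "integrable lborel (\<lambda>r. bump r * r ^ k)"
    unfolding set_integrable_def by simp
  have nn: "0 \<le> bump r * r ^ k" for r
    using bump_nonneg[of r] bump_eq_0[of r] by (cases "r \<le> 1") auto
  have "\<not> (AE r in lborel. bump r * r ^ k = 0)"
  proof
    assume "AE r in lborel. bump r * r ^ k = 0"
    then have "AE r in lborel. r \<notin> {1<..<2::real}"
      by eventually_elim (use bump_pos in force)
    then have "{1<..<2::real} \<in> null_sets lborel"
      by (subst AE_iff_null_sets) auto
    then show False by (simp add: null_sets_def)
  qed
  then have "(LINT r|lborel. bump r * r ^ k) \<noteq> 0"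
    using integral_nonneg_eq_0_iff_AE[OF int] nn by auto
  moreover have "0 \<le> (LINT r|lborel. bump r * r ^ k)"
    using nn by (intro integral_nonneg_AE) auto
  ultimately show "0 < (LINT r|lborel. bump r * r ^ k)" by simp
qed

section \<open>Change of variables on cones\<close>

lemma norm_times_sgn: "norm y *\<^sub>R sgn y = (y :: 'a::real_normed_vector)"
  by (cases "y = 0") (simp_all add: sgn_div_norm)

lemma bump_neq_0D: "bump t \<noteq> 0 \<Longrightarrow> 1 < t" "bump t \<noteq> 0 \<Longrightarrow> t < 2"
  using bump_eq_0[of t] by force+

text \<open>The matrix is the derivative of \<open>(r, s, t) \<mapsto> r P(s, t)\<close>: scaling
  the surface by \<open>r\<close> gives \<open>r\<^sup>2\<close>, and since \<open>P\<close> is the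
  unit normal the triple product is the signed area density.\<close>

lemma det_cone_matrix:
  fixes p a b :: "real^3"
  shows "det (matrix (\<lambda>h. (h $ 1) *\<^sub>R p + r *\<^sub>R ((h $ 2) *\<^sub>R a + (h $ 3) *\<^sub>R b)) :: real^3^3) = r\<^sup>2 * (p \<bullet> cross3 a b)"
  unfolding det_3 matrix_def
  by (simp add: axis_def cross3_def inner_vec_def sum_3 algebra_simps power2_eq_square)

lemma integrable_lebesgue_lborel:
  fixes f :: "'a::euclidean_space \<Rightarrow> real"
  assumes "integrable lborel f"
  shows "integrable lebesgue f" "integral\<^sup>L lebesgue f = integral\<^sup>L lborel f"
  using assms integrable_completion[of f lborel] integral_completion[of f lborel]
  by (auto dest: borel_measurable_integrable)

text \<open>The map \<open>(r, z) \<mapsto> r P(z)\<close> with \<open>1 < r < 2\<close> is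
  injective onto the part of the shell above the patch, and the weighted integrand becomes a product
  of a function of \<open>r\<close> and a function of \<open>z\<close>. The left-hand side depends
  on the patch only through its image, so different parametrizations can be compared.\<close>

lemma cone_change_of_variables:
  fixes P :: "real \<times> real \<Rightarrow> real^3" and g :: "real^3 \<Rightarrow> real"
  assumes R: "R \<in> sets borel"
    and P: "\<And>z. z \<in> R \<Longrightarrow> (P has_derivative (\<lambda>h. fst h *\<^sub>R Ps z + snd h *\<^sub>R Pr z)) (at z)"
    and inj: "inj_on P R" and sph: "\<And>z. z \<in> R \<Longrightarrow> P z \<in> unit_sphere"
    and int: "set_integrable lborel R (\<lambda>z. \<bar>P z \<bullet> cross3 (Ps z) (Pr z)\<bar> * g (P z))"
  defines "F \<equiv> \<lambda>y. indicator {y. sgn y \<in> P ` R} y * (bump (norm y) * g (sgn y))"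
  shows "integrable lebesgue F"
    and "integral\<^sup>L lebesgue F = (LINT r|lborel. bump r * r\<^sup>2) *
      (LINT z:R|lborel. \<bar>P z \<bullet> cross3 (Ps z) (Pr z)\<bar> * g (P z))"
proof -
  define T where "T = {w :: real^3. 1 < w$1 \<and> w$1 < 2 \<and> (w$2, w$3) \<in> R}"
  define \<Psi> where "\<Psi> w = (w$1) *\<^sub>R P (w$2, w$3)" for w :: "real^3"
  define \<Psi>' where "\<Psi>' w = (\<lambda>h :: real^3. (h $ 1) *\<^sub>R P (w$2, w$3) + (w$1) *\<^sub>R
      ((h $ 2) *\<^sub>R Ps (w$2, w$3) + (h $ 3) *\<^sub>R Pr (w$2, w$3)))" for w :: "real^3"
  define G where "G z = indicator R z * (\<bar>P z \<bullet> cross3 (Ps z) (Pr z)\<bar> * g (P z))" for z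
  define K where "K w = (bump (w$1) * (w$1)\<^sup>2) * G (w$2, w$3)" for w :: "real^3"
  \<comment> \<open>The change-of-variables theorem is applied to vector-valued integrands; the real
    integrand is wrapped as a vector of length one.\<close>
  let ?f = "\<lambda>y. (vec (bump (norm y) * g (sgn y)) :: real^1)"
  have G: "integrable lborel G"
    using int by (simp add: set_integrable_def G_def[abs_def])
  then have [measurable]: "G \<in> borel_measurable borel" by auto
  have bm [measurable]: "bump \<in> borel_measurable borel"
    by (intro borel_measurable_continuous_onI continuous_intros continuous_on_bump(1)[of UNIV "\<lambda>x. x", simplified])
  have nthm [measurable]: "(\<lambda>w :: real^3. w $ i) \<in> borel_measurable borel" for i
    by (intro borel_measurable_continuous_onI continuous_intros)
  have pm [measurable]: "(\<lambda>w :: real^3. (w $ 2, w $ 3)) \<in> borel_measurable borel"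
    by (intro borel_measurable_continuous_onI continuous_intros)
  have Km [measurable]: "K \<in> borel_measurable borel"
    unfolding K_def by measurable
  note prod = integral_product_lborel[OF integrable_bump_power[of 2] G]
  have "integrable (distr lborel borel vec3) K"
    by (subst integrable_distr_eq) (use prod(1) in \<open>auto simp: K_def\<close>)
  then have Kl: "integrable lborel K"
    by (simp add: distr_vec3)
  have "integral\<^sup>L lborel K = integral\<^sup>L (distr lborel borel vec3) K"
    by (simp add: distr_vec3)
  also have "\<dots> = (LINT r|lborel. bump r * r\<^sup>2) * integral\<^sup>L lborel G"
    by (subst integral_distr) (use prod(2) in \<open>auto simp: K_def\<close>)
  finally have Ki: "integral\<^sup>L lborel K = (LINT r|lborel. bump r * r\<^sup>2) * integral\<^sup>L lborel G" .
  have T: "T \<in> sets borel"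
  proof -
    have "T = {w \<in> space borel. 1 < w$1 \<and> w$1 < 2} \<inter> ((\<lambda>w. (w$2, w$3)) -` R \<inter> space borel)"
      by (auto simp: T_def)
    also have "\<dots> \<in> sets borel"
      by (rule sets.Int[OF _ measurable_sets[OF pm R]]) measurable
    finally show ?thesis .
  qed
  have K_eq: "\<bar>det (matrix (\<Psi>' w))\<bar> *\<^sub>R ?f (\<Psi> w) = vec (K w)" if "w \<in> T" for w
  proof -
    let ?z = "(w$2, w$3)"
    have z: "?z \<in> R" "norm (P ?z) = 1" and w: "w $ 1 > 0"
      using that sph[of ?z] by (auto simp: T_def)
    have e: "norm (\<Psi> w) = w$1" "sgn (\<Psi> w) = P ?z"
      using w z by (simp_all add: \<Psi>_def sgn_div_norm)
    have d: "det (matrix (\<Psi>' w)) = (w$1)\<^sup>2 * (P ?z \<bullet> cross3 (Ps ?z) (Pr ?z))"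
      unfolding \<Psi>'_def by (rule det_cone_matrix)
    show ?thesis
      unfolding e d using z by (simp add: K_def G_def abs_mult vec_eq_iff)
  qed
  have "\<Psi> ` T = {y. sgn y \<in> P ` R \<and> 1 < norm y \<and> norm y < 2}" (is "_ = ?Y")
  proof (intro equalityI subsetI)
    fix y assume "y \<in> \<Psi> ` T"
    then show "y \<in> ?Y"
      using sph by (auto simp: T_def \<Psi>_def sgn_div_norm)
  next
    fix y assume y: "y \<in> ?Y"
    then obtain a b where z: "(a, b) \<in> R" "sgn y = P (a, b)" by auto
    have "y = \<Psi> (vec3 (norm y, a, b))"
      unfolding \<Psi>_def vec3_nth fst_conv snd_conv z(2)[symmetric] norm_times_sgn ..
    moreover have "vec3 (norm y, a, b) \<in> T"
      using y z(1) by (simp add: T_def)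
    ultimately show "y \<in> \<Psi> ` T" by blast
  qed
  then have F_eq: "F = (\<lambda>y. indicator (\<Psi> ` T) y *\<^sub>R (bump (norm y) * g (sgn y)))"
    by (auto simp: F_def fun_eq_iff indicator_def bump_eq_0 not_less)
  have derP: "(\<Psi> has_derivative \<Psi>' w) (at w within T)" if "w \<in> T" for w
  proof -
    have z: "(w$2, w$3) \<in> R" using that by (simp add: T_def)
    have "((\<lambda>w. P (w$2, w$3)) has_derivative
        (\<lambda>h. fst (h$2, h$3) *\<^sub>R Ps (w$2, w$3) + snd (h$2, h$3) *\<^sub>R Pr (w$2, w$3))) (at w within T)"
    proof (rule has_derivative_compose[where f = "\<lambda>w. (w$2, w$3)"])
      show "((\<lambda>w :: real^3. (w$2, w$3)) has_derivative (\<lambda>h. (h$2, h$3))) (at w within T)"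
        by (intro has_derivative_Pair bounded_linear_imp_has_derivative bounded_linear_vec_nth)
    qed (rule P[OF z])
    from has_derivative_scaleR[OF bounded_linear_imp_has_derivative[OF bounded_linear_vec_nth[of 1]] this]
    show ?thesis
      unfolding \<Psi>_def[abs_def] \<Psi>'_def by (simp add: add.commute)
  qed
  have injP: "inj_on \<Psi> T"
  proof (rule inj_onI)
    fix v w assume v: "v \<in> T" and w: "w \<in> T" and eq: "\<Psi> v = \<Psi> w"
    have "norm (\<Psi> v) = v$1" "norm (\<Psi> w) = w$1"
      using v w sph[of "(v$2, v$3)"] sph[of "(w$2, w$3)"] by (auto simp: T_def \<Psi>_def)
    then have 1: "v$1 = w$1" using eq by simp
    then have "P (v$2, v$3) = P (w$2, w$3)"
      using eq v by (simp add: \<Psi>_def T_def)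
    then have "(v$2, v$3) = (w$2, w$3)"
      using inj v w by (auto simp: T_def dest: inj_onD)
    then show "v = w" using 1 by (simp add: vec_eq_iff forall_3)
  qed
  have KT: "(\<lambda>w. indicator T w * K w) = K"
    by (auto simp: fun_eq_iff indicator_def K_def G_def T_def dest: bump_neq_0D)
  have "K absolutely_integrable_on T"
    using integrable_lebesgue_lborel(1)[OF Kl] by (simp add: set_integrable_def KT)
  moreover have iK: "integral T K = integral\<^sup>L lborel K"
    using set_lebesgue_integral_eq_integral(2)[OF calculation] integrable_lebesgue_lborel(2)[OF Kl]
    by (simp add: set_lebesgue_integral_def KT)
  ultimately have "(\<lambda>w. \<bar>det (matrix (\<Psi>' w))\<bar> *\<^sub>R ?f (\<Psi> w)) absolutely_integrable_on T \<and>
      integral T (\<lambda>w. \<bar>det (matrix (\<Psi>' w))\<bar> *\<^sub>R ?f (\<Psi> w)) = vec (integral\<^sup>L lborel K)"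
    by (simp add: absolutely_integrable_on_1_iff integral_on_1_eq K_eq cong: set_integrable_cong integral_cong)
  then have "?f absolutely_integrable_on (\<Psi> ` T) \<and> integral (\<Psi> ` T) ?f = vec (integral\<^sup>L lborel K)"
    by (subst (asm) has_absolute_integral_change_of_variables[OF _ derP injP]) (use T in auto)
  then have "(\<lambda>y. bump (norm y) * g (sgn y)) absolutely_integrable_on (\<Psi> ` T)"
    "integral (\<Psi> ` T) (\<lambda>y. bump (norm y) * g (sgn y)) = integral\<^sup>L lborel K"
    by (simp_all add: absolutely_integrable_on_1_iff integral_on_1_eq vec_eq_iff)
  then show "integrable lebesgue F" and "integral\<^sup>L lebesgue F = (LINT r|lborel. bump r * r\<^sup>2) *
      (LINT z:R|lborel. \<bar>P z \<bullet> cross3 (Ps z) (Pr z)\<bar> * g (P z))"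
    using set_lebesgue_integral_eq_integral(2)[of "\<Psi> ` T" "\<lambda>y. bump (norm y) * g (sgn y)"]
    by (simp_all add: F_eq set_integrable_def set_lebesgue_integral_def Ki G_def[abs_def])
qed

section \<open>Integration over the sphere\<close>

lemma integral_translation_eq:
  fixes f :: "'a::euclidean_space \<Rightarrow> real"
  assumes "integrable lborel f"
  shows "integrable lborel (\<lambda>x. f (c + x))" "(LINT x|lborel. f (c + x)) = (LINT x|lborel. f x)"
proof -
  have [measurable]: "f \<in> borel_measurable borel" using assms by auto
  have "integrable (distr lborel borel ((+) c)) f"
    using assms by (simp add: lborel_distr_plus)
  then show "integrable lborel (\<lambda>x. f (c + x))"
    by (subst (asm) integrable_distr_eq) auto
  have "(LINT x|lborel. f x) = integral\<^sup>L (distr lborel borel ((+) c)) f"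
    by (simp add: lborel_distr_plus)
  also have "\<dots> = (LINT x|lborel. f (c + x))"
    by (rule integral_distr) auto
  finally show "(LINT x|lborel. f (c + x)) = (LINT x|lborel. f x)" ..
qed

lemma integrable_continuous_compact_support:
  fixes f :: "'a::euclidean_space \<Rightarrow> real"
  assumes "continuous_on UNIV f" "\<And>x. norm x \<ge> r \<Longrightarrow> f x = 0"
  shows "integrable lborel f"
proof -
  have "integrable lborel (\<lambda>x. indicator (cball 0 r) x *\<^sub>R f x)"
    by (rule borel_integrable_compact) (auto intro: continuous_on_subset[OF assms(1)])
  moreover have "(\<lambda>x. indicator (cball 0 r) x *\<^sub>R f x) = f"
    using assms(2) by (auto simp: fun_eq_iff indicator_def not_le)
  ultimately show ?thesis by simp
qed

text \<open>Difference quotients have integral zero; the mean value theorem bounds them by the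
  maximum of the derivative, so dominated convergence passes the zero to the limit.\<close>

lemma integral_directional_derivative_eq_0:
  fixes f :: "'a::euclidean_space \<Rightarrow> real"
  assumes f: "\<And>x. (f has_derivative f' x) (at x)"
    and cont: "continuous_on UNIV (\<lambda>x. f' x e)"
    and supp: "\<And>x. norm x \<ge> r \<Longrightarrow> f x = 0"
  shows "integrable lborel (\<lambda>x. f' x e)" and "(LINT x|lborel. f' x e) = 0"
proof -
  have D0: "f' x e = 0" if "norm x > r" for x
  proof -
    have "open {x :: 'a. norm x > r}"
      by (intro open_Collect_less continuous_intros)
    then have "(f has_derivative (\<lambda>_. 0)) (at x)"
      by (rule has_derivative_transform_within_open[of "\<lambda>_. 0", rotated]) (use that supp in auto)
    then show ?thesis
      using has_derivative_unique[OF f] by metis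
  qed
  show int: "integrable lborel (\<lambda>x. f' x e)"
    by (rule integrable_continuous_compact_support[OF cont, of "r + 1"]) (use D0 in auto)
  have fc: "continuous_on UNIV f"
    using f by (meson continuous_at_imp_continuous_on has_derivative_continuous)
  have fint: "integrable lborel f"
    by (rule integrable_continuous_compact_support[OF fc supp])
  have "compact ((\<lambda>x. f' x e) ` cball 0 r)"
    by (intro compact_continuous_image continuous_on_subset[OF cont]) auto
  then obtain B where "\<forall>x\<in>cball 0 r. \<bar>f' x e\<bar> \<le> B" "B > 0"
    by (auto dest!: compact_imp_bounded simp: bounded_pos)
  then have B: "\<bar>f' x e\<bar> \<le> B" for x
    using D0[of x] by (cases "norm x \<le> r") auto
  have dir: "((\<lambda>t. f (x + t *\<^sub>R e)) has_real_derivative f' (x + t *\<^sub>R e) e) (at t)" for x t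
  proof -
    have "((\<lambda>t. f (x + t *\<^sub>R e)) has_derivative (\<lambda>h. f' (x + t *\<^sub>R e) (h *\<^sub>R e))) (at t)"
      by (rule has_derivative_compose[where g = f, OF _ f]) (auto intro!: derivative_eq_intros)
    then show ?thesis
      using has_derivative_linear[OF f] by (simp add: has_field_derivative_def linear_cmul mult_commute_abs)
  qed
  \<comment> \<open>The steps are at most 1, so all quotients vanish outside the ball of radius
    \<open>r + norm e\<close>, where the dominating function is supported.\<close>
  define s where "s n x = (f (x + inverse (real (Suc n)) *\<^sub>R e) - f x) / inverse (real (Suc n))" for n x
  have sm: "s n \<in> borel_measurable lborel" for n
    unfolding s_def using fc
    by (auto intro!: borel_measurable_continuous_onI continuous_intros continuous_on_compose2[OF fc])
  have s0: "integral\<^sup>L lborel (s n) = 0" for n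
    unfolding s_def
    using integral_translation_eq[OF fint, of "inverse (real (Suc n)) *\<^sub>R e"] fint
    by (simp add: add.commute[of _ "inverse (1 + real n) *\<^sub>R e"])
  have "(\<lambda>n. integral\<^sup>L lborel (s n)) \<longlonglongrightarrow> (LINT x|lborel. f' x e)"
  proof (rule integral_dominated_convergence[where w = "\<lambda>x. B * indicator (cball 0 (r + norm e)) x"])
    show "AE x in lborel. (\<lambda>n. s n x) \<longlonglongrightarrow> f' x e"
    proof (rule AE_I2)
      fix x
      have "((\<lambda>h. (f (x + h *\<^sub>R e) - f x) / h) \<longlongrightarrow> f' x e) (at 0)"
        using dir[of x 0] by (simp add: DERIV_def)
      moreover have "filterlim (\<lambda>n. inverse (real (Suc n))) (at 0) sequentially"
        using LIMSEQ_inverse_real_of_nat by (auto simp: filterlim_at)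
      ultimately show "(\<lambda>n. s n x) \<longlonglongrightarrow> f' x e"
        unfolding s_def by (rule filterlim_compose)
    qed
    show "AE x in lborel. norm (s n x) \<le> B * indicator (cball 0 (r + norm e)) x" for n
    proof (rule AE_I2)
      fix x
      let ?h = "inverse (real (Suc n))"
      have h: "0 < ?h" "?h \<le> 1" by (auto simp: divide_simps)
      obtain z where "f (x + ?h *\<^sub>R e) - f (x + 0 *\<^sub>R e) = (?h - 0) * f' (x + z *\<^sub>R e) e"
        using MVT2[OF h(1) dir[of x]] by blast
      then have "s n x = f' (x + z *\<^sub>R e) e"
        using h by (simp add: s_def)
      then have "\<bar>s n x\<bar> \<le> B" using B by simp
      moreover have "s n x = 0" if "norm x > r + norm e"
      proof -
        have "norm (?h *\<^sub>R e) \<le> norm e"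
          using h(2) mult_right_mono[of ?h 1 "norm e"] by simp
        then have "norm x \<ge> r" "norm (x + ?h *\<^sub>R e) \<ge> r"
          using that norm_diff_ineq[of x "?h *\<^sub>R e"] norm_ge_zero[of e] by linarith+
        then show ?thesis by (simp add: s_def supp)
      qed
      ultimately show "norm (s n x) \<le> B * indicator (cball 0 (r + norm e)) x"
        by (auto simp: indicator_def not_le)
    qed
    show "integrable lborel (\<lambda>x. B * indicator (cball 0 (r + norm e)) x)"
      by (intro integrable_mult_right integrable_real_indicator) (use emeasure_bounded_finite[OF bounded_cball] in auto)
  qed (use sm int in auto)
  then show "(LINT x|lborel. f' x e) = 0"
    by (simp add: s0 LIMSEQ_const_iff)
qed

section \<open>The surface measure in coordinates and as a weighted volume\<close>

lemma sets_sphere_measure [simp, measurable_cong]: "sets sphere_measure = sets borel"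
  and space_sphere_measure [simp]: "space sphere_measure = UNIV"
  by (simp_all add: sphere_measure_def)

lemma continuous_on_sph [continuous_intros]:
  fixes f g :: "'a::t2_space \<Rightarrow> real"
  assumes "continuous_on S f" "continuous_on S g"
  shows "continuous_on S (\<lambda>x. sph (f x) (g x))"
proof (rule continuous_on_componentwise_vec)
  show "continuous_on S (\<lambda>x. sph (f x) (g x) $ i)" for i
    using exhaust_3[of i] by (elim disjE) (simp_all add: continuous_on_mult continuous_on_sin continuous_on_cos assms)
qed

lemma sph_measurable [measurable]: "(\<lambda>z. sph (fst z) (snd z)) \<in> borel_measurable borel"
  by (intro borel_measurable_continuous_onI continuous_intros)

lemma
  fixes g :: "real^3 \<Rightarrow> real"
  assumes [measurable]: "g \<in> borel_measurable borel"
  shows integrable_sphere_measure_iff: "integrable sphere_measure g \<longleftrightarrow>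
      integrable lborel (\<lambda>z. indicator ({0..<2*pi} \<times> {0..pi}) z * sin (snd z) * g (sph (fst z) (snd z)))" (is ?A)
    and integral_sphere_measure: "integral\<^sup>L sphere_measure g =
      (LINT z|lborel. indicator ({0..<2*pi} \<times> {0..pi}) z * sin (snd z) * g (sph (fst z) (snd z)))" (is ?B)
proof -
  let ?Q = "{0..<2*pi} \<times> {0..pi}"
  let ?d = "\<lambda>z. indicator ?Q z * sin (snd z) :: real"
  have d: "(\<lambda>(\<phi>, \<theta>). indicator ?Q (\<phi>, \<theta>) * ennreal (sin \<theta>)) = (\<lambda>z. ennreal (?d z))"
    by (auto simp: fun_eq_iff indicator_def)
  have Q: "?Q \<in> sets borel"
    by (simp add: borel_Times)
  have dm [measurable]: "?d \<in> borel_measurable lborel"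
    unfolding measurable_lborel2
    by (intro borel_measurable_times borel_measurable_indicator[OF Q]
        borel_measurable_continuous_onI continuous_intros)
  have dnn: "0 \<le> ?d z" for z
    by (auto simp: indicator_def intro: sin_ge_zero)
  have s: "(\<lambda>(\<phi>, \<theta>). sph \<phi> \<theta>) = (\<lambda>z. sph (fst z) (snd z))"
    by auto
  show ?A
    unfolding sphere_measure_def d s
    by (subst integrable_distr_eq; (subst integrable_density)?) (use dnn in \<open>auto simp: mult.assoc\<close>)
  show ?B
    unfolding sphere_measure_def d s
    by (subst integral_distr; (subst integral_density)?) (use dnn in \<open>auto simp: mult.assoc\<close>)
qed

lemma has_derivative_sph:
  "((\<lambda>z. sph (fst z) (snd z)) has_derivative
     (\<lambda>h. fst h *\<^sub>R sph_phi (fst z) (snd z) + snd h *\<^sub>R sph_theta (fst z) (snd z))) (at z)"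
proof -
  have "((\<lambda>z. sph (fst z) (snd z) $ i) has_derivative
     (\<lambda>h. (fst h *\<^sub>R sph_phi (fst z) (snd z) + snd h *\<^sub>R sph_theta (fst z) (snd z)) $ i)) (at z)" for i
    using exhaust_3[of i] by (auto intro!: derivative_eq_intros simp: algebra_simps)
  then show ?thesis
    by (subst has_derivative_componentwise_within) (auto simp: Basis_vec_def inner_axis)
qed

lemma sph_jacobian: "sph p q \<bullet> cross3 (sph_phi p q) (sph_theta p q) = - sin q"
proof -
  have "(cos p)\<^sup>2 + (sin p)\<^sup>2 = 1" "(cos q)\<^sup>2 + (sin q)\<^sup>2 = 1" by simp_all
  then show ?thesis
    unfolding inner_vec_def sum_3 inner_real_def cross_components sph_nth sph_phi_nth sph_theta_nth by algebra
qed

lemma inj_on_sph: "inj_on (\<lambda>z. sph (fst z) (snd z)) ({0<..<2*pi} \<times> {0<..<pi})"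
proof (rule inj_onI, clarify)
  fix p q p' q' assume pq: "p \<in> {0<..<2*pi}" "q \<in> {0<..<pi}" "p' \<in> {0<..<2*pi}" "q' \<in> {0<..<pi}"
    and eq: "sph (fst (p, q)) (snd (p, q)) = sph (fst (p', q')) (snd (p', q'))"
  then have e: "cos p * sin q = cos p' * sin q'" "sin p * sin q = sin p' * sin q'" "cos q = cos q'"
    using sph_nth[of p q] sph_nth[of p' q'] by auto
  have q: "q = q'" using e(3) pq cos_inj_pi[of q q'] by auto
  moreover have "sin q > 0" using pq by (auto intro: sin_gt_zero)
  ultimately have "cos p = cos p'" "sin p = sin p'" using e by auto
  then have "cos (p - p') = 1" by (simp add: cos_diff flip: power2_eq_square)
  then obtain n where n: "p - p' = of_int n * (2 * pi)"
    by (auto simp: cos_one_2pi_int algebra_simps)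
  then have "\<bar>of_int n * (2 * pi)\<bar> < 1 * (2 * pi)" using pq by auto
  then have "\<bar>real_of_int n\<bar> < 1" by (simp add: abs_mult)
  then have "n = 0" by linarith
  then show "p = p' \<and> q = q'" using n q by simp
qed

text \<open>Spherical coordinates are one instance of the cone formula, up to null sets. The outcome
  expresses the surface measure by Lebesgue measure without reference to the poles.\<close>

lemma integral_sphere_measure_cone:
  fixes g :: "real^3 \<Rightarrow> real"
  assumes gm [measurable]: "g \<in> borel_measurable borel" and g: "integrable sphere_measure g"
  shows "integrable lebesgue (\<lambda>y. bump (norm y) * g (sgn y))"
    and "(LINT y|lebesgue. bump (norm y) * g (sgn y)) =
      (LINT r|lborel. bump r * r\<^sup>2) * integral\<^sup>L sphere_measure g"
proof -
  let ?P = "\<lambda>z. sph (fst z) (snd z)"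
  let ?R = "{0<..<2*pi} \<times> {0<..<pi}" and ?Q = "{0..<2*pi} \<times> {0..pi}"
  have R: "?R \<in> sets borel" by (simp add: borel_Times)
  have ae: "AE z in lborel. indicator ?Q z * sin (snd z) * g (?P z) =
      indicator ?R z * (\<bar>?P z \<bullet> cross3 (sph_phi (fst z) (snd z)) (sph_theta (fst z) (snd z))\<bar> * g (?P z))"
  proof -
    \<comment> \<open>Of the edges in which the two rectangles differ, only longitude zero has to be
      discarded; on the two colatitude edges \<open>sin\<close> vanishes.\<close>
    have "negligible {z :: real \<times> real. z \<bullet> (1, 0) = 0}"
      by (rule negligible_standard_hyperplane) (simp add: Basis_prod_def)
    then have "{z :: real \<times> real. fst z = 0} \<in> null_sets lborel"
      by (subst null_sets_completion_iff[symmetric])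
        (auto simp: negligible_iff_null_sets inner_prod_def intro!: borel_closed closed_Collect_eq continuous_intros)
    then have "AE z :: real \<times> real in lborel. z \<notin> {z. fst z = 0}"
      by (rule AE_not_in)
    then show ?thesis
      by eventually_elim
        (use sin_ge_zero in \<open>auto simp: indicator_def sph_jacobian less_le\<close>)
  qed
  have Rm: "(\<lambda>z. indicator ?R z * (\<bar>?P z \<bullet> cross3 (sph_phi (fst z) (snd z)) (sph_theta (fst z) (snd z))\<bar> * g (?P z)))
      \<in> borel_measurable lborel" (is "?I \<in> _")
    unfolding sph_jacobian measurable_lborel2
    by (intro borel_measurable_times borel_measurable_indicator[OF R] measurable_compose[OF sph_measurable gm]
        borel_measurable_continuous_onI continuous_intros)
  have Qm: "(\<lambda>z. indicator ?Q z * sin (snd z) * g (?P z)) \<in> borel_measurable lborel"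
    unfolding measurable_lborel2
    by (intro borel_measurable_times borel_measurable_indicator measurable_compose[OF sph_measurable gm]
        borel_measurable_continuous_onI continuous_intros) (simp add: borel_Times)
  have I: "integrable lborel ?I" "integral\<^sup>L lborel ?I = integral\<^sup>L sphere_measure g"
    using g integrable_cong_AE[OF Qm Rm ae] integral_cong_AE[OF Qm Rm ae]
    by (simp_all add: integrable_sphere_measure_iff integral_sphere_measure)
  define F where "F y = indicator {y. sgn y \<in> ?P ` ?R} y * (bump (norm y) * g (sgn y))" for y
  have si: "set_integrable lborel ?R
      (\<lambda>z. \<bar>?P z \<bullet> cross3 (sph_phi (fst z) (snd z)) (sph_theta (fst z) (snd z))\<bar> * g (?P z))"
    using I by (simp add: set_integrable_def)
  note cv = cone_change_of_variables[OF R has_derivative_sph inj_on_sph _ si]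
  have F: "integrable lebesgue F"
      "integral\<^sup>L lebesgue F = (LINT r|lborel. bump r * r\<^sup>2) * integral\<^sup>L sphere_measure g"
    using cv I(2) by (simp_all add: F_def[abs_def] set_lebesgue_integral_def)
  \<comment> \<open>The open rectangle misses only the axis through the poles and the half-plane of
    longitude zero, and both lie in this plane.\<close>
  have "AE y in lebesgue. y \<notin> {y :: real^3. y $ 2 = 0}"
    by (rule AE_not_in) (simp add: negligible_standard_hyperplane_cart flip: negligible_iff_null_sets)
  then have ae': "AE y in lebesgue. F y = bump (norm y) * g (sgn y)"
  proof eventually_elim
    case (elim y)
    then have y0: "y \<noteq> 0" by auto
    define p q where "p = longitude (sgn y)" and "q = colatitude (sgn y)"
    have e: "sph p q = sgn y"
      unfolding p_def q_def using y0 by (intro sph_longitude_colatitude) (simp add: norm_sgn)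
    have "sgn y $ 2 \<noteq> 0"
      using elim y0 by (simp add: sgn_div_norm)
    then have "sin p \<noteq> 0" "sin q \<noteq> 0"
      using sph_nth(2)[of p q] unfolding e by auto
    moreover have "0 \<le> p" "p < 2 * pi"
      using Arg2pi by (auto simp: p_def longitude_def)
    moreover have "0 \<le> q" "q \<le> pi"
      using component_le_norm_cart[of "sgn y" 3] y0
      by (auto simp: q_def colatitude_def norm_sgn intro!: arccos_lbound arccos_ubound)
    ultimately have "(p, q) \<in> ?R"
      by (auto simp: less_le)
    then have "sgn y \<in> ?P ` ?R"
      using e by (force simp: image_iff)
    then show ?case by (simp add: F_def)
  qed
  have [measurable]: "sgn \<in> borel_measurable (borel :: (real^3) measure)"
    unfolding sgn_div_norm[abs_def] by measurable
  have [measurable]: "bump \<in> borel_measurable borel"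
    by (intro borel_measurable_continuous_onI continuous_on_bump(1)[of UNIV "\<lambda>x. x", simplified])
  have m: "(\<lambda>y :: real^3. bump (norm y) * g (sgn y)) \<in> borel_measurable lebesgue"
    by (rule measurable_completion) measurable
  show "integrable lebesgue (\<lambda>y. bump (norm y) * g (sgn y))"
    and "(LINT y|lebesgue. bump (norm y) * g (sgn y)) =
      (LINT r|lborel. bump r * r\<^sup>2) * integral\<^sup>L sphere_measure g"
    using F integrable_cong_AE[OF _ m ae'] integral_cong_AE[OF _ m ae'] borel_measurable_integrable[OF F(1)]
    by auto
qed

lemma integrable_sphere_measure_1: "integrable sphere_measure (\<lambda>_. 1 :: real)"
  and integral_sphere_measure_1: "(LINT x|sphere_measure. 1 :: real) = 4 * pi"
proof -
  let ?f = "indicator {0..<2*pi} :: real \<Rightarrow> real"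
  let ?g = "\<lambda>q :: real. indicator {0..pi} q *\<^sub>R sin q :: real"
  have f: "integrable lborel ?f" "integral\<^sup>L lborel ?f = 2 * pi"
    by simp_all
  have g: "has_bochner_integral lborel ?g (- cos pi - (- cos 0))"
    by (rule has_bochner_integral_FTC_Icc)
       (auto intro!: derivative_eq_intros continuous_intros simp flip: has_real_derivative_iff_has_vector_derivative)
  have g': "integrable lborel ?g" "integral\<^sup>L lborel ?g = 2"
    using g by (auto simp: has_bochner_integral_iff)
  have e: "indicator ({0..<2*pi} \<times> {0..pi}) z * sin (snd z) * 1 = ?f (fst z) * ?g (snd z)" for z :: "real \<times> real"
    by (simp add: indicator_def mem_Times_iff)
  show "integrable sphere_measure (\<lambda>_. 1 :: real)"
    unfolding integrable_sphere_measure_iff[OF borel_measurable_const] e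
    by (rule integral_product_lborel(1)[OF f(1) g'(1)])
  show "(LINT x|sphere_measure. 1 :: real) = 4 * pi"
    unfolding integral_sphere_measure[OF borel_measurable_const] e
    using integral_product_lborel(2)[OF f(1) g'(1)] f g' by simp
qed

interpretation sphere_measure: finite_measure sphere_measure
proof
  have "(\<integral>\<^sup>+ x. 1 \<partial>sphere_measure) < \<infinity>"
    using integrable_sphere_measure_1 by (simp add: integrable_iff_bounded)
  then show "emeasure sphere_measure (space sphere_measure) \<noteq> \<infinity>"
    by simp
qed

lemma AE_sphere_measure: "AE x in sphere_measure. x \<in> unit_sphere"
  unfolding sphere_measure_def by (subst AE_distr_iff) (auto simp: case_prod_beta')

text \<open>Both sides, multiplied by the same positive radial constant, are the volume integral
  over the cone above the patch.\<close>

lemma integral_sphere_parametrization: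
  fixes P :: "real \<times> real \<Rightarrow> real^3" and g :: "real^3 \<Rightarrow> real"
  assumes R: "R \<in> sets borel" and A: "P ` R \<in> sets borel"
    and P: "\<And>z. z \<in> R \<Longrightarrow> (P has_derivative (\<lambda>h. fst h *\<^sub>R Ps z + snd h *\<^sub>R Pr z)) (at z)"
    and inj: "inj_on P R" and sph: "\<And>z. z \<in> R \<Longrightarrow> P z \<in> unit_sphere"
    and int: "set_integrable lborel R (\<lambda>z. \<bar>P z \<bullet> cross3 (Ps z) (Pr z)\<bar> * g (P z))"
    and g: "set_integrable sphere_measure (P ` R) g"
  shows "(LINT x:P ` R|sphere_measure. g x) = (LINT z:R|lborel. \<bar>P z \<bullet> cross3 (Ps z) (Pr z)\<bar> * g (P z))"
proof -
  let ?g = "\<lambda>x. indicator (P ` R) x * g x"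
  have gi: "integrable sphere_measure ?g"
    using g by (simp add: set_integrable_def)
  then have gm: "?g \<in> borel_measurable borel"
    using borel_measurable_integrable measurable_cong_sets[OF sets_sphere_measure refl] by blast
  have eq: "(\<lambda>y. indicator {y. sgn y \<in> P ` R} y * (bump (norm y) * g (sgn y))) =
      (\<lambda>y. bump (norm y) * ?g (sgn y))"
    by (auto simp: indicator_def fun_eq_iff)
  have "(LINT r|lborel. bump r * r\<^sup>2) * integral\<^sup>L sphere_measure ?g =
      (LINT r|lborel. bump r * r\<^sup>2) * (LINT z:R|lborel. \<bar>P z \<bullet> cross3 (Ps z) (Pr z)\<bar> * g (P z))"
    by (rule trans[OF integral_sphere_measure_cone(2)[OF gm gi, symmetric]
          cone_change_of_variables(2)[OF R P inj sph int, unfolded eq]])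
  then show ?thesis
    using integral_bump_power[of 2] by (simp add: set_lebesgue_integral_def)
qed

lemma integral_sphere_divergence_eq_0:
  fixes X :: "real^3 \<Rightarrow> real^3"
  assumes X: "\<And>i x. x \<in> unit_sphere \<Longrightarrow> has_surface_gradient (\<lambda>y. X y $ i) (H i x) x"
    and H: "\<And>i. continuous_on unit_sphere (H i)"
    and tan: "\<And>x. x \<in> unit_sphere \<Longrightarrow> X x \<bullet> x = 0"
  shows "(LINT x:unit_sphere|sphere_measure. (\<Sum>i\<in>UNIV. H i x $ i)) = 0"
proof -
  \<comment> \<open>The factor \<open>t\<close> compensates the division by \<open>norm y\<close> in
    the derivative of a radial extension. The divergence of
    \<open>b (norm y) *\<^sub>R X (sgn y)\<close> then carries exactly the weight
    \<open>bump\<close>, and the derivative of \<open>b\<close> itself only meets the radial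
    component of \<open>X\<close>, which is zero.\<close>
  define b where "b t = t * bump t" for t
  define b' where "b' t = bump t + t * bump' t" for t
  define D where "D i y h = b' (norm y) * ((y \<bullet> h) / norm y) * X (sgn y) $ i + bump (norm y) * (H i (sgn y) \<bullet> h)"
    for i y h
  have b0: "b t = 0" "b' t = 0" if "t \<le> 1 \<or> 2 \<le> t" for t
    using that by (auto simp: b_def b'_def bump_eq_0 bump'_eq_0)
  have bd: "(b has_real_derivative b' t) (at t)" for t
    unfolding b_def[abs_def] b'_def using DERIV_mult'[OF DERIV_ident bump_deriv, of t] by (simp add: add.commute mult.commute)
  have der: "((\<lambda>y. b (norm y) * X (sgn y) $ i) has_derivative D i y) (at y)" for i y
  proof (cases "norm y < 1")
    \<comment> \<open>At the origin \<open>sgn\<close> is not differentiable, but the field is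
      identically zero on the unit ball.\<close>
    case True
    have "((\<lambda>y. b (norm y) * X (sgn y) $ i) has_derivative (\<lambda>_. 0)) (at y)"
      by (rule has_derivative_transform_within_open[of "\<lambda>_. 0" _ _ _ "ball 0 1"]) (use True b0 in auto)
    moreover have "D i y = (\<lambda>_. 0)"
      using True by (auto simp: D_def fun_eq_iff b0 bump_eq_0)
    ultimately show ?thesis by simp
  next
    case False
    then have y: "y \<noteq> 0" by auto
    have "((\<lambda>y. b (norm y)) has_derivative (\<lambda>h. b' (norm y) * (h \<bullet> sgn y))) (at y)"
      by (rule has_derivative_compose[OF has_derivative_norm[OF y] bd[unfolded has_field_derivative_def]])
    from has_derivative_mult[OF this has_derivative_radial_extension[OF X[OF sgn_in_unit_sphere[OF y]] y]]
    show ?thesis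
      by (rule has_derivative_eq_rhs)
        (use y in \<open>auto simp: D_def fun_eq_iff b_def sgn_div_norm divide_inverse inner_commute ac_simps\<close>)
  qed
  have sgnc: "continuous_on (- {0}) (sgn :: real^3 \<Rightarrow> _)"
    unfolding sgn_div_norm[abs_def] by (intro continuous_intros) auto
  have "continuous_on unit_sphere X"
    by (intro continuous_on_componentwise_vec has_surface_gradient_continuous_on[OF X]) auto
  have cont: "continuous_on UNIV (\<lambda>y. D i y (axis i 1))" for i
  proof -
    have "continuous_on (- {0}) (\<lambda>y. D i y (axis i 1))"
      unfolding D_def b'_def
      by (intro continuous_intros continuous_on_compose2[OF H sgnc]
            continuous_on_compose2[OF \<open>continuous_on unit_sphere X\<close> sgnc])
         (auto simp: norm_sgn split: if_splits)
    moreover have "continuous_on (ball 0 1) (\<lambda>y. D i y (axis i 1))"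
      by (rule continuous_on_eq[of _ "\<lambda>_. 0"]) (auto simp: D_def b0 bump_eq_0)
    ultimately have "continuous_on (- {0} \<union> ball 0 1) (\<lambda>y. D i y (axis i 1))"
      by (intro continuous_on_open_Un) auto
    moreover have "- {0} \<union> ball 0 1 = (UNIV :: (real^3) set)"
      by auto
    ultimately show ?thesis by simp
  qed
  have supp: "b (norm y) * X (sgn y) $ i = 0" if "2 \<le> norm y" for y i
    using that by (simp add: b0)
  note dir = integral_directional_derivative_eq_0[OF der cont supp]
  let ?g = "\<lambda>x. indicator unit_sphere x * (\<Sum>i\<in>UNIV. H i x $ i)"
  have eq: "(\<Sum>i\<in>UNIV. D i y (axis i 1)) = bump (norm y) * ?g (sgn y)" for y
  proof (cases "y = 0")
    case False
    have "(\<Sum>i\<in>UNIV. D i y (axis i 1)) = b' (norm y) * (sgn y \<bullet> X (sgn y)) + bump (norm y) * (\<Sum>i\<in>UNIV. H i (sgn y) $ i)"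
    proof -
      have "D i y (axis i 1) = b' (norm y) * (sgn y $ i * X (sgn y) $ i) + bump (norm y) * H i (sgn y) $ i" for i
        by (simp add: D_def inner_axis sgn_div_norm divide_inverse ac_simps)
      then show ?thesis
        by (simp add: sum.distrib sum_distrib_left inner_vec_def[of "sgn y"])
    qed
    then show ?thesis
      using tan[of "sgn y"] False by (simp add: norm_sgn inner_commute)
  qed (simp add: D_def bump_eq_0)
  have "(\<Sum>i\<in>UNIV. LINT y|lborel. D i y (axis i 1)) = 0"
    using dir(2) by simp
  then have z: "(LINT y|lborel. bump (norm y) * ?g (sgn y)) = 0"
    using dir(1) by (subst (asm) Bochner_Integration.integral_sum[symmetric]) (simp_all add: eq)
  have i: "integrable lborel (\<lambda>y. bump (norm y) * ?g (sgn y))"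
    unfolding eq[symmetric] using dir(1) by (intro Bochner_Integration.integrable_sum) auto
  have 0: "(LINT y|lebesgue. bump (norm y) * ?g (sgn y)) = 0"
    by (rule trans[OF integrable_lebesgue_lborel(2)[OF i] z])
  have gc: "continuous_on unit_sphere (\<lambda>x. \<Sum>i\<in>UNIV. H i x $ i)"
    by (intro continuous_intros H)
  have gm: "?g \<in> borel_measurable borel"
    using borel_measurable_continuous_on_indicator[OF _ gc] by simp
  obtain B where B: "\<forall>x\<in>unit_sphere. \<bar>\<Sum>i\<in>UNIV. H i x $ i\<bar> \<le> B"
    using compact_imp_bounded[OF compact_continuous_image[OF gc compact_sphere]]
    by (auto simp: bounded_iff)
  have gi: "integrable sphere_measure ?g"
  proof (rule sphere_measure.integrable_const_bound)
    show "AE x in sphere_measure. norm (?g x) \<le> B"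
      using AE_sphere_measure by eventually_elim (use B in auto)
  qed (use gm in \<open>simp add: measurable_cong_sets[OF sets_sphere_measure refl]\<close>)
  have "(LINT r|lborel. bump r * r\<^sup>2) * integral\<^sup>L sphere_measure ?g = 0"
    using integral_sphere_measure_cone(2)[OF gm gi] 0 by simp
  then show ?thesis
    using integral_bump_power[of 2] by (simp add: set_lebesgue_integral_def)
qed

section \<open>Zonal functions and the regularized fundamental solution\<close>

definition zonal_field :: "(real \<Rightarrow> real) \<Rightarrow> real^3 \<Rightarrow> real^3 \<Rightarrow> real^3" where
  "zonal_field p x0 x = p (x \<bullet> x0) *\<^sub>R (x0 - (x \<bullet> x0) *\<^sub>R x)"

text \<open>For \<open>p = f'\<close> the field is the surface gradient of \<open>x \<mapsto> f (x, x0)\<close>. In the next definition \<open>q\<close> is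
  the ambient gradient of its \<open>i\<close>-th component, which is then projected to the tangent plane.\<close>

definition zonal_hess :: "(real \<Rightarrow> real) \<Rightarrow> (real \<Rightarrow> real) \<Rightarrow> real^3 \<Rightarrow> 3 \<Rightarrow> real^3 \<Rightarrow> real^3" where
  "zonal_hess p p' x0 i x =
     (let \<tau> = x \<bullet> x0;
          q = (p' \<tau> * (x0 $ i - \<tau> * x $ i) - p \<tau> * x $ i) *\<^sub>R x0 - (p \<tau> * \<tau>) *\<^sub>R axis i 1
      in q - (q \<bullet> x) *\<^sub>R x)"

lemma zonal_field_tangent: "norm x = 1 \<Longrightarrow> zonal_field p x0 x \<bullet> x = 0"
  by (simp add: zonal_field_def inner_diff_left dot_square_norm inner_commute[of x0])

lemma has_surface_gradient_zonal:
  assumes "norm x = 1" and f: "(f has_real_derivative p (x \<bullet> x0)) (at (x \<bullet> x0))"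
  shows "has_surface_gradient (\<lambda>y. f (y \<bullet> x0)) (zonal_field p x0 x) x"
proof -
  have "has_surface_gradient (\<lambda>y. y \<bullet> x0) (x0 - (x0 \<bullet> x) *\<^sub>R x) x"
    by (rule has_surface_gradient_ambient[OF assms(1)]) (auto intro!: derivative_eq_intros simp: inner_commute)
  from has_surface_gradient_compose[OF this f] show ?thesis
    by (simp add: zonal_field_def inner_commute)
qed

lemma has_surface_gradient_zonal_field:
  assumes "norm x = 1" and p: "(p has_real_derivative p' (x \<bullet> x0)) (at (x \<bullet> x0))"
  shows "has_surface_gradient (\<lambda>y. zonal_field p x0 y $ i) (zonal_hess p p' x0 i x) x"
proof -
  let ?t = "x \<bullet> x0"
  let ?q = "(p' ?t * (x0 $ i - ?t * x $ i) - p ?t * x $ i) *\<^sub>R x0 - (p ?t * ?t) *\<^sub>R axis i 1"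
  have 1: "((\<lambda>y. y \<bullet> x0) has_derivative (\<lambda>h. h \<bullet> x0)) (at x)"
    by (auto intro!: derivative_eq_intros)
  have 2: "((\<lambda>y :: real^3. y $ i) has_derivative (\<lambda>h. h $ i)) (at x)"
    by (intro bounded_linear_imp_has_derivative bounded_linear_vec_nth)
  have 3: "((\<lambda>y. p (y \<bullet> x0)) has_derivative (\<lambda>h. p' ?t * (h \<bullet> x0))) (at x)"
    by (rule has_derivative_compose[OF 1 p[unfolded has_field_derivative_def]])
  have "((\<lambda>y. p (y \<bullet> x0) * (x0 $ i - (y \<bullet> x0) * y $ i)) has_derivative
      (\<lambda>h. p ?t * (0 - (?t * h $ i + h \<bullet> x0 * x $ i)) + p' ?t * (h \<bullet> x0) * (x0 $ i - ?t * x $ i))) (at x)"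
    by (intro has_derivative_mult has_derivative_diff has_derivative_const 1 2 3)
  moreover have "(\<lambda>h. p ?t * (0 - (?t * h $ i + h \<bullet> x0 * x $ i)) + p' ?t * (h \<bullet> x0) * (x0 $ i - ?t * x $ i)) = (\<lambda>h. ?q \<bullet> h)"
    by (auto simp: fun_eq_iff inner_diff_left inner_axis' inner_axis inner_commute algebra_simps)
  ultimately have "has_surface_gradient (\<lambda>y. p (y \<bullet> x0) * (x0 $ i - (y \<bullet> x0) * y $ i)) (?q - (?q \<bullet> x) *\<^sub>R x) x"
    by (intro has_surface_gradient_ambient[OF assms(1)]) simp
  then show ?thesis
    by (simp add: zonal_field_def zonal_hess_def Let_def)
qed

lemma zonal_trace_algebra:
  fixes a1 a2 a3 b1 b2 b3 t p q :: real
  assumes "t = a1 * b1 + a2 * b2 + a3 * b3" "a1\<^sup>2 + a2\<^sup>2 + a3\<^sup>2 = 1" "b1\<^sup>2 + b2\<^sup>2 + b3\<^sup>2 = 1"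
  shows "((q * (b1 - t * a1) - p * a1) * b1 - p * t - ((q * (b1 - t * a1) - p * a1) * t - p * t * a1) * a1)
     + ((q * (b2 - t * a2) - p * a2) * b2 - p * t - ((q * (b2 - t * a2) - p * a2) * t - p * t * a2) * a2)
     + ((q * (b3 - t * a3) - p * a3) * b3 - p * t - ((q * (b3 - t * a3) - p * a3) * t - p * t * a3) * a3)
     = (1 - t\<^sup>2) * q - 2 * t * p"
  using assms by algebra

text \<open>For \<open>p = f'\<close> this is the Legendre operator
  \<open>(1 - t\<^sup>2) f'' - 2 t f'\<close>, the Laplacian of
  \<open>x \<mapsto> f (x \<bullet> x0)\<close>.\<close>

lemma zonal_hess_trace:
  assumes "norm x = 1" "norm x0 = 1"
  shows "(\<Sum>i\<in>UNIV. zonal_hess p p' x0 i x $ i) = (1 - (x \<bullet> x0)\<^sup>2) * p' (x \<bullet> x0) - 2 * (x \<bullet> x0) * p (x \<bullet> x0)"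
proof -
  let ?t = "x \<bullet> x0"
  have c: "zonal_hess p p' x0 i x $ i = (p' ?t * (x0 $ i - ?t * x $ i) - p ?t * x $ i) * x0 $ i - p ?t * ?t
      - ((p' ?t * (x0 $ i - ?t * x $ i) - p ?t * x $ i) * ?t - p ?t * ?t * x $ i) * x $ i" for i
    by (simp add: zonal_hess_def Let_def inner_diff_left inner_axis' inner_commute[of x0])
  have "?t = x $ 1 * x0 $ 1 + x $ 2 * x0 $ 2 + x $ 3 * x0 $ 3"
    by (simp add: inner_vec_def sum_3)
  moreover have "(x$1)\<^sup>2 + (x$2)\<^sup>2 + (x$3)\<^sup>2 = 1" "(x0$1)\<^sup>2 + (x0$2)\<^sup>2 + (x0$3)\<^sup>2 = 1"
    using assms by (simp_all add: norm_eq_1 inner_vec_def sum_3 power2_eq_square)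
  ultimately show ?thesis
    unfolding sum_3 c by (rule zonal_trace_algebra)
qed

lemma inner_unit_sphere_bounds:
  fixes x x0 :: "'a::real_inner"
  assumes "norm x = 1" "norm x0 = 1"
  shows "x \<bullet> x0 \<le> 1" "-1 \<le> x \<bullet> x0"
  using Cauchy_Schwarz_ineq2[of x x0] assms by auto

lemma continuous_on_zonal:
  fixes x0 :: "real^3"
  assumes "continuous_on T p" "(\<lambda>x. x \<bullet> x0) ` S \<subseteq> T"
  shows "continuous_on S (\<lambda>x. p (x \<bullet> x0))"
  by (rule continuous_on_compose2[OF assms(1)]) (use assms(2) in \<open>auto intro!: continuous_intros\<close>)

lemma continuous_on_zonal_hess:
  assumes "continuous_on T p" "continuous_on T p'" "(\<lambda>x. x \<bullet> x0) ` S \<subseteq> T"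
  shows "continuous_on S (zonal_hess p p' x0 i)"
proof -
  note c = continuous_on_zonal[OF assms(1,3)] continuous_on_zonal[OF assms(2,3)]
  show ?thesis
    unfolding zonal_hess_def[abs_def] Let_def by (intro continuous_intros c)
qed

lemma continuous_on_zonal_field:
  assumes "continuous_on T p" "(\<lambda>x. x \<bullet> x0) ` S \<subseteq> T"
  shows "continuous_on S (zonal_field p x0)"
  unfolding zonal_field_def[abs_def] by (intro continuous_intros continuous_on_zonal[OF assms])

lemma integral_sphere_indicator:
  fixes f :: "real^3 \<Rightarrow> real"
  assumes "f \<in> borel_measurable borel"
  shows "(LINT x:unit_sphere|sphere_measure. f x) = (LINT x|sphere_measure. f x)"
  unfolding set_lebesgue_integral_def
proof (rule integral_cong_AE)
  show "(\<lambda>x. indicator unit_sphere x *\<^sub>R f x) \<in> borel_measurable sphere_measure"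
    "f \<in> borel_measurable sphere_measure"
    using assms unfolding measurable_cong_sets[OF sets_sphere_measure refl]
    by (auto intro!: borel_measurable_times borel_measurable_indicator)
  show "AE x in sphere_measure. indicator unit_sphere x *\<^sub>R f x = f x"
    using AE_sphere_measure by eventually_elim auto
qed

text \<open>The integrand is the derivative of \<open>(1 - t\<^sup>2) p(t)\<close> at
  \<open>t = x \<bullet> x0\<close>. In polar coordinates about \<open>x0\<close> this would be the
  fundamental theorem of calculus with vanishing end values; here it is the divergence of a zonal
  field on the closed sphere.\<close>

lemma integral_sphere_zonal_eq_0:
  assumes x0: "norm x0 = 1"
    and p: "\<And>t. -1 \<le> t \<Longrightarrow> t \<le> 1 \<Longrightarrow> (p has_real_derivative p' t) (at t)"
    and p': "continuous_on {-1..1} p'"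
  shows "(LINT x:unit_sphere|sphere_measure. (1 - (x \<bullet> x0)\<^sup>2) * p' (x \<bullet> x0) - 2 * (x \<bullet> x0) * p (x \<bullet> x0)) = 0"
proof -
  have pc: "continuous_on {-1..1} p"
    by (rule DERIV_atLeastAtMost_imp_continuous_on) (use p in auto)
  have im: "(\<lambda>x. x \<bullet> x0) ` unit_sphere \<subseteq> {-1..1}"
    using inner_unit_sphere_bounds[OF _ x0] by auto
  have "(LINT x:unit_sphere|sphere_measure. (\<Sum>i\<in>UNIV. zonal_hess p p' x0 i x $ i)) = 0"
  proof (rule integral_sphere_divergence_eq_0[where X = "zonal_field p x0"])
    show "has_surface_gradient (\<lambda>y. zonal_field p x0 y $ i) (zonal_hess p p' x0 i x) x"
      if "x \<in> unit_sphere" for i x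
      using that inner_unit_sphere_bounds[of x x0] x0
      by (intro has_surface_gradient_zonal_field p) auto
  qed (auto intro: continuous_on_zonal_hess[OF pc p' im] zonal_field_tangent)
  also have "(LINT x:unit_sphere|sphere_measure. (\<Sum>i\<in>UNIV. zonal_hess p p' x0 i x $ i)) =
    (LINT x:unit_sphere|sphere_measure. (1 - (x \<bullet> x0)\<^sup>2) * p' (x \<bullet> x0) - 2 * (x \<bullet> x0) * p (x \<bullet> x0))"
    by (rule set_lebesgue_integral_cong) (use zonal_hess_trace x0 in auto)
  finally show ?thesis .
qed

lemma integrable_sphere_continuous:
  fixes f :: "real^3 \<Rightarrow> real"
  assumes "continuous_on unit_sphere f"
  shows "set_integrable sphere_measure unit_sphere f"
proof -
  obtain B where B: "\<forall>x\<in>unit_sphere. \<bar>f x\<bar> \<le> B"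
    using compact_imp_bounded[OF compact_continuous_image[OF assms compact_sphere]]
    by (auto simp: bounded_iff)
  show ?thesis
    unfolding set_integrable_def
  proof (rule sphere_measure.integrable_const_bound)
    show "AE x in sphere_measure. norm (indicator unit_sphere x *\<^sub>R f x) \<le> B"
      using AE_sphere_measure by eventually_elim (use B in auto)
    show "(\<lambda>x. indicator unit_sphere x *\<^sub>R f x) \<in> borel_measurable sphere_measure"
      unfolding measurable_cong_sets[OF sets_sphere_measure refl]
      by (rule borel_measurable_continuous_on_indicator[OF _ assms]) simp
  qed
qed

definition Ureg :: "real \<Rightarrow> real^3 \<Rightarrow> real^3 \<Rightarrow> real" where
  "Ureg a x0 x = - (1 / (4 * pi)) * ln (a - x \<bullet> x0)"

text \<open>First and second derivative of the profile \<open>t \<mapsto> -(1/4\<pi>) ln (a - t)\<close>.\<close>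

definition Ureg' :: "real \<Rightarrow> real \<Rightarrow> real" where
  "Ureg' a t = 1 / (4 * pi * (a - t))"

definition Ureg'' :: "real \<Rightarrow> real \<Rightarrow> real" where
  "Ureg'' a t = 1 / (4 * pi * (a - t)\<^sup>2)"

text \<open>With \<open>a = (1 + r\<^sup>2) / (2 r)\<close> and \<open>0 < r < 1\<close> one has
  \<open>\<bar>x - r x0\<bar>\<^sup>2 = 2 r (a - x \<bullet> x0)\<close> on the sphere, and the
  kernel equals \<open>(1 - r\<^sup>2)\<^sup>2 / (4 pi \<bar>x - r x0\<bar>\<^sup>4)\<close>, the
  Poisson kernel of the hyperbolic ball.\<close>

definition sphere_kernel :: "real \<Rightarrow> real^3 \<Rightarrow> real^3 \<Rightarrow> real" where
  "sphere_kernel a x0 x = (a\<^sup>2 - 1) / (4 * pi * (a - x \<bullet> x0)\<^sup>2)"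

lemma Ureg_derivs:
  assumes "t < a"
  shows "((\<lambda>t. - (1 / (4 * pi)) * ln (a - t)) has_real_derivative Ureg' a t) (at t)"
    and "(Ureg' a has_real_derivative Ureg'' a t) (at t)"
proof -
  show "((\<lambda>t. - (1 / (4 * pi)) * ln (a - t)) has_real_derivative Ureg' a t) (at t)"
    using assms by (auto intro!: derivative_eq_intros simp: Ureg'_def field_simps)
  have "((\<lambda>t. 1 / (4 * pi) * inverse (a - t)) has_real_derivative 1 / (4 * pi) * (inverse (a - t))\<^sup>2) (at t)"
    using assms by (auto intro!: derivative_eq_intros simp: power2_eq_square)
  then show "(Ureg' a has_real_derivative Ureg'' a t) (at t)"
    by (simp add: Ureg'_def[abs_def] Ureg''_def inverse_eq_divide power_one_over)
qed

lemma Ureg_trace: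
  assumes "t < a"
  shows "(1 - t\<^sup>2) * Ureg'' a t - 2 * t * Ureg' a t = 1 / (4 * pi) - (a\<^sup>2 - 1) / (4 * pi * (a - t)\<^sup>2)"
proof -
  have "(1 - t\<^sup>2) - 2 * t * (a - t) = (a - t)\<^sup>2 - (a\<^sup>2 - 1)" by algebra
  then have "((1 - t\<^sup>2) - 2 * t * (a - t)) / (4 * pi * (a - t)\<^sup>2) = ((a - t)\<^sup>2 - (a\<^sup>2 - 1)) / (4 * pi * (a - t)\<^sup>2)"
    by simp
  then show ?thesis
    using assms by (simp add: Ureg'_def Ureg''_def diff_divide_distrib power2_eq_square)
qed

lemma sphere_kernel_measurable [measurable]: "sphere_kernel a x0 \<in> borel_measurable borel"
  unfolding sphere_kernel_def[abs_def] by measurable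

lemma integral_sphere_kernel:
  assumes a: "1 < a" and x0: "norm x0 = 1"
  shows "integrable sphere_measure (sphere_kernel a x0)" "(LINT x|sphere_measure. sphere_kernel a x0 x) = 1"
proof -
  have lt: "x \<bullet> x0 < a" if "x \<in> unit_sphere" for x
    using inner_unit_sphere_bounds[of x x0] that a x0 by auto
  have "(LINT x:unit_sphere|sphere_measure. (1 - (x \<bullet> x0)\<^sup>2) * Ureg'' a (x \<bullet> x0) - 2 * (x \<bullet> x0) * Ureg' a (x \<bullet> x0)) = 0"
  proof (rule integral_sphere_zonal_eq_0[OF x0])
    show "continuous_on {-1..1} (Ureg'' a)"
      unfolding Ureg''_def[abs_def] using a by (intro continuous_intros) auto
  qed (use a in \<open>auto intro!: Ureg_derivs\<close>)
  also have "(LINT x:unit_sphere|sphere_measure. (1 - (x \<bullet> x0)\<^sup>2) * Ureg'' a (x \<bullet> x0) - 2 * (x \<bullet> x0) * Ureg' a (x \<bullet> x0))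
     = (LINT x:unit_sphere|sphere_measure. 1 / (4 * pi) - sphere_kernel a x0 x)"
    by (rule set_lebesgue_integral_cong) (use Ureg_trace lt in \<open>auto simp: sphere_kernel_def\<close>)
  also have "\<dots> = (LINT x|sphere_measure. 1 / (4 * pi) - sphere_kernel a x0 x)"
    by (rule integral_sphere_indicator) measurable
  finally have 0: "(LINT x|sphere_measure. 1 / (4 * pi) - sphere_kernel a x0 x) = 0" .
  have "continuous_on unit_sphere (sphere_kernel a x0)"
    unfolding sphere_kernel_def[abs_def] using lt by (intro continuous_intros) force+
  then have i: "integrable sphere_measure (\<lambda>x. indicator unit_sphere x *\<^sub>R sphere_kernel a x0 x)"
    using integrable_sphere_continuous by (simp add: set_integrable_def)
  show i2: "integrable sphere_measure (sphere_kernel a x0)"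
    by (rule integrable_cong_AE_imp[OF i])
       (use AE_sphere_measure in \<open>auto simp: measurable_cong_sets[OF sets_sphere_measure refl] elim!: eventually_mono\<close>)
  show "(LINT x|sphere_measure. sphere_kernel a x0 x) = 1"
    using 0 i2 integrable_sphere_measure_1 integral_sphere_measure_1
    by (subst (asm) Bochner_Integration.integral_diff) auto
qed

section \<open>Limits of the regularization\<close>

text \<open>The kernel is nonnegative with integral 1 for every \<open>a > 1\<close>, but its value
  at \<open>x0\<close> tends to infinity as \<open>a \<rightarrow> 1\<close>; a point of positive
  mass would contradict this. The argument treats the poles like any other point.\<close>

lemma AE_sphere_neq:
  assumes x0: "norm x0 = 1"
  shows "AE x in sphere_measure. x \<noteq> x0"
proof -
  have le: "measure sphere_measure {x0} * ((a + 1) / (4 * pi * (a - 1))) \<le> 1" if a: "1 < a" for a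
  proof -
    have "sphere_kernel a x0 x0 = (a + 1) / (4 * pi * (a - 1))"
    proof -
      have "a\<^sup>2 - 1 = (a - 1) * (a + 1)" by algebra
      then show ?thesis
        using x0 a by (simp add: sphere_kernel_def dot_square_norm power2_eq_square[of "a - 1"])
    qed
    then have "measure sphere_measure {x0} * ((a + 1) / (4 * pi * (a - 1))) =
        (LINT x|sphere_measure. indicator {x0} x * sphere_kernel a x0 x0)"
      by simp
    also have "\<dots> \<le> (LINT x|sphere_measure. sphere_kernel a x0 x)"
    proof (rule integral_mono)
      have "integrable sphere_measure (indicator {x0} :: _ \<Rightarrow> real)"
        by (rule integrable_real_indicator) (auto simp: sphere_measure.emeasure_eq_measure)
      then show "integrable sphere_measure (\<lambda>x. indicator {x0} x * sphere_kernel a x0 x0)"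
        by (rule integrable_mult_left)
      show "indicator {x0} x * sphere_kernel a x0 x0 \<le> sphere_kernel a x0 x" for x
        using a by (auto simp: indicator_def sphere_kernel_def)
    qed (use integral_sphere_kernel[OF a x0] in auto)
    finally show ?thesis using integral_sphere_kernel[OF a x0] by simp
  qed
  let ?m = "measure sphere_measure {x0}"
  have "?m \<le> e" if "e > 0" for e
  proof -
    \<comment> \<open>For this \<open>a\<close> the value of the kernel at \<open>x0\<close> is
      \<open>(2 + e / (2 pi)) / (2 e)\<close>, which exceeds \<open>1 / e\<close>.\<close>
    have a: "1 < 1 + e / (2 * pi)" using that by simp
    have "?m * ((1 + e / (2 * pi) + 1) / (4 * pi * (e / (2 * pi)))) \<le> 1"
      using le[OF a] by simp
    then have "?m * (2 + e / (2 * pi)) \<le> 2 * e"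
      using that by (simp add: field_simps)
    moreover have "?m * 2 \<le> ?m * (2 + e / (2 * pi))"
      using that by (intro mult_left_mono) auto
    ultimately show ?thesis by simp
  qed
  then have "?m \<le> 0" by (rule field_le_epsilon[of _ 0, simplified])
  then have "?m = 0" by (simp add: measure_le_0_iff)
  then have "{x0} \<in> null_sets sphere_measure"
    by (auto simp: sphere_measure.emeasure_eq_measure)
  from AE_not_in[OF this] show ?thesis by simp
qed

definition areg :: "nat \<Rightarrow> real" where
  "areg n = 1 + inverse (real (Suc n))"

lemma areg_bounds: "1 < areg n" "areg n \<le> 2"
  by (auto simp: areg_def divide_simps)

lemma areg_tendsto: "areg \<longlonglongrightarrow> 1"
  unfolding areg_def[abs_def] using tendsto_add[OF tendsto_const[of 1] LIMSEQ_inverse_real_of_nat] by simp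

lemma areg_antimono: "m \<le> n \<Longrightarrow> areg n \<le> areg m"
  by (simp add: areg_def le_imp_inverse_le)

text \<open>With \<open>p = -ln (a - t)\<close> in \<open>integral_sphere_zonal_eq_0\<close> the right-hand side has an integral that is
  bounded uniformly in \<open>a\<close>, so monotone convergence yields the integrability of \<open>U\<^sup>*\<close>.\<close>

lemma ln_zonal_bound:
  fixes t a :: real
  assumes "-1 \<le> t" "t \<le> 1" "1 < a" "a \<le> 2"
  shows "- ln (a - t) \<le> 6 - 2 * t * ln (a - t)"
proof -
  have ln3: "ln (3::real) \<le> 2" and ln2: "ln (2::real) \<le> 1"
    using ln_le_minus_one[of 3] ln_le_minus_one[of 2] by auto
  have u: "ln (a - t) \<le> 2"
  proof -
    have "ln (a - t) \<le> ln 3" using assms by (subst ln_le_cancel_iff) auto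
    then show ?thesis using ln3 by linarith
  qed
  \<comment> \<open>The claim is \<open>(2 t - 1) ln (a - t) \<le> 6\<close>. Near the singularity
    the two factors have opposite signs; elsewhere the logarithm is at most 2 and the other factor
    at most 3 in absolute value.\<close>
  show ?thesis
  proof (cases "t \<ge> 1/2 \<and> ln (a - t) < 0")
    case True
    then have "(2 * t - 1) * ln (a - t) \<le> 0" by (intro mult_nonneg_nonpos) auto
    then show ?thesis by (simp add: algebra_simps)
  next
    case False
    have l: "-1 \<le> ln (a - t)"
    proof (cases "t \<ge> 1/2")
      case True then show ?thesis using False by linarith
    next
      case False
      then have "ln (inverse 2) \<le> ln (a - t)" using assms by (subst ln_le_cancel_iff) auto
      then show ?thesis using ln2 ln_div[of 1 "2::real"] by simp
    qed
    have "\<bar>ln (a - t)\<bar> \<le> 2" using u l by auto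
    then have "\<bar>(2 * t - 1) * ln (a - t)\<bar> \<le> 3 * 2"
      using assms unfolding abs_mult by (intro mult_mono) auto
    then show ?thesis by (simp add: algebra_simps abs_le_iff)
  qed
qed

lemma integrable_sphere_borel_bounded:
  fixes f :: "real^3 \<Rightarrow> real"
  assumes "f \<in> borel_measurable borel" "\<And>x. x \<in> unit_sphere \<Longrightarrow> \<bar>f x\<bar> \<le> B"
  shows "integrable sphere_measure f"
proof (rule sphere_measure.integrable_const_bound)
  show "AE x in sphere_measure. norm (f x) \<le> B"
    using AE_sphere_measure by eventually_elim (use assms in auto)
qed (use assms in \<open>simp add: measurable_cong_sets[OF sets_sphere_measure refl]\<close>)

text \<open>The constant is \<open>6 + 2\<close> times the area \<open>4 pi\<close>: 6 comes from
  \<open>ln_zonal_bound\<close>, and 2 bounds \<open>(1 - t\<^sup>2) / (a - t)\<close>, whose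
  integral replaces that of \<open>- 2 t ln (a - t)\<close>. Bounds depending on \<open>a\<close>
  enter only for integrability.\<close>

lemma integral_ln_zonal_bound:
  assumes a: "1 < a" "a \<le> 2" and x0: "norm x0 = 1"
  shows "integrable sphere_measure (\<lambda>x. ln (a - x \<bullet> x0))"
    and "(LINT x|sphere_measure. - ln (a - x \<bullet> x0)) \<le> 32 * pi"
proof -
  note b = inner_unit_sphere_bounds[OF _ x0]
  have lnb: "\<bar>ln (a - t)\<bar> \<le> \<bar>ln (a - 1)\<bar> + ln 3" if "-1 \<le> t" "t \<le> 1" for t
  proof -
    have "ln (a - 1) \<le> ln (a - t)" "ln (a - t) \<le> ln 3"
      using that a by (simp_all add: ln_le_cancel_iff)
    then show ?thesis using ln_gt_zero[of "3::real"] by linarith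
  qed
  show i: "integrable sphere_measure (\<lambda>x. ln (a - x \<bullet> x0))"
    by (rule integrable_sphere_borel_bounded[where B = "\<bar>ln (a - 1)\<bar> + ln 3"])
       (use lnb b in auto)
  have i': "integrable sphere_measure (\<lambda>x. x \<bullet> x0 * ln (a - x \<bullet> x0))"
  proof (rule integrable_sphere_borel_bounded[where B = "1 * (\<bar>ln (a - 1)\<bar> + ln 3)"])
    show "\<bar>x \<bullet> x0 * ln (a - x \<bullet> x0)\<bar> \<le> 1 * (\<bar>ln (a - 1)\<bar> + ln 3)" if "x \<in> unit_sphere" for x
      unfolding abs_mult using b[of x] that lnb by (intro mult_mono) (auto simp: abs_le_iff)
  qed simp
  have f: "0 \<le> (1 - t\<^sup>2) / (a - t)" "(1 - t\<^sup>2) / (a - t) \<le> 2" if "-1 \<le> t" "t \<le> 1" for t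
  proof -
    have "0 \<le> (1 - t) * (1 + t)" using that by (intro mult_nonneg_nonneg) auto
    then show "0 \<le> (1 - t\<^sup>2) / (a - t)" using that a by (simp add: power2_eq_square algebra_simps)
    have "(1 - t) * (1 + t) \<le> (a - t) * 2" using that a by (intro mult_mono) auto
    then show "(1 - t\<^sup>2) / (a - t) \<le> 2" using that a by (simp add: divide_le_eq power2_eq_square algebra_simps)
  qed
  have i'': "integrable sphere_measure (\<lambda>x. (1 - (x \<bullet> x0)\<^sup>2) / (a - x \<bullet> x0))"
  proof (rule integrable_sphere_borel_bounded[where B = 2])
    show "\<bar>(1 - (x \<bullet> x0)\<^sup>2) / (a - x \<bullet> x0)\<bar> \<le> 2" if "x \<in> unit_sphere" for x
      using f[of "x \<bullet> x0"] b[of x] that by (subst abs_of_nonneg) auto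
  qed simp
  have "(LINT x:unit_sphere|sphere_measure. (1 - (x \<bullet> x0)\<^sup>2) * (1 / (a - x \<bullet> x0)) - 2 * (x \<bullet> x0) * (- ln (a - x \<bullet> x0))) = 0"
  proof (rule integral_sphere_zonal_eq_0[OF x0])
    show "((\<lambda>t. - ln (a - t)) has_real_derivative 1 / (a - t)) (at t)" if "-1 \<le> t" "t \<le> 1" for t
      using that a by (auto intro!: derivative_eq_intros)
  qed (use a in \<open>auto intro!: continuous_intros\<close>)
  then have "(LINT x|sphere_measure. (1 - (x \<bullet> x0)\<^sup>2) / (a - x \<bullet> x0) + 2 * (x \<bullet> x0 * ln (a - x \<bullet> x0))) = 0"
    by (subst (asm) integral_sphere_indicator) (simp_all add: mult.assoc)
  then have z: "(LINT x|sphere_measure. (1 - (x \<bullet> x0)\<^sup>2) / (a - x \<bullet> x0)) = - 2 * (LINT x|sphere_measure. x \<bullet> x0 * ln (a - x \<bullet> x0))"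
    using i' i'' by (subst (asm) Bochner_Integration.integral_add) auto
  have "(LINT x|sphere_measure. - ln (a - x \<bullet> x0)) \<le> (LINT x|sphere_measure. 6 * 1 - 2 * (x \<bullet> x0 * ln (a - x \<bullet> x0)))"
  proof (rule integral_mono_AE)
    show "AE x in sphere_measure. - ln (a - x \<bullet> x0) \<le> 6 * 1 - 2 * (x \<bullet> x0 * ln (a - x \<bullet> x0))"
      using AE_sphere_measure by eventually_elim (use ln_zonal_bound a b in \<open>auto simp: mult.assoc\<close>)
  qed (use i i' integrable_sphere_measure_1 in auto)
  also have "\<dots> = 24 * pi + (LINT x|sphere_measure. (1 - (x \<bullet> x0)\<^sup>2) / (a - x \<bullet> x0))"
    using i' integrable_sphere_measure_1 integral_sphere_measure_1 z
    by (subst Bochner_Integration.integral_diff) auto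
  also have "(LINT x|sphere_measure. (1 - (x \<bullet> x0)\<^sup>2) / (a - x \<bullet> x0)) \<le> (LINT x|sphere_measure. 2 * 1)"
  proof (rule integral_mono_AE)
    show "AE x in sphere_measure. (1 - (x \<bullet> x0)\<^sup>2) / (a - x \<bullet> x0) \<le> 2 * 1"
      using AE_sphere_measure by eventually_elim (use f b in auto)
  qed (use i'' integrable_sphere_measure_1 in auto)
  also have "\<dots> = 8 * pi"
    using integral_sphere_measure_1 by simp
  finally show "(LINT x|sphere_measure. - ln (a - x \<bullet> x0)) \<le> 32 * pi" by simp
qed

lemma inner_unit_lt_1:
  fixes x x0 :: "'a::real_inner"
  assumes "norm x = 1" "norm x0 = 1" "x \<noteq> x0"
  shows "x \<bullet> x0 < 1"
proof -
  have "0 < (x - x0) \<bullet> (x - x0)" using assms(3) by simp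
  also have "\<dots> = 2 - 2 * (x \<bullet> x0)"
    using assms(1,2) unfolding norm_eq_1 by (simp add: inner_diff_left inner_diff_right inner_commute[of x0 x])
  finally show ?thesis by simp
qed

lemma integrable_ln_zonal:
  assumes x0: "norm x0 = 1"
  shows "integrable sphere_measure (\<lambda>x. ln \<bar>1 - x \<bullet> x0\<bar>)"
proof -
  let ?F = "\<lambda>n. LINT x|sphere_measure. - ln (areg n - x \<bullet> x0)"
  note i = integral_ln_zonal_bound[OF areg_bounds x0]
  have mono: "- ln (areg m - x \<bullet> x0) \<le> - ln (areg n - x \<bullet> x0)" if "m \<le> n" "x \<in> unit_sphere" for m n x
    using areg_antimono[OF that(1)] areg_bounds(1)[of n] inner_unit_sphere_bounds[of x x0] that x0
    by (simp add: ln_le_cancel_iff)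
  have "incseq ?F"
  proof (rule incseq_SucI, rule integral_mono_AE)
    show "AE x in sphere_measure. - ln (areg n - x \<bullet> x0) \<le> - ln (areg (Suc n) - x \<bullet> x0)" for n
      using AE_sphere_measure by eventually_elim (rule mono, auto)
  qed (use i in auto)
  then obtain L where L: "?F \<longlonglongrightarrow> L"
    using incseq_convergent[of ?F "32 * pi"] i(2) by blast
  have "integrable sphere_measure (\<lambda>x. - ln \<bar>1 - x \<bullet> x0\<bar>)"
  proof (rule integrable_monotone_convergence[OF _ _ _ L])
    show "AE x in sphere_measure. mono (\<lambda>n. - ln (areg n - x \<bullet> x0))"
      using AE_sphere_measure by eventually_elim (auto intro!: monoI mono)
    show "AE x in sphere_measure. (\<lambda>n. - ln (areg n - x \<bullet> x0)) \<longlonglongrightarrow> - ln \<bar>1 - x \<bullet> x0\<bar>"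
      using AE_sphere_measure AE_sphere_neq[OF x0]
    proof eventually_elim
      case (elim x)
      then have "x \<bullet> x0 < 1" using x0 by (intro inner_unit_lt_1) auto
      then show ?case by (auto intro!: tendsto_eq_intros areg_tendsto)
    qed
  qed (use i in \<open>auto simp: measurable_cong_sets[OF sets_sphere_measure refl]\<close>)
  then show ?thesis by simp
qed

lemma Ustar_measurable [measurable]: "(\<lambda>x. Ustar x x0) \<in> borel_measurable borel"
  unfolding Ustar_def by measurable

lemma integrable_Ustar: "norm x0 = 1 \<Longrightarrow> integrable sphere_measure (\<lambda>x. Ustar x x0)"
  unfolding Ustar_def by (intro integrable_mult_right integrable_ln_zonal)

lemma integrable_Ustar_times:
  assumes x0: "norm x0 = 1" and h: "h \<in> borel_measurable borel" "\<And>x. x \<in> unit_sphere \<Longrightarrow> \<bar>h x\<bar> \<le> B"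
  shows "integrable sphere_measure (\<lambda>x. Ustar x x0 * h x)"
proof (rule Bochner_Integration.integrable_bound[OF integrable_mult_left[OF integrable_Ustar[OF x0], of B]])
  show "AE x in sphere_measure. norm (Ustar x x0 * h x) \<le> norm (Ustar x x0 * B)"
    using AE_sphere_measure
  proof eventually_elim
    case (elim x)
    have "\<bar>h x\<bar> \<le> \<bar>B\<bar>" using h(2)[OF elim] by linarith
    then show ?case by (simp add: abs_mult mult_left_mono)
  qed
qed (use h(1) in \<open>auto simp: measurable_cong_sets[OF sets_sphere_measure refl]\<close>)

text \<open>From \<open>1 - t \<le> areg n - t \<le> 3\<close> follows \<open>\<bar>ln (areg n -
  t)\<bar> \<le> \<bar>ln (1 - t)\<bar> + ln 3\<close>, an integrable bound independent of
  \<open>n\<close>.\<close>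

lemma tendsto_integral_Ureg:
  assumes x0: "norm x0 = 1" and h: "h \<in> borel_measurable borel" "\<And>x. x \<in> unit_sphere \<Longrightarrow> \<bar>h x\<bar> \<le> B"
  shows "(\<lambda>n. LINT x|sphere_measure. Ureg (areg n) x0 x * h x) \<longlonglongrightarrow> (LINT x|sphere_measure. Ustar x x0 * h x)"
proof (rule integral_dominated_convergence[where w = "\<lambda>x. (\<bar>ln \<bar>1 - x \<bullet> x0\<bar>\<bar> + ln 3 * 1) * \<bar>B\<bar>"])
  show "integrable sphere_measure (\<lambda>x. (\<bar>ln \<bar>1 - x \<bullet> x0\<bar>\<bar> + ln 3 * 1) * \<bar>B\<bar>)"
    using integrable_ln_zonal[OF x0] integrable_sphere_measure_1 by auto
  show "AE x in sphere_measure. (\<lambda>n. Ureg (areg n) x0 x * h x) \<longlonglongrightarrow> Ustar x x0 * h x"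
    using AE_sphere_measure AE_sphere_neq[OF x0]
  proof eventually_elim
    case (elim x)
    then have "x \<bullet> x0 < 1" using x0 by (intro inner_unit_lt_1) auto
    then show ?case unfolding Ureg_def Ustar_def by (auto intro!: tendsto_eq_intros areg_tendsto)
  qed
  show "AE x in sphere_measure. norm (Ureg (areg n) x0 x * h x) \<le> (\<bar>ln \<bar>1 - x \<bullet> x0\<bar>\<bar> + ln 3 * 1) * \<bar>B\<bar>" for n
    using AE_sphere_measure AE_sphere_neq[OF x0]
  proof eventually_elim
    case (elim x)
    let ?t = "x \<bullet> x0"
    have t: "?t < 1" "-1 \<le> ?t" using elim x0 by (auto intro!: inner_unit_lt_1 inner_unit_sphere_bounds)
    have "ln (1 - ?t) \<le> ln (areg n - ?t)" "ln (areg n - ?t) \<le> ln 3"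
      using t areg_bounds[of n] by (simp_all add: ln_le_cancel_iff)
    then have "\<bar>ln (areg n - ?t)\<bar> \<le> \<bar>ln \<bar>1 - ?t\<bar>\<bar> + ln 3"
      using t ln_gt_zero[of "3::real"] abs_of_pos[of "1 - ?t"] by linarith
    moreover have "\<bar>Ureg (areg n) x0 x\<bar> \<le> 1 * \<bar>ln (areg n - ?t)\<bar>"
      unfolding Ureg_def abs_mult using pi_ge_two by (intro mult_right_mono) auto
    ultimately have "\<bar>Ureg (areg n) x0 x\<bar> \<le> \<bar>ln \<bar>1 - ?t\<bar>\<bar> + ln 3 * 1" by simp
    moreover have "\<bar>h x\<bar> \<le> \<bar>B\<bar>" using h(2)[OF elim(1)] by linarith
    ultimately show ?case
      unfolding real_norm_def abs_mult by (intro mult_mono) auto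
  qed
qed (use h(1) in \<open>auto simp: measurable_cong_sets[OF sets_sphere_measure refl] Ureg_def\<close>)

text \<open>The usual argument for an approximate identity: close to \<open>x0\<close> the function
  is near \<open>L\<close> and the kernel has mass at most 1, far from \<open>x0\<close> the kernel
  tends to zero uniformly. Only boundedness and the behaviour at \<open>x0\<close> enter, so
  \<open>h\<close> may jump elsewhere, as a function cut off by an indicator does.\<close>

lemma tendsto_integral_sphere_kernel:
  assumes x0: "norm x0 = 1" and h: "h \<in> borel_measurable borel" "\<And>x. x \<in> unit_sphere \<Longrightarrow> \<bar>h x\<bar> \<le> B"
    and lim: "\<And>e. e > 0 \<Longrightarrow> \<exists>d>0. \<forall>x\<in>unit_sphere. dist x x0 < d \<longrightarrow> \<bar>h x - L\<bar> < e"
  shows "(\<lambda>n. LINT x|sphere_measure. sphere_kernel (areg n) x0 x * h x) \<longlonglongrightarrow> L"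
proof (rule LIMSEQ_I)
  fix e :: real assume e: "e > 0"
  obtain d where d: "d > 0" "\<And>x. x \<in> unit_sphere \<Longrightarrow> dist x x0 < d \<Longrightarrow> \<bar>h x - L\<bar> < e / 2"
    using lim[of "e / 2"] e by auto
  define M where "M = \<bar>B\<bar> + \<bar>L\<bar>"
  \<comment> \<open>At distance at least \<open>d\<close> from \<open>x0\<close> one has
    \<open>a - x \<bullet> x0 \<ge> d\<^sup>2 / 2\<close>, since the squared distance is
    \<open>2 - 2 (x \<bullet> x0)\<close>; \<open>c a\<close> bounds the integrand there.\<close>
  define c where "c a = M * ((a\<^sup>2 - 1) / (4 * pi * (d\<^sup>2 / 2)\<^sup>2))" for a :: real
  have "(\<lambda>n. c (areg n) * (4 * pi)) \<longlonglongrightarrow> 0"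
    unfolding c_def using d(1) by (auto intro!: tendsto_eq_intros areg_tendsto)
  then have "\<forall>\<^sub>F n in sequentially. c (areg n) * (4 * pi) < e / 2"
    by (rule order_tendstoD(2)) (use e in simp)
  then obtain N where N: "\<And>n. n \<ge> N \<Longrightarrow> c (areg n) * (4 * pi) < e / 2"
    by (auto simp: eventually_sequentially)
  show "\<exists>N. \<forall>n\<ge>N. norm ((LINT x|sphere_measure. sphere_kernel (areg n) x0 x * h x) - L) < e"
  proof (intro exI[of _ N] allI impI)
    fix n assume n: "n \<ge> N"
    let ?a = "areg n"
    note K = integral_sphere_kernel[OF areg_bounds(1)[of n] x0]
    have K0: "0 \<le> sphere_kernel ?a x0 x" for x
      using areg_bounds[of n] by (auto simp: sphere_kernel_def)
    have Kh: "integrable sphere_measure (\<lambda>x. sphere_kernel ?a x0 x * h x)"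
    proof (rule Bochner_Integration.integrable_bound[OF integrable_mult_left[OF K(1), of B]])
      show "AE x in sphere_measure. norm (sphere_kernel ?a x0 x * h x) \<le> norm (sphere_kernel ?a x0 x * B)"
        using AE_sphere_measure
      proof eventually_elim
        case (elim x)
        have "\<bar>h x\<bar> \<le> \<bar>B\<bar>" using h(2)[OF elim] by linarith
        then show ?case by (simp add: abs_mult mult_left_mono)
      qed
    qed (use h(1) in \<open>auto simp: measurable_cong_sets[OF sets_sphere_measure refl]\<close>)
    have "(LINT x|sphere_measure. sphere_kernel ?a x0 x * h x) - L
        = (LINT x|sphere_measure. sphere_kernel ?a x0 x * h x - sphere_kernel ?a x0 x * L)"
      using K Kh by (subst Bochner_Integration.integral_diff) auto
    also have "norm \<dots> \<le> (LINT x|sphere_measure. norm (sphere_kernel ?a x0 x * h x - sphere_kernel ?a x0 x * L))"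
      by (rule integral_norm_bound)
    also have "\<dots> \<le> (LINT x|sphere_measure. sphere_kernel ?a x0 x * (e / 2) + c ?a * 1)"
    proof (rule integral_mono_AE)
      show "integrable sphere_measure (\<lambda>x. norm (sphere_kernel ?a x0 x * h x - sphere_kernel ?a x0 x * L))"
        using K Kh by auto
      show "integrable sphere_measure (\<lambda>x. sphere_kernel ?a x0 x * (e / 2) + c ?a * 1)"
        using K integrable_sphere_measure_1 by auto
      show "AE x in sphere_measure. norm (sphere_kernel ?a x0 x * h x - sphere_kernel ?a x0 x * L)
          \<le> sphere_kernel ?a x0 x * (e / 2) + c ?a * 1"
        using AE_sphere_measure
      proof eventually_elim
        case (elim x)
        have a2: "0 \<le> ?a\<^sup>2 - 1" using areg_bounds(1)[of n] by simp
        have c0: "0 \<le> c ?a" unfolding c_def M_def using a2 by (intro mult_nonneg_nonneg divide_nonneg_nonneg) auto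
        have eq: "norm (sphere_kernel ?a x0 x * h x - sphere_kernel ?a x0 x * L) = sphere_kernel ?a x0 x * \<bar>h x - L\<bar>"
          using K0[of x] by (simp add: abs_mult flip: right_diff_distrib)
        show ?case
        proof (cases "dist x x0 < d")
          case True
          then have "sphere_kernel ?a x0 x * \<bar>h x - L\<bar> \<le> sphere_kernel ?a x0 x * (e / 2)"
            using d(2)[OF elim] K0[of x] by (intro mult_left_mono) auto
          then show ?thesis using eq c0 by simp
        next
          case False
          have "(dist x x0)\<^sup>2 = 2 - 2 * (x \<bullet> x0)"
            using elim x0 unfolding mem_sphere_0 norm_eq_1 dist_norm power2_norm_eq_inner
            by (simp add: inner_diff_left inner_diff_right inner_commute[of x0 x])
          moreover have "d\<^sup>2 \<le> (dist x x0)\<^sup>2" using False d(1) by (intro power_mono) auto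
          ultimately have "d\<^sup>2 / 2 \<le> ?a - x \<bullet> x0" using areg_bounds(1)[of n] by simp
          then have "(d\<^sup>2 / 2)\<^sup>2 \<le> (?a - x \<bullet> x0)\<^sup>2" by (intro power_mono) auto
          then have "sphere_kernel ?a x0 x \<le> (?a\<^sup>2 - 1) / (4 * pi * (d\<^sup>2 / 2)\<^sup>2)"
            unfolding sphere_kernel_def using a2 d(1) by (intro frac_le) auto
          moreover have "\<bar>h x - L\<bar> \<le> M" using h(2)[OF elim] unfolding M_def by linarith
          ultimately have "sphere_kernel ?a x0 x * \<bar>h x - L\<bar> \<le> c ?a"
            unfolding c_def using K0[of x] by (subst mult.commute) (intro mult_mono, auto)
          moreover have "0 \<le> sphere_kernel ?a x0 x * (e / 2)" using K0[of x] e by simp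
          ultimately show ?thesis using eq by simp
        qed
      qed
    qed
    also have "\<dots> = e / 2 + c ?a * (4 * pi)"
      using K integrable_sphere_measure_1 integral_sphere_measure_1
      by (subst Bochner_Integration.integral_add) auto
    also have "\<dots> < e" using N[OF n] by simp
    finally show "norm ((LINT x|sphere_measure. sphere_kernel ?a x0 x * h x) - L) < e" .
  qed
qed

section \<open>Tubular coordinates around a curve on the sphere\<close>

lemma inner_cross_cross: "cross3 a b \<bullet> cross3 a b = (a \<bullet> a) * (b \<bullet> b) - (a \<bullet> b)\<^sup>2"
  by (simp add: cross3_simps power2_eq_square)

lemma bounded_bilinear_cross3: "bounded_bilinear cross3"
  unfolding bilinear_conv_bounded_bilinear[symmetric] bilinear_def linear_iff
  by (simp add: cross_add_left cross_add_right cross_mult_left cross_mult_right)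

lemma cross_rotate: "cross3 (- s *\<^sub>R g + c *\<^sub>R n) (c *\<^sub>R g + s *\<^sub>R n) = (c * c + s * s) *\<^sub>R cross3 n g"
  by (simp add: cross3_simps)

text \<open>The vectors \<open>a\<close>, \<open>b\<close> and \<open>a \<times> b\<close> are
  orthogonal, so only the direction of \<open>b\<close> is left. Multiplying by
  \<open>b \<bullet> b\<close> avoids a division and covers \<open>b = 0\<close>. It is applied with
  \<open>\<gamma>\<close> and \<open>\<gamma>'\<close>.\<close>

lemma vector_parallel_if_orthogonal:
  fixes a b v :: "real^3"
  assumes "v \<bullet> a = 0" "v \<bullet> cross3 a b = 0" "a \<bullet> b = 0" "a \<bullet> a = 1"
  shows "(b \<bullet> b) *\<^sub>R v = (v \<bullet> b) *\<^sub>R b"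
proof -
  have "cross3 v (cross3 a (cross3 a b)) = 0"
    using assms by (simp add: Lagrange[of v])
  then have "cross3 b v = 0"
    using assms by (simp add: Lagrange[of a] cross_mult_right cross_skew[of v] cross_minus_right)
  then have "cross3 b (cross3 b v) = 0"
    by simp
  then show ?thesis
    by (simp add: Lagrange inner_commute)
qed

text \<open>Continuity of the derivative in operator norm, in the form that the theorem on local
  injectivity demands.\<close>

lemma has_derivative_partials_onorm:
  fixes A B :: "'a::metric_space \<Rightarrow> 'b::real_normed_vector"
  assumes A: "continuous (at a) A" and B: "continuous (at a) B" and e: "e > 0"
  shows "\<exists>d>0. \<forall>x. dist a x < d \<longrightarrow>
    onorm (\<lambda>h :: real \<times> real. (fst h *\<^sub>R A x + snd h *\<^sub>R B x) - (fst h *\<^sub>R A a + snd h *\<^sub>R B a)) < e"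
proof -
  have e4: "e / 4 > 0" using e by simp
  obtain d1 where d1: "d1 > 0" "\<forall>x. dist x a < d1 \<longrightarrow> dist (A x) (A a) < e / 4"
    using A e4 unfolding continuous_at_eps_delta by blast
  obtain d2 where d2: "d2 > 0" "\<forall>x. dist x a < d2 \<longrightarrow> dist (B x) (B a) < e / 4"
    using B e4 unfolding continuous_at_eps_delta by blast
  show ?thesis
  proof (intro exI[of _ "min d1 d2"] conjI allI impI)
    fix x assume x: "dist a x < min d1 d2"
    have "onorm (\<lambda>h :: real \<times> real. (fst h *\<^sub>R A x + snd h *\<^sub>R B x) - (fst h *\<^sub>R A a + snd h *\<^sub>R B a)) \<le> e / 2"
    proof (rule onorm_bound)
      fix h :: "real \<times> real"
      have "(fst h *\<^sub>R A x + snd h *\<^sub>R B x) - (fst h *\<^sub>R A a + snd h *\<^sub>R B a)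
          = fst h *\<^sub>R (A x - A a) + snd h *\<^sub>R (B x - B a)"
        by (simp add: algebra_simps)
      also have "norm \<dots> \<le> \<bar>fst h\<bar> * norm (A x - A a) + \<bar>snd h\<bar> * norm (B x - B a)"
        by (rule order_trans[OF norm_triangle_ineq]) simp
      also have "\<dots> \<le> norm h * (e / 4) + norm h * (e / 4)"
        using d1(2)[rule_format, of x] d2(2)[rule_format, of x] x norm_fst_le[of "fst h" "snd h"] norm_snd_le[of "snd h" "fst h"]
        by (intro add_mono mult_mono) (auto simp: dist_norm norm_minus_commute dist_commute)
      finally show "norm ((fst h *\<^sub>R A x + snd h *\<^sub>R B x) - (fst h *\<^sub>R A a + snd h *\<^sub>R B a)) \<le> e / 2 * norm h"
        by (simp add: algebra_simps)
    qed (use e in simp)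
    then show "onorm (\<lambda>h :: real \<times> real. (fst h *\<^sub>R A x + snd h *\<^sub>R B x) - (fst h *\<^sub>R A a + snd h *\<^sub>R B a)) < e"
      using e by simp
  qed (use d1 d2 in auto)
qed

lemma periodic_add_of_int:
  fixes f :: "real \<Rightarrow> 'a"
  assumes "\<And>s. f (s + 1) = f s"
  shows "f (s + of_int n) = f s"
proof -
  have *: "f (s + real m) = f s" for s m
  proof (induction m)
    case (Suc m)
    then show ?case using assms[of "s + real m"] by (simp add: algebra_simps)
  qed simp
  show ?thesis
    using *[of s "nat n"] *[of "s + of_int n" "nat (- n)"] by (cases "n \<ge> 0") simp_all
qed

lemma periodic_frac:
  fixes f :: "real \<Rightarrow> 'a"
  assumes "\<And>s. f (s + 1) = f s"
  shows "f (frac s) = f s"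
  using periodic_add_of_int[of f s "- \<lfloor>s\<rfloor>", OF assms] by (simp add: frac_def)

text \<open>The sign \<open>\<sigma> = \<plusminus>1\<close> selects the side of the curve to which the normal \<open>nv\<close> below points.\<close>

locale sphere_curve =
  fixes \<gamma> \<gamma>' \<gamma>'' :: "real \<Rightarrow> real^3" and \<sigma> :: real
  assumes periodic: "\<gamma> (s + 1) = \<gamma> s"
    and on_sphere: "norm (\<gamma> s) = 1"
    and deriv1: "(\<gamma> has_vector_derivative \<gamma>' s) (at s)"
    and deriv2: "(\<gamma>' has_vector_derivative \<gamma>'' s) (at s)"
    and cont2: "continuous_on UNIV \<gamma>''"
    and regular: "\<gamma>' s \<noteq> 0"
    and simple: "0 \<le> s \<Longrightarrow> s < 1 \<Longrightarrow> 0 \<le> s' \<Longrightarrow> s' < 1 \<Longrightarrow> \<gamma> s = \<gamma> s' \<Longrightarrow> s = s'"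
    and sign: "\<sigma> * \<sigma> = 1"
begin

lemma cont0: "continuous_on T \<gamma>" and cont1: "continuous_on T \<gamma>'"
  by (auto intro: continuous_at_imp_continuous_on
      has_vector_derivative_continuous[OF deriv1] has_vector_derivative_continuous[OF deriv2])

lemma cont_rules [continuous_intros]:
  fixes f :: "'t::t2_space \<Rightarrow> real"
  assumes "continuous_on T f"
  shows "continuous_on T (\<lambda>x. \<gamma> (f x))" "continuous_on T (\<lambda>x. \<gamma>' (f x))" "continuous_on T (\<lambda>x. \<gamma>'' (f x))"
  using continuous_on_compose2[OF cont0 assms] continuous_on_compose2[OF cont1 assms]
    continuous_on_compose2[OF cont2 assms] by auto

lemma periodic': "\<gamma>' (s + 1) = \<gamma>' s"
proof -
  have "((\<lambda>s. \<gamma> (s + 1)) has_vector_derivative \<gamma>' (s + 1)) (at s)"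
    using vector_diff_chain_at[of "\<lambda>s. s + 1" 1 s \<gamma> "\<gamma>' (s + 1)"] deriv1
      has_vector_derivative_add_const[of "\<lambda>s. s" 1 1] has_vector_derivative_id[of "at s"]
    by (simp add: o_def id_def)
  then show ?thesis
    using vector_derivative_unique_at[OF _ deriv1] by (simp add: periodic)
qed

definition speed :: "real \<Rightarrow> real" where "speed s = norm (\<gamma>' s)"

definition nv :: "real \<Rightarrow> real^3" where
  "nv s = (\<sigma> / speed s) *\<^sub>R cross3 (\<gamma> s) (\<gamma>' s)"

definition nv' :: "real \<Rightarrow> real^3" where
  "nv' s = (\<sigma> / speed s) *\<^sub>R cross3 (\<gamma> s) (\<gamma>'' s)
     - (\<sigma> * (\<gamma>' s \<bullet> \<gamma>'' s) / speed s ^ 3) *\<^sub>R cross3 (\<gamma> s) (\<gamma>' s)"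

text \<open>The geodesic curvature with respect to \<open>nv\<close>, up to the sign convention,
  read off from the tangential component of \<open>nv'\<close>.\<close>

definition curv :: "real \<Rightarrow> real" where
  "curv s = - (nv' s \<bullet> \<gamma>' s) / (speed s)\<^sup>2"

definition tube :: "real \<Rightarrow> real \<Rightarrow> real^3" where
  "tube s r = cos r *\<^sub>R \<gamma> s + sin r *\<^sub>R nv s"

definition tube_s :: "real \<Rightarrow> real \<Rightarrow> real^3" where
  "tube_s s r = cos r *\<^sub>R \<gamma>' s + sin r *\<^sub>R nv' s"

definition tube_r :: "real \<Rightarrow> real \<Rightarrow> real^3" where
  "tube_r s r = - sin r *\<^sub>R \<gamma> s + cos r *\<^sub>R nv s"

lemma speed_pos: "speed s > 0"
  using regular by (simp add: speed_def)

lemma nv_periodic: "nv (s + 1) = nv s"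
  by (simp add: nv_def speed_def periodic periodic')

lemma tube_periodic: "tube (s + 1) r = tube s r" "tube_r (s + 1) r = tube_r s r"
  by (simp_all add: tube_def tube_r_def periodic nv_periodic)

lemma cont_nv [continuous_intros]:
  fixes f :: "'t::t2_space \<Rightarrow> real"
  assumes "continuous_on T f"
  shows "continuous_on T (\<lambda>x. nv (f x))" "continuous_on T (\<lambda>x. nv' (f x))" "continuous_on T (\<lambda>x. curv (f x))"
proof -
  show "continuous_on T (\<lambda>x. nv (f x))"
    unfolding nv_def speed_def using regular by (intro continuous_intros assms continuous_on_cross) auto
  show 1: "continuous_on T (\<lambda>x. nv' (f x))"
    unfolding nv'_def speed_def using regular by (intro continuous_intros assms continuous_on_cross) auto
  show "continuous_on T (\<lambda>x. curv (f x))"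
    unfolding curv_def speed_def using regular by (intro continuous_intros assms 1) auto
qed

lemma cont_tube [continuous_intros]:
  fixes f g :: "'t::t2_space \<Rightarrow> real"
  assumes "continuous_on T f" "continuous_on T g"
  shows "continuous_on T (\<lambda>x. tube (f x) (g x))" "continuous_on T (\<lambda>x. tube_s (f x) (g x))"
    "continuous_on T (\<lambda>x. tube_r (f x) (g x))"
  unfolding tube_def tube_s_def tube_r_def by (intro continuous_intros assms)+

lemma \<gamma>_inner: "\<gamma> s \<bullet> \<gamma> s = 1"
  using on_sphere[of s] by (simp add: norm_eq_1)

lemma constant_inner_deriv:
  fixes f g :: "real \<Rightarrow> real^3"
  assumes f: "(f has_vector_derivative f') (at s)" and g: "(g has_vector_derivative g') (at s)"
    and c: "\<And>s. f s \<bullet> g s = c"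
  shows "f s \<bullet> g' + f' \<bullet> g s = 0"
proof -
  have "((\<lambda>s. f s \<bullet> g s) has_derivative (\<lambda>h. f s \<bullet> (h *\<^sub>R g') + (h *\<^sub>R f') \<bullet> g s)) (at s)"
    by (rule has_derivative_inner[OF f[unfolded has_vector_derivative_def] g[unfolded has_vector_derivative_def]])
  moreover have "((\<lambda>s. f s \<bullet> g s) has_derivative (\<lambda>h. 0)) (at s)"
    using c by simp
  ultimately have "(\<lambda>h. f s \<bullet> (h *\<^sub>R g') + (h *\<^sub>R f') \<bullet> g s) = (\<lambda>h. 0)"
    by (rule has_derivative_unique)
  from fun_cong[OF this, of 1] show ?thesis by simp
qed

lemma \<gamma>_\<gamma>': "\<gamma> s \<bullet> \<gamma>' s = 0"
  using constant_inner_deriv[OF deriv1 deriv1 \<gamma>_inner, of s] by (simp add: inner_commute)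

lemma nv_facts: "nv s \<bullet> \<gamma> s = 0" "nv s \<bullet> \<gamma>' s = 0" "nv s \<bullet> nv s = 1"
proof -
  show "nv s \<bullet> \<gamma> s = 0" "nv s \<bullet> \<gamma>' s = 0"
    by (simp_all add: nv_def inner_commute[of "cross3 _ _"] dot_cross_self)
  have "nv s \<bullet> nv s = (\<sigma> * \<sigma>) / (speed s)\<^sup>2 * (cross3 (\<gamma> s) (\<gamma>' s) \<bullet> cross3 (\<gamma> s) (\<gamma>' s))"
    by (simp add: nv_def power2_eq_square)
  also have "\<dots> = 1"
    unfolding inner_cross_cross \<gamma>_inner \<gamma>_\<gamma>' sign
    using regular by (simp add: speed_def dot_square_norm)
  finally show "nv s \<bullet> nv s = 1" .
qed

lemma cross_\<gamma>_\<gamma>': "cross3 (\<gamma> s) (\<gamma>' s) = (\<sigma> * speed s) *\<^sub>R nv s"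
  using speed_pos[of s] by (simp add: nv_def sign mult.assoc[symmetric])

lemma nv_deriv: "(nv has_vector_derivative nv' s) (at s)"
proof -
  have d1: "(\<gamma> has_derivative (\<lambda>h. h *\<^sub>R \<gamma>' s)) (at s)" and d2: "(\<gamma>' has_derivative (\<lambda>h. h *\<^sub>R \<gamma>'' s)) (at s)"
    using deriv1 deriv2 by (simp_all add: has_vector_derivative_def)
  have c: "((\<lambda>s. cross3 (\<gamma> s) (\<gamma>' s)) has_derivative
      (\<lambda>h. cross3 (\<gamma> s) (h *\<^sub>R \<gamma>'' s) + cross3 (h *\<^sub>R \<gamma>' s) (\<gamma>' s))) (at s)"
    by (rule bounded_bilinear.FDERIV[OF bounded_bilinear_cross3 d1 d2])
  have n: "(speed has_derivative (\<lambda>h. (h *\<^sub>R \<gamma>'' s) \<bullet> sgn (\<gamma>' s))) (at s)"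
    unfolding speed_def[abs_def] by (rule has_derivative_compose[OF d2 has_derivative_norm[OF regular]])
  have i: "((\<lambda>s. \<sigma> / speed s) has_derivative (\<lambda>h. - \<sigma> * ((h *\<^sub>R \<gamma>'' s) \<bullet> sgn (\<gamma>' s)) / (speed s)\<^sup>2)) (at s)"
  proof -
    have "((\<lambda>v. \<sigma> / v) has_real_derivative - \<sigma> / (speed s)\<^sup>2) (at (speed s))"
      using speed_pos[of s] by (auto intro!: derivative_eq_intros simp: power2_eq_square)
    from has_derivative_compose[OF n this[unfolded has_field_derivative_def]] show ?thesis
      by simp
  qed
  have "(nv has_derivative (\<lambda>h. (\<sigma> / speed s) *\<^sub>R (cross3 (\<gamma> s) (h *\<^sub>R \<gamma>'' s) + cross3 (h *\<^sub>R \<gamma>' s) (\<gamma>' s))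
      + (- \<sigma> * ((h *\<^sub>R \<gamma>'' s) \<bullet> sgn (\<gamma>' s)) / (speed s)\<^sup>2) *\<^sub>R cross3 (\<gamma> s) (\<gamma>' s))) (at s)"
    unfolding nv_def[abs_def] by (rule has_derivative_scaleR[OF i c])
  moreover have "(\<lambda>h. (\<sigma> / speed s) *\<^sub>R (cross3 (\<gamma> s) (h *\<^sub>R \<gamma>'' s) + cross3 (h *\<^sub>R \<gamma>' s) (\<gamma>' s))
      + (- \<sigma> * ((h *\<^sub>R \<gamma>'' s) \<bullet> sgn (\<gamma>' s)) / (speed s)\<^sup>2) *\<^sub>R cross3 (\<gamma> s) (\<gamma>' s)) = (\<lambda>h. h *\<^sub>R nv' s)"
    using speed_pos[of s]
    by (auto simp: fun_eq_iff nv'_def cross_mult_right cross_mult_left sgn_div_norm speed_def[symmetric]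
        scaleR_diff_right power2_eq_square power3_eq_cube inner_commute divide_simps ac_simps)
  ultimately show ?thesis
    by (simp add: has_vector_derivative_def)
qed

text \<open>Differentiating \<open>nv \<bullet> \<gamma> = 0\<close> and
  \<open>nv \<bullet> nv = 1\<close> removes the components along \<open>\<gamma>\<close> and
  \<open>nv\<close>. Hence every parallel curve has velocity proportional to
  \<open>\<gamma>'\<close>.\<close>

lemma nv'_parallel: "nv' s = - curv s *\<^sub>R \<gamma>' s"
proof -
  have 1: "nv' s \<bullet> \<gamma> s = 0"
    using constant_inner_deriv[OF nv_deriv deriv1 nv_facts(1), of s] nv_facts(2)[of s] by simp
  have "nv' s \<bullet> nv s = 0"
    using constant_inner_deriv[OF nv_deriv nv_deriv nv_facts(3), of s] by (simp add: inner_commute)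
  then have "nv' s \<bullet> cross3 (\<gamma> s) (\<gamma>' s) = 0"
    by (simp add: cross_\<gamma>_\<gamma>')
  from vector_parallel_if_orthogonal[OF 1 this \<gamma>_\<gamma>' \<gamma>_inner]
  have e: "(speed s)\<^sup>2 *\<^sub>R nv' s = (nv' s \<bullet> \<gamma>' s) *\<^sub>R \<gamma>' s"
    by (simp add: speed_def dot_square_norm)
  have "nv' s = (1 / (speed s)\<^sup>2) *\<^sub>R ((speed s)\<^sup>2 *\<^sub>R nv' s)"
    using speed_pos[of s] by simp
  then show ?thesis
    unfolding e by (simp add: curv_def)
qed

lemma norm_tube: "norm (tube s r) = 1"
proof -
  have "tube s r \<bullet> tube s r = (cos r)\<^sup>2 + (sin r)\<^sup>2"
    by (simp add: tube_def inner_add_left inner_add_right \<gamma>_inner nv_facts inner_commute[of "\<gamma> s" "nv s"]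
        flip: power2_eq_square)
  then show ?thesis by (simp add: norm_eq_1)
qed

lemma tube_0: "tube s 0 = \<gamma> s" "tube_s s 0 = \<gamma>' s" "tube_r s 0 = nv s"
  by (simp_all add: tube_def tube_s_def tube_r_def)

text \<open>The pair \<open>tube\<close>, \<open>tube_r\<close> is the pair \<open>\<gamma>\<close>,
  \<open>nv\<close> rotated by \<open>r\<close> in its plane, so the cross product of the pair does
  not change; the velocity is \<open>\<gamma>'\<close> times \<open>cos r - curv s * sin r\<close>,
  whose zeros are the focal points.\<close>

lemma tube_jacobian:
  "tube s r \<bullet> cross3 (tube_s s r) (tube_r s r) = \<sigma> * speed s * (cos r - curv s * sin r)"
proof -
  have ts: "tube_s s r = (cos r - curv s * sin r) *\<^sub>R \<gamma>' s"
    by (simp add: tube_s_def nv'_parallel algebra_simps)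
  have "cross3 (tube_r s r) (tube s r) = ((cos r)\<^sup>2 + (sin r)\<^sup>2) *\<^sub>R cross3 (nv s) (\<gamma> s)"
    unfolding tube_r_def tube_def by (simp only: cross_rotate power2_eq_square)
  then have "\<gamma>' s \<bullet> cross3 (tube_r s r) (tube s r) = \<gamma>' s \<bullet> cross3 (nv s) (\<gamma> s)"
    by simp
  also have "\<dots> = cross3 (\<gamma> s) (\<gamma>' s) \<bullet> nv s"
    by (metis cross_triple inner_commute)
  also have "\<dots> = \<sigma> * speed s"
    by (simp add: cross_\<gamma>_\<gamma>' nv_facts)
  finally have "\<gamma>' s \<bullet> cross3 (tube_r s r) (tube s r) = \<sigma> * speed s" .
  moreover have "tube s r \<bullet> cross3 (\<gamma>' s) (tube_r s r) = \<gamma>' s \<bullet> cross3 (tube_r s r) (tube s r)"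
    by (metis cross_triple inner_commute)
  ultimately show ?thesis
    unfolding ts by (simp add: cross_mult_left)
qed

lemma has_derivative_tube:
  "((\<lambda>z. tube (fst z) (snd z)) has_derivative
     (\<lambda>h. fst h *\<^sub>R tube_s (fst z) (snd z) + snd h *\<^sub>R tube_r (fst z) (snd z))) (at z)"
proof -
  have g: "((\<lambda>z. \<gamma> (fst z)) has_derivative (\<lambda>h. fst h *\<^sub>R \<gamma>' (fst z))) (at z)"
    by (rule has_derivative_compose[OF has_derivative_fst[OF has_derivative_ident] deriv1[unfolded has_vector_derivative_def]])
  have n: "((\<lambda>z. nv (fst z)) has_derivative (\<lambda>h. fst h *\<^sub>R nv' (fst z))) (at z)"
    by (rule has_derivative_compose[OF has_derivative_fst[OF has_derivative_ident] nv_deriv[unfolded has_vector_derivative_def]])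
  have c: "((\<lambda>z. cos (snd z)) has_derivative (\<lambda>h. - sin (snd z) * snd h)) (at z)"
      "((\<lambda>z. sin (snd z)) has_derivative (\<lambda>h. cos (snd z) * snd h)) (at z)" for z :: "real \<times> real"
    by (auto intro!: derivative_eq_intros)
  show ?thesis
    unfolding tube_def
    by (rule has_derivative_eq_rhs[OF has_derivative_add[OF has_derivative_scaleR[OF c(1) g] has_derivative_scaleR[OF c(2) n]]])
       (simp add: fun_eq_iff tube_s_def tube_r_def algebra_simps)
qed

text \<open>The two mixed derivatives exist and agree because \<open>s\<close> and \<open>r\<close>
  are separated in each summand, although \<open>nv'\<close> is merely continuous. This common value
  cancels in the exterior derivative below.\<close>

lemma tube_partials:
  "((\<lambda>s. tube s r) has_vector_derivative tube_s s r) (at s)"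
  "((\<lambda>r. tube s r) has_vector_derivative tube_r s r) (at r)"
  "((\<lambda>s. tube_r s r) has_vector_derivative (- sin r *\<^sub>R \<gamma>' s + cos r *\<^sub>R nv' s)) (at s)"
  "((\<lambda>r. tube_s s r) has_vector_derivative (- sin r *\<^sub>R \<gamma>' s + cos r *\<^sub>R nv' s)) (at r)"
  unfolding tube_def tube_s_def tube_r_def
  by (auto intro!: derivative_eq_intros deriv1 nv_deriv simp: has_vector_derivative_minus)


section \<open>Injectivity of the tubular map near the curve\<close>

lemma periodic_int: "\<gamma> (s + of_int n) = \<gamma> s" "\<gamma>' (s + of_int n) = \<gamma>' s"
  by (rule periodic_add_of_int[of \<gamma>, OF periodic], rule periodic_add_of_int[of \<gamma>', OF periodic'])

lemma tube_periodic_int: "tube (s + of_int n) r = tube s r"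
  by (simp add: tube_def nv_def speed_def periodic_int)

lemma tube_frac: "tube (frac s) r = tube s r"
  using tube_periodic_int[of s "- \<lfloor>s\<rfloor>" r] by (simp add: frac_def)

lemma \<gamma>_frac: "\<gamma> (frac s) = \<gamma> s"
  using tube_frac[of s 0] by (simp add: tube_0)

text \<open>On the curve itself the partial derivatives are the orthogonal vectors
  \<open>\<gamma>'\<close> and \<open>nv\<close>; \<open>?g\<close> reads off the coefficients and
  is thus a left inverse of the derivative.\<close>

lemma tube_locally_injective:
  obtains d where "d > 0" "inj_on (\<lambda>z. tube (fst z) (snd z)) (ball (s, 0) d)"
proof -
  let ?g = "\<lambda>v. ((v \<bullet> \<gamma>' s) / (speed s)\<^sup>2, v \<bullet> nv s)"
  let ?f' = "\<lambda>z h. fst h *\<^sub>R tube_s (fst z) (snd z) + snd h *\<^sub>R tube_r (fst z) (snd z)"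
  show ?thesis
  proof (rule has_derivative_locally_injective[of "(s, 0)" UNIV ?g ?f' "\<lambda>z. tube (fst z) (snd z)"])
    show "bounded_linear ?g"
      by (intro bounded_linear_Pair bounded_linear_divide[THEN bounded_linear_compose] bounded_linear_inner_left)
    show "?g \<circ> ?f' (s, 0) = id"
    proof -
      have "(speed s)\<^sup>2 = \<gamma>' s \<bullet> \<gamma>' s" by (simp add: speed_def power2_norm_eq_inner)
      then show ?thesis
        using regular[of s] nv_facts[of s]
        by (simp add: fun_eq_iff tube_0 inner_add_left inner_commute[of "\<gamma>' s" "nv s"])
    qed
    fix e :: real assume "e > 0"
    have "continuous_on UNIV (\<lambda>z :: real \<times> real. tube_s (fst z) (snd z))" "continuous_on UNIV (\<lambda>z :: real \<times> real. tube_r (fst z) (snd z))"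
      by (intro continuous_intros)+
    then have "continuous (at (s, 0)) (\<lambda>z. tube_s (fst z) (snd z))" "continuous (at (s, 0)) (\<lambda>z. tube_r (fst z) (snd z))"
      by (simp_all add: continuous_on_eq_continuous_at)
    from has_derivative_partials_onorm[OF this \<open>e > 0\<close>]
    show "\<exists>d>0. \<forall>z. dist (s, 0) z < d \<longrightarrow> onorm (\<lambda>v. ?f' z v - ?f' (s, 0) v) < e" .
  qed (use has_derivative_tube that in auto)
qed

lemma tube_injective_radius:
  obtains r0 where "r0 > 0"
    "\<And>s r s' r'. 0 \<le> s \<Longrightarrow> s < 1 \<Longrightarrow> 0 \<le> s' \<Longrightarrow> s' < 1 \<Longrightarrow> \<bar>r\<bar> < r0 \<Longrightarrow> \<bar>r'\<bar> < r0 \<Longrightarrow>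
      tube s r = tube s' r' \<Longrightarrow> s = s' \<and> r = r'"
proof -
  define bad where "bad e z \<longleftrightarrow> (case z of ((s, s'), (r, r')) \<Rightarrow> 0 \<le> s \<and> s < 1 \<and> 0 \<le> s' \<and> s' < 1 \<and>
      \<bar>r\<bar> < e \<and> \<bar>r'\<bar> < e \<and> tube s r = tube s' r' \<and> (s \<noteq> s' \<or> r \<noteq> r'))"
    for e :: real and z :: "(real \<times> real) \<times> (real \<times> real)"
  \<comment> \<open>A limit point of counterexamples with \<open>e \<rightarrow> 0\<close> contradicts local injectivity.\<close>
  have "\<exists>e>0. \<forall>z. \<not> bad e z"
  proof (rule ccontr)
    assume "\<not> (\<exists>e>0. \<forall>z. \<not> bad e z)"
    then have "\<exists>z. bad (inverse (real (Suc n))) z" for n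
      by (metis inverse_positive_iff_positive of_nat_0_less_iff zero_less_Suc)
    then obtain X where X: "\<And>n. bad (inverse (real (Suc n))) (X n)" by metis
    have "compact (({0..1} \<times> {0..1}) \<times> ({-1..1} \<times> {-1..1}) :: ((real \<times> real) \<times> (real \<times> real)) set)"
      by (intro compact_Times compact_Icc)
    moreover have "X n \<in> ({0..1} \<times> {0..1}) \<times> ({-1..1} \<times> {-1..1})" for n
    proof -
      have "inverse (real (Suc n)) \<le> 1" by (simp add: divide_simps)
      then show ?thesis using X[of n] by (auto simp: bad_def split: prod.splits)
    qed
    ultimately obtain l \<rho> where l: "strict_mono \<rho>" "(X \<circ> \<rho>) \<longlonglongrightarrow> l"
      and lS: "l \<in> ({0..1} \<times> {0..1}) \<times> ({-1..1} \<times> {-1..1})"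
      unfolding compact_def by meson
    define s s' r r' where "s n = fst (fst (X (\<rho> n)))" and "s' n = snd (fst (X (\<rho> n)))"
      and "r n = fst (snd (X (\<rho> n)))" and "r' n = snd (snd (X (\<rho> n)))" for n
    define a a' where "a = fst (fst l)" and "a' = snd (fst l)"
    have sl: "s \<longlonglongrightarrow> a" "s' \<longlonglongrightarrow> a'"
      using l(2) unfolding s_def[abs_def] s'_def[abs_def] a_def a'_def o_def
      by (auto intro!: tendsto_intros)
    have b: "0 \<le> s n" "s n < 1" "0 \<le> s' n" "s' n < 1" "\<bar>r n\<bar> < inverse (real (Suc (\<rho> n)))"
        "\<bar>r' n\<bar> < inverse (real (Suc (\<rho> n)))" "tube (s n) (r n) = tube (s' n) (r' n)"
        "s n \<noteq> s' n \<or> r n \<noteq> r' n" for n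
      using X[of "\<rho> n"] by (auto simp: bad_def s_def s'_def r_def r'_def split: prod.splits)
    have inv0: "(\<lambda>n. inverse (real (Suc (\<rho> n)))) \<longlonglongrightarrow> 0"
      using LIMSEQ_subseq_LIMSEQ[OF LIMSEQ_inverse_real_of_nat l(1)] by (simp add: o_def)
    have rl: "r \<longlonglongrightarrow> 0" "r' \<longlonglongrightarrow> 0"
      by (rule Lim_null_comparison[OF _ inv0], use b in \<open>auto intro!: always_eventually less_imp_le\<close>)+
    have tc: "continuous_on UNIV (\<lambda>z :: real \<times> real. tube (fst z) (snd z))"
      by (intro continuous_intros)
    have tl: "(\<lambda>n. tube (s n) (r n)) \<longlonglongrightarrow> tube a 0" "(\<lambda>n. tube (s' n) (r' n)) \<longlonglongrightarrow> tube a' 0"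
      using continuous_on_tendsto_compose[OF tc tendsto_Pair[OF sl(1) rl(1)]]
        continuous_on_tendsto_compose[OF tc tendsto_Pair[OF sl(2) rl(2)]] by auto
    have "tube a 0 = tube a' 0"
      using tl unfolding b(7) by (rule LIMSEQ_unique)
    then have eq: "\<gamma> a = \<gamma> a'" by (simp add: tube_0)
    have aa: "0 \<le> a" "a \<le> 1" "0 \<le> a'" "a' \<le> 1"
      using lS by (auto simp: a_def a'_def mem_Times_iff)
    have "frac a = frac a'"
      using eq by (intro simple) (auto simp: \<gamma>_frac frac_lt_1)
    then have "a - a' = of_int (\<lfloor>a\<rfloor> - \<lfloor>a'\<rfloor>)" by (simp add: frac_def)
    \<comment> \<open>The limits may be the endpoints 0 and 1 of the parameter interval, which give
      the same point of the curve. Shifting one sequence by \<open>m\<close> brings both to the same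
      limit.\<close>
    then obtain m :: int where m: "a = a' + of_int m" by (metis add.commute diff_eq_eq)
    obtain d where d: "d > 0" and inj: "inj_on (\<lambda>z. tube (fst z) (snd z)) (ball (a, 0) d)"
      using tube_locally_injective .
    have "(\<lambda>n. (s n, r n)) \<longlonglongrightarrow> (a, 0)" "(\<lambda>n. (s' n + of_int m, r' n)) \<longlonglongrightarrow> (a, 0)"
      unfolding m using sl rl m by (auto intro!: tendsto_intros)
    then have "\<forall>\<^sub>F n in sequentially. (s n, r n) \<in> ball (a, 0) d \<and> (s' n + of_int m, r' n) \<in> ball (a, 0) d"
      using d by (intro eventually_conj topological_tendstoD) auto
    then obtain n where n: "(s n, r n) \<in> ball (a, 0) d" "(s' n + of_int m, r' n) \<in> ball (a, 0) d"
      by (auto simp: eventually_sequentially)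
    have "(s n, r n) = (s' n + of_int m, r' n)"
      by (rule inj_onD[OF inj _ n]) (use b(7)[of n] in \<open>simp add: tube_periodic_int\<close>)
    then have e: "s n = s' n + of_int m" "r n = r' n" by auto
    then have "\<bar>real_of_int m\<bar> < 1" using b(1-4)[of n] by auto
    then have "m = 0" by linarith
    then show False using e b(8)[of n] by simp
  qed
  then obtain e where e: "e > 0" "\<And>z. \<not> bad e z" by blast
  show thesis
  proof (rule that[OF e(1)])
    fix s r s' r' assume "0 \<le> s" "s < 1" "0 \<le> s'" "s' < 1" "\<bar>r\<bar> < e" "\<bar>r'\<bar> < e" "tube s r = tube s' r'"
    then show "s = s' \<and> r = r'"
      using e(2)[of "((s, s'), (r, r'))"] by (simp add: bad_def)
  qed
qed

lemma jacobian_positive_radius: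
  obtains r0 where "r0 > 0" "r0 \<le> 1" "\<And>s r. 0 \<le> s \<Longrightarrow> s \<le> 1 \<Longrightarrow> \<bar>r\<bar> < r0 \<Longrightarrow> 0 < cos r - curv s * sin r"
proof -
  have "continuous_on {0..1} curv"
    by (rule cont_nv(3)[OF continuous_on_id])
  from compact_imp_bounded[OF compact_continuous_image[OF this compact_Icc]]
  obtain K where K: "K > 0" "\<And>s. 0 \<le> s \<Longrightarrow> s \<le> 1 \<Longrightarrow> \<bar>curv s\<bar> \<le> K"
    by (auto simp: bounded_pos)
  \<comment> \<open>This makes the curvature term less than 1/2, while
    \<open>\<bar>r\<bar> < 1 < pi / 3\<close> keeps the cosine at least 1/2.\<close>
  let ?r0 = "1 / (2 * (K + 1))"
  have r0: "?r0 > 0" "?r0 \<le> 1" "K * ?r0 < 1 / 2"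
    using K(1) by (auto simp: divide_simps)
  have "0 < cos r - curv s * sin r" if s: "0 \<le> s" "s \<le> 1" and r: "\<bar>r\<bar> < ?r0" for s r
  proof -
    have "\<bar>curv s * sin r\<bar> \<le> K * ?r0"
      unfolding abs_mult using K(2)[OF s] K(1) r abs_sin_x_le_abs_x[of r] by (intro mult_mono) auto
    moreover have "cos (pi / 3) \<le> cos \<bar>r\<bar>"
    proof -
      have "\<bar>r\<bar> < 1" using r r0(2) by linarith
      then show ?thesis using pi_gt3 by (intro cos_monotone_0_pi_le) auto
    qed
    then have "1 / 2 \<le> cos r" by (simp add: cos_60)
    ultimately show ?thesis using r0(3) abs_ge_self[of "curv s * sin r"] by linarith
  qed
  then show ?thesis using that r0 by blast
qed

end

locale sphere_tube = sphere_curve +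
  fixes r0 :: real
  assumes r0: "0 < r0" "r0 \<le> 1"
    and tube_inj: "0 \<le> s \<Longrightarrow> s < 1 \<Longrightarrow> 0 \<le> s' \<Longrightarrow> s' < 1 \<Longrightarrow> \<bar>r\<bar> < r0 \<Longrightarrow> \<bar>r'\<bar> < r0 \<Longrightarrow>
      tube s r = tube s' r' \<Longrightarrow> s = s' \<and> r = r'"
    and jac_pos: "0 \<le> s \<Longrightarrow> s \<le> 1 \<Longrightarrow> \<bar>r\<bar> < r0 \<Longrightarrow> 0 < cos r - curv s * sin r"

lemma (in sphere_curve) ex_sphere_tube: "\<exists>r0. sphere_tube \<gamma> \<gamma>' \<gamma>'' \<sigma> r0"
proof -
  obtain ra where ra: "ra > 0" "\<And>s r s' r'. 0 \<le> s \<Longrightarrow> s < 1 \<Longrightarrow> 0 \<le> s' \<Longrightarrow> s' < 1 \<Longrightarrow> \<bar>r\<bar> < ra \<Longrightarrow> \<bar>r'\<bar> < ra \<Longrightarrow>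
      tube s r = tube s' r' \<Longrightarrow> s = s' \<and> r = r'"
    using tube_injective_radius by blast
  obtain rb where rb: "rb > 0" "rb \<le> 1" "\<And>s r. 0 \<le> s \<Longrightarrow> s \<le> 1 \<Longrightarrow> \<bar>r\<bar> < rb \<Longrightarrow> 0 < cos r - curv s * sin r"
    using jacobian_positive_radius by blast
  have "sphere_tube_axioms \<gamma> \<gamma>' \<gamma>'' \<sigma> (min ra rb)"
  proof
    show "0 < min ra rb" "min ra rb \<le> 1" using ra(1) rb(1,2) by auto
    show "s = s' \<and> r = r'"
      if "0 \<le> s" "s < 1" "0 \<le> s'" "s' < 1" "\<bar>r\<bar> < min ra rb" "\<bar>r'\<bar> < min ra rb" "tube s r = tube s' r'" for s s' r r'
      by (rule ra(2)[of s s' r r']) (use that in simp_all)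
    show "0 < cos r - curv s * sin r" if "0 \<le> s" "s \<le> 1" "\<bar>r\<bar> < min ra rb" for s r
      by (rule rb(3)) (use that in simp_all)
  qed
  then show ?thesis
    using sphere_curve_axioms by (auto simp: sphere_tube_def)
qed

text \<open>Components are relatively open since the sphere is locally connected, and relatively
  closed in the complement of \<open>C\<close>, so new points of the closure lie on
  \<open>C\<close>.\<close>

lemma component_of_sphere_complement:
  assumes c: "c \<in> components (unit_sphere - C)" and C: "closed C" "C \<subseteq> unit_sphere"
  shows "openin (top_of_set unit_sphere) c" "closure c \<subseteq> c \<union> C" "c \<subseteq> unit_sphere - C" "c \<noteq> {}" "connected c"
proof -
  have o: "openin (top_of_set unit_sphere) (unit_sphere - C)"
    using C by (simp add: closed_subset openin_diff)
  have "locally connected (unit_sphere - C)"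
    by (rule locally_open_subset[OF locally_connected_sphere o])
  from openin_components_locally_connected[OF this c]
  show "openin (top_of_set unit_sphere) c"
    using o by (rule openin_trans)
  show sub: "c \<subseteq> unit_sphere - C" "c \<noteq> {}" "connected c"
    using c by (auto simp: in_components_subset in_components_nonempty in_components_connected)
  have "closedin (top_of_set (unit_sphere - C)) c"
    by (rule closedin_component[OF c])
  then obtain T where T: "closed T" "c = (unit_sphere - C) \<inter> T"
    by (auto simp: closedin_closed)
  have "closure c \<subseteq> T" "closure c \<subseteq> unit_sphere"
    using T sub(1) by (intro closure_minimal; force)+
  then show "closure c \<subseteq> c \<union> C" using T by blast
qed

section \<open>Nearest points on the curve and its two sides\<close>

context sphere_curve
begin

lemma range_\<gamma>: "range \<gamma> = \<gamma> ` {0..1}" "range \<gamma> = \<gamma> ` {0..<1}"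
proof -
  have "\<gamma> s \<in> \<gamma> ` {0..<1}" for s
    using \<gamma>_frac[of s] frac_ge_0[of s] frac_lt_1[of s] by (metis atLeastLessThan_iff imageI)
  then show "range \<gamma> = \<gamma> ` {0..1}" "range \<gamma> = \<gamma> ` {0..<1}" by force+
qed

lemma compact_range_\<gamma>: "compact (range \<gamma>)"
  unfolding range_\<gamma>(1) by (intro compact_continuous_image cont0 compact_Icc)

lemma range_\<gamma>_sphere: "range \<gamma> \<subseteq> unit_sphere"
  using on_sphere by auto

lemma dist_unit: "(dist x y)\<^sup>2 = 2 - 2 * (x \<bullet> y)" if "norm x = 1" "norm y = 1" for x y :: "real^3"
  using that unfolding norm_eq_1 dist_norm power2_norm_eq_inner
  by (simp add: inner_diff_left inner_diff_right inner_commute[of y x])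

lemma dist_tube_\<gamma>: "\<bar>r\<bar> \<le> pi \<Longrightarrow> dist (tube s r) (\<gamma> s) = 2 * sin (\<bar>r\<bar> / 2)"
proof -
  assume r: "\<bar>r\<bar> \<le> pi"
  have "(dist (tube s r) (\<gamma> s))\<^sup>2 = 2 - 2 * cos \<bar>r\<bar>"
    by (simp add: dist_unit norm_tube on_sphere) (simp add: tube_def inner_add_left \<gamma>_inner nv_facts)
  also have "cos \<bar>r\<bar> = 1 - 2 * (sin (\<bar>r\<bar> / 2))\<^sup>2"
    using cos_double_sin[of "\<bar>r\<bar> / 2"] by simp
  finally have "(dist (tube s r) (\<gamma> s))\<^sup>2 = (2 * sin (\<bar>r\<bar> / 2))\<^sup>2"
    by (simp add: power_mult_distrib)
  moreover have "0 \<le> sin (\<bar>r\<bar> / 2)" using r by (intro sin_ge_zero) auto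
  ultimately show ?thesis by (subst (asm) power2_eq_iff_nonneg) auto
qed

text \<open>A nearest point \<open>\<gamma> s\<close> maximizes
  \<open>x \<bullet> \<gamma> s\<close>, so \<open>x\<close> is orthogonal to
  \<open>\<gamma>' s\<close> there and lies in the plane of \<open>\<gamma> s\<close> and
  \<open>nv s\<close>; the angle in this plane is \<open>r\<close>.\<close>

lemma nearest_point_tube:
  assumes x: "norm x = 1"
  obtains s r where "0 \<le> s" "s < 1" "\<bar>r\<bar> \<le> pi" "x = tube s r" "infdist x (range \<gamma>) = 2 * sin (\<bar>r\<bar> / 2)"
proof -
  have "closed (range \<gamma>)" using compact_range_\<gamma> compact_imp_closed by blast
  then obtain y where "y \<in> range \<gamma>" "infdist x (range \<gamma>) = dist x y"
    using infdist_attains_inf[of "range \<gamma>" x] by auto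
  then obtain s where s: "0 \<le> s" "s < 1" "infdist x (range \<gamma>) = dist x (\<gamma> s)"
    unfolding range_\<gamma>(2) by auto
  have max: "x \<bullet> \<gamma> s' \<le> x \<bullet> \<gamma> s" for s'
  proof -
    have "dist x (\<gamma> s) \<le> dist x (\<gamma> s')"
      unfolding s(3)[symmetric] by (intro infdist_le) auto
    then have "(dist x (\<gamma> s))\<^sup>2 \<le> (dist x (\<gamma> s'))\<^sup>2" by (intro power_mono) auto
    then show ?thesis by (simp add: dist_unit x on_sphere)
  qed
  have "((\<lambda>s. x \<bullet> \<gamma> s) has_derivative (\<lambda>h. x \<bullet> (h *\<^sub>R \<gamma>' s))) (at s)"
    by (rule has_derivative_inner_right[OF deriv1[unfolded has_vector_derivative_def]])
  then have "((\<lambda>s. x \<bullet> \<gamma> s) has_real_derivative x \<bullet> \<gamma>' s) (at s)"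
    by (simp add: has_field_derivative_def mult_commute_abs)
  from DERIV_local_max[OF this zero_less_one] max have 0: "x \<bullet> \<gamma>' s = 0" by auto
  define c d where "c = x \<bullet> \<gamma> s" and "d = x \<bullet> nv s"
  define v where "v = x - c *\<^sub>R \<gamma> s - d *\<^sub>R nv s"
  have v: "v \<bullet> \<gamma> s = 0" "v \<bullet> nv s = 0" "v \<bullet> \<gamma>' s = 0"
    by (simp_all add: v_def c_def d_def inner_diff_left \<gamma>_inner nv_facts 0 \<gamma>_\<gamma>' inner_commute[of "\<gamma> s" "nv s"])
  have "v \<bullet> cross3 (\<gamma> s) (\<gamma>' s) = 0" using v by (simp add: cross_\<gamma>_\<gamma>')
  from vector_parallel_if_orthogonal[OF v(1) this \<gamma>_\<gamma>' \<gamma>_inner] have "v = 0"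
    using v(3) regular by simp
  then have xe: "x = c *\<^sub>R \<gamma> s + d *\<^sub>R nv s" by (simp add: v_def algebra_simps)
  have "x \<bullet> x = c\<^sup>2 + d\<^sup>2"
    unfolding xe by (simp add: inner_add_left inner_add_right \<gamma>_inner nv_facts inner_commute[of "\<gamma> s" "nv s"] power2_eq_square)
  then have cd: "c\<^sup>2 + d\<^sup>2 = 1" using x by (simp add: norm_eq_1)
  obtain r where r: "\<bar>r\<bar> \<le> pi" "c = cos r" "d = sin r"
  proof (cases "d \<ge> 0")
    case True
    then show ?thesis using sincos_total_pi[OF True cd] that by force
  next
    case False
    then obtain t where "0 \<le> t" "t \<le> pi" "c = cos t" "- d = sin t"
      using sincos_total_pi[of "- d" c] cd by auto
    then show ?thesis using that[of "- t"] by auto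
  qed
  then have "x = tube s r" using xe by (simp add: tube_def)
  with that s r dist_tube_\<gamma> show ?thesis by auto
qed

end

context sphere_tube
begin

lemma r0_pi: "r0 < pi"
  using r0 pi_gt3 by linarith

text \<open>The representation through a nearest point has normal coordinate of size at most
  \<open>\<bar>r\<bar> < r0\<close>, so injectivity identifies it with the given one.\<close>

lemma infdist_tube:
  assumes r: "\<bar>r\<bar> < r0"
  shows "infdist (tube s r) (range \<gamma>) = 2 * sin (\<bar>r\<bar> / 2)"
proof -
  obtain s1 r1 where 1: "0 \<le> s1" "s1 < 1" "\<bar>r1\<bar> \<le> pi" "tube s r = tube s1 r1"
      "infdist (tube s r) (range \<gamma>) = 2 * sin (\<bar>r1\<bar> / 2)"
    using nearest_point_tube[OF norm_tube] by blast
  have "infdist (tube s r) (range \<gamma>) \<le> dist (tube s r) (\<gamma> s)" by (intro infdist_le) auto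
  then have "sin (\<bar>r1\<bar> / 2) \<le> sin (\<bar>r\<bar> / 2)"
    using 1 dist_tube_\<gamma>[of r s] r r0_pi by auto
  then have "\<bar>r1\<bar> \<le> \<bar>r\<bar>"
    using 1 r r0_pi by (subst (asm) sin_mono_le_eq) auto
  moreover have "tube (frac s) r = tube s1 r1" using 1 by (simp add: tube_frac)
  ultimately have "r = r1"
    using tube_inj[of "frac s" s1 r r1] 1 r by (auto simp: frac_lt_1)
  then show ?thesis using 1 by simp
qed

lemma near_curve_in_tube:
  assumes x: "norm x = 1" and d: "infdist x (range \<gamma>) < 2 * sin (\<rho> / 2)" and \<rho>: "0 \<le> \<rho>" "\<rho> \<le> r0"
  obtains s r where "0 \<le> s" "s < 1" "\<bar>r\<bar> < \<rho>" "x = tube s r"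
proof -
  obtain s r where 1: "0 \<le> s" "s < 1" "\<bar>r\<bar> \<le> pi" "x = tube s r" "infdist x (range \<gamma>) = 2 * sin (\<bar>r\<bar> / 2)"
    using nearest_point_tube[OF x] by blast
  then have "sin (\<bar>r\<bar> / 2) < sin (\<rho> / 2)" using d by simp
  then have "\<bar>r\<bar> < \<rho>"
    using 1 \<rho> r0_pi by (subst (asm) sin_mono_less_eq) auto
  then show ?thesis using that 1 by blast
qed

lemma tube_notin_curve: "\<bar>r\<bar> < r0 \<Longrightarrow> r \<noteq> 0 \<Longrightarrow> tube s r \<notin> range \<gamma>"
proof
  assume r: "\<bar>r\<bar> < r0" "r \<noteq> 0" and "tube s r \<in> range \<gamma>"
  then have "infdist (tube s r) (range \<gamma>) = 0" by (rule_tac infdist_zero)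
  moreover have "sin (\<bar>r\<bar> / 2) > 0" using r r0_pi by (intro sin_gt_zero) auto
  ultimately show False using infdist_tube[OF r(1), of s] by simp
qed

lemma connected_tube_strip:
  assumes "connected I"
  shows "connected ((\<lambda>z. tube (fst z) (snd z)) ` (UNIV \<times> I))"
  by (intro connected_continuous_image connected_Times assms) (auto intro!: continuous_intros)

text \<open>A strip on one side is connected, avoids the curve and meets \<open>c\<close>, so
  maximality of components puts it inside \<open>c\<close>.\<close>

lemma strip_in_component:
  assumes c: "c \<in> components (unit_sphere - range \<gamma>)"
    and I: "connected I" "I \<subseteq> {-r0<..<r0}" "0 \<notin> I" and r: "r \<in> I" "tube s r \<in> c"
    and r': "r' \<in> I"
  shows "tube s' r' \<in> c"
proof -
  let ?T = "(\<lambda>z. tube (fst z) (snd z)) ` (UNIV \<times> I)"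
  have "?T \<subseteq> unit_sphere - range \<gamma>"
  proof (intro image_subsetI)
    fix z :: "real \<times> real" assume "z \<in> UNIV \<times> I"
    then have "\<bar>snd z\<bar> < r0" "snd z \<noteq> 0" using I by (auto simp: abs_less_iff)
    then show "tube (fst z) (snd z) \<in> unit_sphere - range \<gamma>"
      using tube_notin_curve by (auto simp: norm_tube)
  qed
  moreover have "c \<inter> ?T \<noteq> {}" using r by force
  ultimately have "?T \<subseteq> c"
    by (intro components_maximal[OF c connected_tube_strip[OF I(1)]])
  then show ?thesis using r' by force
qed

text \<open>If both sides were in \<open>S2\<close>, then \<open>S1\<close> would stay away from the curve and so be closed and open.\<close>

lemma tube_sides:
  assumes comp: "components (unit_sphere - range \<gamma>) = {S1, S2}" and ne: "S1 \<noteq> S2"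
    and r1: "0 < r1" "r1 < r0" "tube s1 r1 \<in> S2"
  shows "0 < r \<Longrightarrow> r < r0 \<Longrightarrow> tube s r \<in> S2" and "- r0 < r \<Longrightarrow> r < 0 \<Longrightarrow> tube s r \<notin> S2"
proof -
  have c: "S1 \<in> components (unit_sphere - range \<gamma>)" "S2 \<in> components (unit_sphere - range \<gamma>)"
    using comp by auto
  have disj: "S1 \<inter> S2 = {}"
    using c ne components_nonoverlap by blast
  have clC: "closed (range \<gamma>)" using compact_range_\<gamma> compact_imp_closed by blast
  note S1 = component_of_sphere_complement[OF c(1) clC range_\<gamma>_sphere]
  have pos: "tube s r \<in> S2" if "0 < r" "r < r0" for s r
    by (rule strip_in_component[OF c(2), of "{0<..<r0}" r1 s1]) (use that r1 in auto)
  then show "0 < r \<Longrightarrow> r < r0 \<Longrightarrow> tube s r \<in> S2" .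
  show "tube s r \<notin> S2" if r: "- r0 < r" "r < 0" for r s
  proof
    assume in2: "tube s r \<in> S2"
    have neg: "tube s' r' \<in> S2" if "- r0 < r'" "r' < 0" for s' r'
      by (rule strip_in_component[OF c(2), of "{-r0<..<0}" r s]) (use that r in2 in auto)
    have "closure S1 \<inter> range \<gamma> = {}"
    proof (rule ccontr)
      assume "closure S1 \<inter> range \<gamma> \<noteq> {}"
      then obtain x where x: "x \<in> closure S1" "x \<in> range \<gamma>" by blast
      have "0 < 2 * sin (r0 / 2)" using r0 r0_pi by (auto intro!: sin_gt_zero)
      then obtain y where y: "y \<in> S1" "dist y x < 2 * sin (r0 / 2)"
        using x(1) by (auto simp: closure_approachable)
      have y': "norm y = 1" "y \<notin> range \<gamma>" using S1(3) y(1) by auto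
      have "infdist y (range \<gamma>) < 2 * sin (r0 / 2)"
        using infdist_le[OF x(2), of y] y(2) by linarith
      from near_curve_in_tube[OF y'(1) this] r0
      obtain s' r' where s': "\<bar>r'\<bar> < r0" "y = tube s' r'" by (metis less_imp_le order_refl)
      have "r' \<noteq> 0" using y'(2) s' by (auto simp: tube_0)
      then have "y \<in> S2" using pos[of r' s'] neg[of r' s'] s' by (cases "r' > 0") auto
      then show False using y disj by blast
    qed
    then have "closure S1 = S1" using S1(2) closure_subset by blast
    then have "closed S1" by (metis closed_closure)
    then have "closedin (top_of_set unit_sphere) S1" using S1(3) by (intro closed_subset) auto
    then have "S1 = unit_sphere"
      using S1(1,4) connected_sphere[of "0 :: real^3" 1] by (auto simp: connected_clopen)
    then show False using S1(3) on_sphere[of 0] by auto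
  qed
qed

end

section \<open>Cutoffs and the divergence in tubular coordinates\<close>

text \<open>Supplies the differentiability of Stone-Weierstrass approximants, from which cutoffs are
  built.\<close>

lemma real_polynomial_function_C1:
  fixes p :: "'a::euclidean_space \<Rightarrow> real"
  assumes "real_polynomial_function p"
  shows "\<exists>G. (\<forall>x. (p has_derivative (\<lambda>h. G x \<bullet> h)) (at x)) \<and> continuous_on UNIV G"
  using assms
proof induction
  case (linear f)
  have "f h = adjoint f 1 \<bullet> h" for h
    using adjoint_works[of f h 1] bounded_linear.linear[OF linear] by (simp add: inner_commute)
  then obtain v where v: "f = (\<lambda>h. v \<bullet> h)" by auto
  show ?case
    unfolding v by (intro exI[of _ "\<lambda>_. v"]) (auto intro!: derivative_eq_intros)
next
  case (const c)
  show ?case by (intro exI[of _ "\<lambda>_. 0"]) auto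
next
  case (add f g)
  then obtain F G where "\<And>x. (f has_derivative (\<lambda>h. F x \<bullet> h)) (at x)" "continuous_on UNIV F"
    "\<And>x. (g has_derivative (\<lambda>h. G x \<bullet> h)) (at x)" "continuous_on UNIV G" by blast
  then show ?case
    by (intro exI[of _ "\<lambda>x. F x + G x"]) (auto simp: inner_add_left intro!: has_derivative_add continuous_on_add)
next
  case (mult f g)
  then obtain F G where F: "\<And>x. (f has_derivative (\<lambda>h. F x \<bullet> h)) (at x)" "continuous_on UNIV F"
    and G: "\<And>x. (g has_derivative (\<lambda>h. G x \<bullet> h)) (at x)" "continuous_on UNIV G" by blast
  have c: "continuous_on UNIV f" "continuous_on UNIV g"
    by (auto intro!: continuous_at_imp_continuous_on has_derivative_continuous[OF F(1)] has_derivative_continuous[OF G(1)])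
  have "((\<lambda>x. f x * g x) has_derivative (\<lambda>h. (f x *\<^sub>R G x + g x *\<^sub>R F x) \<bullet> h)) (at x)" for x
    using has_derivative_mult[OF F(1)[of x] G(1)[of x]] by (simp add: inner_add_left mult.commute)
  then show ?case
    using c F(2) G(2) by (intro exI[of _ "\<lambda>x. f x *\<^sub>R G x + g x *\<^sub>R F x"]) (auto intro!: continuous_intros)
qed

text \<open>The distance function is only Lipschitz. A truncated affine function of it is
  approximated by a polynomial with error below 1/4, and a profile that is constant below 1/4 and
  above 3/4 restores the exact values 0 and 1.\<close>

lemma sphere_cutoff:
  fixes A :: "(real^3) set"
  assumes d: "d1 < d2"
  obtains \<psi> G where "\<And>x. x \<in> unit_sphere \<Longrightarrow> has_surface_gradient \<psi> (G x) x" "continuous_on unit_sphere G"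
    "\<And>x. x \<in> unit_sphere \<Longrightarrow> infdist x A \<le> d1 \<Longrightarrow> \<psi> x = 1"
    "\<And>x. x \<in> unit_sphere \<Longrightarrow> infdist x A \<ge> d2 \<Longrightarrow> \<psi> x = 0"
    "\<And>x. x \<in> unit_sphere \<Longrightarrow> infdist x A < d1 \<or> infdist x A > d2 \<Longrightarrow> G x = 0"
proof -
  define g where "g x = max 0 (min 1 ((d2 - infdist x A) / (d2 - d1)))" for x
  have "continuous_on unit_sphere g"
    unfolding g_def using d by (intro continuous_intros) auto
  from Stone_Weierstrass_real_polynomial_function[OF compact_sphere this, of "1/4"]
  obtain p where p: "real_polynomial_function p" "\<And>x. x \<in> unit_sphere \<Longrightarrow> \<bar>g x - p x\<bar> < 1 / 4"
    by auto
  obtain D where D: "\<And>x. (p has_derivative (\<lambda>h. D x \<bullet> h)) (at x)" "continuous_on UNIV D"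
    using real_polynomial_function_C1[OF p(1)] by blast
  \<comment> \<open>For \<open>t \<le> 1/4\<close> the inner ramp is 0 and \<open>q t = 0\<close>;
    for \<open>t \<ge> 3/4\<close> it is at least 1 and \<open>q t = 1\<close>.\<close>
  define q where "q t = 1 - ramp (1 - ramp (2 * t - 1 / 2))" for t
  define q' where "q' t = 2 * max 0 (1 - ramp (2 * t - 1 / 2)) * (2 * max 0 (2 * t - 1 / 2) * 2)" for t
  have qd: "(q has_real_derivative q' t) (at t)" for t
  proof -
    have 1: "((\<lambda>t. ramp (2 * t - 1 / 2)) has_real_derivative 2 * max 0 (2 * t - 1 / 2) * 2) (at t)"
      by (rule DERIV_chain'[OF _ ramp_deriv]) (auto intro!: derivative_eq_intros)
    have 2: "((\<lambda>t. 1 - ramp (2 * t - 1 / 2)) has_real_derivative 0 - 2 * max 0 (2 * t - 1 / 2) * 2) (at t)"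
      by (rule DERIV_diff[OF DERIV_const 1])
    have "((\<lambda>t. 1 - ramp (1 - ramp (2 * t - 1 / 2))) has_real_derivative
        0 - 2 * max 0 (1 - ramp (2 * t - 1 / 2)) * (0 - 2 * max 0 (2 * t - 1 / 2) * 2)) (at t)"
      by (rule DERIV_diff[OF DERIV_const DERIV_chain'[OF 2 ramp_deriv]])
    then show ?thesis by (simp add: q_def[abs_def] q'_def)
  qed
  define \<psi> where "\<psi> x = q (p x)" for x
  define G where "G x = q' (p x) *\<^sub>R (D x - (D x \<bullet> x) *\<^sub>R x)" for x
  have 1: "has_surface_gradient \<psi> (G x) x" if "x \<in> unit_sphere" for x
    unfolding \<psi>_def[abs_def] G_def using that
    by (intro has_surface_gradient_compose[OF has_surface_gradient_ambient[OF _ D(1)] qd]) auto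
  have pc: "continuous_on unit_sphere p"
    by (auto intro!: continuous_at_imp_continuous_on has_derivative_continuous[OF D(1)])
  then have 2: "continuous_on unit_sphere G"
    unfolding G_def q'_def
    by (intro continuous_intros continuous_on_subset[OF D(2) subset_UNIV] pc)
  have 3: "\<psi> x = 1" if "x \<in> unit_sphere" "infdist x A \<le> d1" for x
  proof -
    have "g x = 1" using that d by (simp add: g_def divide_simps)
    then have "2 * p x - 1 / 2 \<ge> 1" using p(2)[OF that(1)] by (simp add: abs_if split: if_splits)
    then have "ramp (2 * p x - 1 / 2) \<ge> 1" by (simp add: ramp_def one_le_power)
    then show ?thesis by (simp add: \<psi>_def q_def ramp_def)
  qed
  have 4: "\<psi> x = 0" if "x \<in> unit_sphere" "infdist x A \<ge> d2" for x
  proof -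
    have "g x = 0" using that d by (simp add: g_def divide_simps)
    then have "2 * p x - 1 / 2 \<le> 0" using p(2)[OF that(1)] by (simp add: abs_if split: if_splits)
    then show ?thesis by (simp add: \<psi>_def q_def ramp_def)
  qed
  \<comment> \<open>The strict inequalities describe relatively open sets on which
    \<open>\<psi>\<close> is constant, so uniqueness of the gradient applies.\<close>
  have 5: "G x = 0" if x: "x \<in> unit_sphere" "infdist x A < d1 \<or> infdist x A > d2" for x
  proof -
    have o: "openin (top_of_set unit_sphere) (unit_sphere \<inter> {y. infdist y A < d1})"
      "openin (top_of_set unit_sphere) (unit_sphere \<inter> {y. infdist y A > d2})"
      by (intro openin_open_Int open_Collect_less continuous_intros)+
    have "has_surface_gradient (\<lambda>_. 0) (G x) x \<or> has_surface_gradient (\<lambda>_. 1) (G x) x"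
    proof (cases "infdist x A < d1")
      case True
      have "has_surface_gradient (\<lambda>_. 1) (G x) x"
        by (rule has_surface_gradient_cong_ev[OF 1[OF x(1)] x(1) o(1)]) (use x True 3 in auto)
      then show ?thesis ..
    next
      case False
      have "has_surface_gradient (\<lambda>_. 0) (G x) x"
        by (rule has_surface_gradient_cong_ev[OF 1[OF x(1)] x(1) o(2)]) (use x False 4 in auto)
      then show ?thesis ..
    qed
    then show ?thesis
      using has_surface_gradient_unique[OF _ has_surface_gradient_const x(1)] by blast
  qed
  from 1 2 3 4 5 show ?thesis by (rule that)
qed

text \<open>The derivative of the determinant: applying a matrix with rows \<open>D i\<close> to one
  column at a time and adding up multiplies the determinant by the trace.\<close>

lemma trace_det_identity:
  fixes D :: "3 \<Rightarrow> real^3" and a b c :: "real^3"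
  shows "(\<chi> i. D i \<bullet> a) \<bullet> cross3 b c + a \<bullet> cross3 (\<chi> i. D i \<bullet> b) c + a \<bullet> cross3 b (\<chi> i. D i \<bullet> c)
    = (\<Sum>i\<in>UNIV. D i $ i) * (a \<bullet> cross3 b c)"
  by (simp add: cross3_def inner_vec_def sum_3 algebra_simps)

text \<open>Since the matrix annihilates \<open>x\<close>, the column \<open>x\<close> contributes
  nothing and the trace is one over the tangent plane.\<close>

lemma tangential_trace:
  fixes D :: "3 \<Rightarrow> real^3" and a b x :: "real^3"
  assumes "\<And>i. D i \<bullet> x = 0"
  shows "cross3 x (\<chi> i. D i \<bullet> a) \<bullet> b - cross3 x (\<chi> i. D i \<bullet> b) \<bullet> a = (\<Sum>i\<in>UNIV. D i $ i) * (x \<bullet> cross3 a b)"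
proof -
  have z: "(\<chi> i. D i \<bullet> x) = 0" using assms by (simp add: vec_eq_iff)
  have "cross3 x (\<chi> i. D i \<bullet> a) \<bullet> b = x \<bullet> cross3 (\<chi> i. D i \<bullet> a) b"
    "cross3 x (\<chi> i. D i \<bullet> b) \<bullet> a = - (x \<bullet> cross3 a (\<chi> i. D i \<bullet> b))"
    by (simp_all add: cross3_def inner_vec_def sum_3 algebra_simps)
  then show ?thesis
    using trace_det_identity[of D x a b] by (simp add: z)
qed

lemma cross_tangent_parallel:
  fixes a b x :: "real^3"
  assumes "a \<bullet> x = 0" "b \<bullet> x = 0" "norm x = 1"
  shows "cross3 a b = (x \<bullet> cross3 a b) *\<^sub>R x"
proof -
  have "cross3 x (cross3 a b) = 0"
    using assms by (simp add: Lagrange inner_commute)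
  then have "cross3 x (cross3 x (cross3 a b)) = 0" by simp
  then show ?thesis using assms by (simp add: Lagrange[of x x] norm_eq_1 )
qed

lemma has_vector_derivative_cross3:
  assumes "(f has_vector_derivative f') (at t)" "(g has_vector_derivative g') (at t)"
  shows "((\<lambda>t. cross3 (f t) (g t)) has_vector_derivative cross3 (f t) g' + cross3 f' (g t)) (at t)"
  by (rule bounded_bilinear.has_vector_derivative[OF bounded_bilinear_cross3 assms])

lemma has_real_derivative_inner:
  fixes f g :: "real \<Rightarrow> 'a::real_inner"
  assumes "(f has_vector_derivative f') (at t)" "(g has_vector_derivative g') (at t)"
  shows "((\<lambda>t. f t \<bullet> g t) has_real_derivative f t \<bullet> g' + f' \<bullet> g t) (at t)"
  unfolding has_real_derivative_iff_has_vector_derivative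
  by (rule bounded_bilinear.has_vector_derivative[OF bounded_bilinear_inner assms])

text \<open>Green's theorem on a rectangle that closes up in \<open>s\<close>. Each derivative is
  integrated first in its own variable: periodicity kills the contribution of \<open>A\<close>, and
  only the edge \<open>r = a\<close> remains of \<open>B\<close>.\<close>

lemma integral_iterated_derivative:
  fixes A B As Br :: "real \<Rightarrow> real \<Rightarrow> real"
  assumes A: "\<And>s r. 0 \<le> s \<Longrightarrow> s \<le> 1 \<Longrightarrow> a \<le> r \<Longrightarrow> r \<le> b \<Longrightarrow> ((\<lambda>s. A s r) has_real_derivative As s r) (at s)"
    and B: "\<And>s r. 0 \<le> s \<Longrightarrow> s \<le> 1 \<Longrightarrow> a \<le> r \<Longrightarrow> r \<le> b \<Longrightarrow> ((\<lambda>r. B s r) has_real_derivative Br s r) (at r)"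
    and As: "continuous_on ({0..1} \<times> {a..b}) (\<lambda>z. As (fst z) (snd z))"
    and Br: "continuous_on ({0..1} \<times> {a..b}) (\<lambda>z. Br (fst z) (snd z))"
    and per: "\<And>r. A 1 r = A 0 r" and zero: "\<And>s. B s b = 0" and ab: "a \<le> b"
  shows "integral ({0..1} \<times> {a..b}) (\<lambda>z. As (fst z) (snd z) - Br (fst z) (snd z)) = integral {0..1} (\<lambda>s. B s a)"
proof -
  have Q: "{0..1} \<times> {a..b} = cbox (0 :: real, a) (1, b)"
    by (auto simp: cbox_Pair_eq)
  note As' = As[unfolded Q] and Br' = Br[unfolded Q]
  have "integral (cbox (0, a) (1, b)) (\<lambda>z. As (fst z) (snd z)) = integral {0..1} (\<lambda>s. integral {a..b} (\<lambda>r. As s r))"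
    using integral_prod_continuous[OF As'] by simp
  also have "\<dots> = integral {a..b} (\<lambda>r. integral {0..1} (\<lambda>s. As s r))"
    using integral_swap_continuous[of 0 a 1 b As] As' by (simp add: case_prod_beta')
  also have "\<dots> = integral {a..b} (\<lambda>r. 0)"
  proof (rule integral_cong)
    fix r assume r: "r \<in> {a..b}"
    have "((\<lambda>s. As s r) has_integral A 1 r - A 0 r) {0..1}"
      by (rule fundamental_theorem_of_calculus)
         (use A r in \<open>auto simp flip: has_real_derivative_iff_has_vector_derivative intro: has_field_derivative_at_within\<close>)
    then show "integral {0..1} (\<lambda>s. As s r) = 0" using per by (simp add: integral_unique)
  qed
  finally have 1: "integral (cbox (0, a) (1, b)) (\<lambda>z. As (fst z) (snd z)) = 0" by simp
  have "integral (cbox (0, a) (1, b)) (\<lambda>z. Br (fst z) (snd z)) = integral {0..1} (\<lambda>s. integral {a..b} (\<lambda>r. Br s r))"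
    using integral_prod_continuous[OF Br'] by simp
  also have "\<dots> = integral {0..1} (\<lambda>s. - B s a)"
  proof (rule integral_cong)
    fix s :: real assume s: "s \<in> {0..1}"
    have "((\<lambda>r. Br s r) has_integral B s b - B s a) {a..b}"
      by (rule fundamental_theorem_of_calculus[OF ab])
         (use B s in \<open>auto simp flip: has_real_derivative_iff_has_vector_derivative intro: has_field_derivative_at_within\<close>)
    then show "integral {a..b} (\<lambda>r. Br s r) = - B s a" using zero by (simp add: integral_unique)
  qed
  finally have 2: "integral (cbox (0, a) (1, b)) (\<lambda>z. Br (fst z) (snd z)) = - integral {0..1} (\<lambda>s. B s a)" by simp
  show ?thesis
    unfolding Q using 1 2
    by (subst Henstock_Kurzweil_Integration.integral_diff) (auto intro: integrable_continuous As' Br')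
qed

section \<open>The divergence theorem on the region bounded by the curve\<close>

lemma openin_sphere_borel: "openin (top_of_set unit_sphere) T \<Longrightarrow> T \<in> sets borel"
  by (auto simp: openin_open intro!: sets.Int)

lemma set_integrable_sphere_subcompact:
  fixes f :: "real^3 \<Rightarrow> real"
  assumes "compact Z" "continuous_on Z f" "E \<subseteq> Z" "E \<in> sets borel"
  shows "set_integrable sphere_measure E f"
proof -
  obtain B where B: "\<forall>x\<in>Z. \<bar>f x\<bar> \<le> B"
    using compact_imp_bounded[OF compact_continuous_image[OF assms(2,1)]] by (auto simp: bounded_iff)
  have "(\<lambda>x. indicator E x *\<^sub>R f x) \<in> borel_measurable borel"
    by (rule borel_measurable_continuous_on_indicator[OF assms(4) continuous_on_subset[OF assms(2,3)]])
  then show ?thesis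
    unfolding set_integrable_def
    by (rule integrable_sphere_borel_bounded[where B = "max B 0"])
       (use B assms(3) in \<open>force simp: indicator_def le_max_iff_disj\<close>)
qed

locale sphere_region = sphere_tube +
  fixes \<Omega> :: "(real^3) set"
  assumes \<Omega>_open: "openin (top_of_set unit_sphere) \<Omega>"
    and \<Omega>_closure: "closure \<Omega> \<subseteq> \<Omega> \<union> range \<gamma>"
    and \<Omega>_sub: "\<Omega> \<subseteq> unit_sphere - range \<gamma>"
    and tube_pos: "0 < r \<Longrightarrow> r < r0 \<Longrightarrow> tube s r \<in> \<Omega>"
    and tube_neg: "- r0 < r \<Longrightarrow> r < 0 \<Longrightarrow> tube s r \<notin> \<Omega>"
begin

text \<open>The improper integral measures Euclidean distance from the curve, the tube measures arcs
  along normal great circles; this converts the second into the first.\<close>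

definition chord :: "real \<Rightarrow> real" where "chord r = 2 * sin (r / 2)"

definition inner_region :: "real \<Rightarrow> (real^3) set" where
  "inner_region d = {x \<in> \<Omega>. infdist x (range \<gamma>) > d}"

lemma chord_mono: "0 \<le> a \<Longrightarrow> a < b \<Longrightarrow> b \<le> r0 \<Longrightarrow> chord a < chord b"
  unfolding chord_def using r0_pi by (simp, subst sin_mono_less_eq) auto

lemma chord_pos: "0 < r \<Longrightarrow> r \<le> r0 \<Longrightarrow> 0 < chord r"
  using chord_mono[of 0 r] by (simp add: chord_def)

lemma inner_region_borel: "inner_region d \<in> sets borel"
proof -
  have "openin (top_of_set unit_sphere) (\<Omega> \<inter> (unit_sphere \<inter> {x. infdist x (range \<gamma>) > d}))"
    by (intro openin_Int \<Omega>_open openin_open_Int open_Collect_less continuous_intros)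
  moreover have "\<Omega> \<inter> (unit_sphere \<inter> {x. infdist x (range \<gamma>) > d}) = inner_region d"
    using \<Omega>_sub by (auto simp: inner_region_def)
  ultimately show ?thesis using openin_sphere_borel by metis
qed

text \<open>Passing to the closure of the region adds only points of the curve, and these have
  distance zero. Fields that are continuous on the open region alone are bounded on such
  sets.\<close>

lemma compact_inner: "d > 0 \<Longrightarrow> compact {x \<in> \<Omega>. infdist x (range \<gamma>) \<ge> d}"
proof -
  assume d: "d > 0"
  have "{x \<in> \<Omega>. infdist x (range \<gamma>) \<ge> d} = closure \<Omega> \<inter> {x. infdist x (range \<gamma>) \<ge> d}"
    using \<Omega>_closure closure_subset[of \<Omega>] d by (auto simp: infdist_zero)
  moreover have "closed {x. infdist x (range \<gamma>) \<ge> d}"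
    by (intro closed_Collect_le continuous_intros)
  moreover have "bounded \<Omega>"
    using \<Omega>_sub bounded_subset[OF bounded_sphere[of "0 :: real^3" 1]] by blast
  ultimately show ?thesis
    by (simp add: compact_Int_closed)
qed

lemma tube_annulus:
  assumes \<rho>: "0 < \<rho>" "\<rho> < r1" "r1 < r0"
  shows "(\<lambda>z. tube (fst z) (snd z)) ` ({0..<1} \<times> {\<rho><..<r1}) =
    {x \<in> \<Omega>. chord \<rho> < infdist x (range \<gamma>) \<and> infdist x (range \<gamma>) < chord r1}" (is "?P ` ?R = ?A")
proof (intro equalityI subsetI)
  fix x assume "x \<in> ?P ` ?R"
  then obtain s r where "x = tube s r" "\<rho> < r" "r < r1" by auto
  then show "x \<in> ?A"
    using tube_pos[of r s] infdist_tube[of r s] \<rho> chord_mono[of \<rho> r] chord_mono[of r r1]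
    by (auto simp: chord_def)
next
  fix x assume x: "x \<in> ?A"
  then have "norm x = 1" "infdist x (range \<gamma>) < 2 * sin (r1 / 2)"
    using \<Omega>_sub by (auto simp: chord_def)
  from near_curve_in_tube[OF this] \<rho>
  obtain s r where sr: "0 \<le> s" "s < 1" "\<bar>r\<bar> < r1" "x = tube s r"
    by (metis less_eq_real_def less_trans)
  have id: "infdist x (range \<gamma>) = chord \<bar>r\<bar>" using infdist_tube[of r s] sr \<rho> by (simp add: chord_def)
  have "\<rho> < \<bar>r\<bar>"
  proof (rule ccontr)
    assume "\<not> \<rho> < \<bar>r\<bar>"
    then have "chord \<bar>r\<bar> \<le> chord \<rho>" using chord_mono[of "\<bar>r\<bar>" \<rho>] \<rho> by (cases "\<bar>r\<bar> = \<rho>") auto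
    then show False using id x by simp
  qed
  moreover have "r > 0"
  proof (rule ccontr)
    assume "\<not> r > 0"
    then have "r < 0" "- r0 < r" using calculation sr \<rho> by auto
    then show False using tube_neg[of r s] x sr by auto
  qed
  ultimately show "x \<in> ?P ` ?R" using sr by force
qed

text \<open>For tangential \<open>W\<close> the 1-form
  \<open>v \<mapsto> (x \<times> W) \<bullet> v\<close> has exterior derivative \<open>div W\<close>
  times the area form. \<open>B\<close> and \<open>A\<close> are its components along
  \<open>tube_s\<close> and \<open>tube_r\<close>, so \<open>As - Br\<close> is the divergence times
  the Jacobian \<open>J\<close>.\<close>

lemma tube_boundary_integral:
  assumes W: "\<And>i x. x \<in> \<Omega> \<Longrightarrow> has_surface_gradient (\<lambda>y. W y $ i) (K i x) x"
    and Kc: "\<And>i. continuous_on \<Omega> (K i)" and tan: "\<And>x. x \<in> \<Omega> \<Longrightarrow> W x \<bullet> x = 0"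
    and \<rho>: "0 < \<rho>" "\<rho> < r1" "r1 < r0" and zero: "\<And>s. W (tube s r1) = 0"
  shows "(LINT x:{x \<in> \<Omega>. chord \<rho> < infdist x (range \<gamma>) \<and> infdist x (range \<gamma>) < chord r1}|sphere_measure.
      (\<Sum>i\<in>UNIV. K i x $ i)) = \<sigma> * integral {0..1} (\<lambda>s. cross3 (tube s \<rho>) (W (tube s \<rho>)) \<bullet> tube_s s \<rho>)"
proof -
  let ?P = "\<lambda>z. tube (fst z) (snd z)" and ?R = "{0..<1 :: real} \<times> {\<rho><..<r1}" and ?Q = "{0..1 :: real} \<times> {\<rho>..r1}"
  let ?Ps = "\<lambda>z. tube_s (fst z) (snd z)" and ?Pr = "\<lambda>z. tube_r (fst z) (snd z)"
  let ?A = "{x \<in> \<Omega>. chord \<rho> < infdist x (range \<gamma>) \<and> infdist x (range \<gamma>) < chord r1}"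
  let ?g = "\<lambda>x. \<Sum>i\<in>UNIV. K i x $ i"
  define X where "X s r = - sin r *\<^sub>R \<gamma>' s + cos r *\<^sub>R nv' s" for s r
  define DW where "DW x a = (\<chi> i. K i x \<bullet> a)" for x a
  define A where "A s r = cross3 (tube s r) (W (tube s r)) \<bullet> tube_r s r" for s r
  define B where "B s r = cross3 (tube s r) (W (tube s r)) \<bullet> tube_s s r" for s r
  \<comment> \<open>The curve being only \<open>C\<^sup>2\<close>, \<open>tube_s\<close> cannot be differentiated in \<open>s\<close>; but \<open>A\<close> is needed only
    differentiated in \<open>s\<close> and \<open>B\<close> only in \<open>r\<close>.\<close>
  define As where "As s r = cross3 (tube s r) (W (tube s r)) \<bullet> X s r +
      (cross3 (tube s r) (DW (tube s r) (tube_s s r)) + cross3 (tube_s s r) (W (tube s r))) \<bullet> tube_r s r" for s r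
  define Br where "Br s r = cross3 (tube s r) (W (tube s r)) \<bullet> X s r +
      (cross3 (tube s r) (DW (tube s r) (tube_r s r)) + cross3 (tube_r s r) (W (tube s r))) \<bullet> tube_s s r" for s r
  have in\<Omega>: "tube s r \<in> \<Omega>" if "\<rho> \<le> r" "r \<le> r1" for s r
    using tube_pos[of r s] that \<rho> by auto
  have sph: "tube s r \<in> unit_sphere" for s r by (simp add: norm_tube)
  have Ws: "((\<lambda>s. W (tube s r)) has_vector_derivative DW (tube s r) (tube_s s r)) (at s)"
    and Wr: "((\<lambda>r. W (tube s r)) has_vector_derivative DW (tube s r) (tube_r s r)) (at r)"
    if r: "\<rho> \<le> r" "r \<le> r1" for s r
  proof -
    show "((\<lambda>s. W (tube s r)) has_vector_derivative DW (tube s r) (tube_s s r)) (at s)"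
    proof (rule has_vector_derivative_componentwise)
      show "((\<lambda>s. W (tube s r) $ i) has_real_derivative DW (tube s r) (tube_s s r) $ i) (at s)" for i
        using surface_gradient_along_curve[OF W[OF in\<Omega>[OF r]] tube_partials(1) sph] by (simp add: DW_def)
    qed
    show "((\<lambda>r. W (tube s r)) has_vector_derivative DW (tube s r) (tube_r s r)) (at r)"
    proof (rule has_vector_derivative_componentwise)
      show "((\<lambda>r. W (tube s r) $ i) has_real_derivative DW (tube s r) (tube_r s r) $ i) (at r)" for i
        using surface_gradient_along_curve[OF W[OF in\<Omega>[OF r]] tube_partials(2) sph] by (simp add: DW_def)
    qed
  qed
  have dA: "((\<lambda>s. A s r) has_real_derivative As s r) (at s)" if "\<rho> \<le> r" "r \<le> r1" for s r
    unfolding A_def As_def X_def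
    by (rule has_real_derivative_inner[OF has_vector_derivative_cross3[OF tube_partials(1) Ws[OF that]] tube_partials(3)])
  have dB: "((\<lambda>r. B s r) has_real_derivative Br s r) (at r)" if "\<rho> \<le> r" "r \<le> r1" for s r
    unfolding B_def Br_def X_def
    by (rule has_real_derivative_inner[OF has_vector_derivative_cross3[OF tube_partials(2) Wr[OF that]] tube_partials(4)])
  have orth: "tube_s s r \<bullet> tube s r = 0" "tube_r s r \<bullet> tube s r = 0" for s r
  proof -
    have c: "tube s r \<bullet> tube s r = 1" for s r using norm_tube[of s r] by (simp add: norm_eq_1)
    show "tube_s s r \<bullet> tube s r = 0"
      using constant_inner_deriv[OF tube_partials(1) tube_partials(1) c, of s r] by (simp add: inner_commute)
    show "tube_r s r \<bullet> tube s r = 0"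
      using constant_inner_deriv[OF tube_partials(2) tube_partials(2) c, of s r] by (simp add: inner_commute)
  qed
  define J where "J s r = tube s r \<bullet> cross3 (tube_s s r) (tube_r s r)" for s r
  have AB: "As s r - Br s r = J s r * ?g (tube s r)" if r: "\<rho> \<le> r" "r \<le> r1" for s r
  proof -
    let ?x = "tube s r" and ?a = "tube_s s r" and ?b = "tube_r s r" and ?w = "W (tube s r)"
    have Kx: "K i ?x \<bullet> ?x = 0" for i
      using W[OF in\<Omega>[OF r]] by (auto simp: has_surface_gradient_def)
    have "cross3 ?a ?b = J s r *\<^sub>R ?x"
      unfolding J_def by (rule cross_tangent_parallel[OF orth norm_tube])
    then have "?w \<bullet> cross3 ?a ?b = 0" using tan[OF in\<Omega>[OF r]] by simp
    moreover have "cross3 ?a ?w \<bullet> ?b = - (?w \<bullet> cross3 ?a ?b)" "cross3 ?b ?w \<bullet> ?a = ?w \<bullet> cross3 ?a ?b"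
      by (simp_all add: cross3_def inner_vec_def sum_3 algebra_simps)
    moreover have "cross3 ?x (DW ?x ?a) \<bullet> ?b - cross3 ?x (DW ?x ?b) \<bullet> ?a = ?g ?x * J s r"
      unfolding DW_def J_def by (rule tangential_trace[OF Kx])
    ultimately show ?thesis
      by (simp add: As_def Br_def inner_add_left)
  qed
  have Pc: "continuous_on ?Q ?P" "continuous_on ?Q ?Ps" "continuous_on ?Q ?Pr" "continuous_on ?Q (\<lambda>z. X (fst z) (snd z))"
    unfolding X_def by (intro continuous_intros)+
  have P\<Omega>: "?P ` ?Q \<subseteq> \<Omega>" using in\<Omega> by auto
  have "continuous_on \<Omega> (\<lambda>x. W x $ i)" for i
    using \<Omega>_sub by (intro has_surface_gradient_continuous_on[OF W]) auto
  then have Wc: "continuous_on ?Q (\<lambda>z. W (?P z))"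
    by (intro continuous_on_compose2[OF continuous_on_componentwise_vec Pc(1) P\<Omega>])
  have KPc: "continuous_on ?Q (\<lambda>z. K i (?P z))" for i
    by (rule continuous_on_compose2[OF Kc Pc(1) P\<Omega>])
  have DWc: "continuous_on ?Q (\<lambda>z. DW (?P z) (f z))" if "continuous_on ?Q f" for f
    unfolding DW_def by (intro continuous_on_vec_lambda continuous_intros KPc that)
  have Asc: "continuous_on ?Q (\<lambda>z. As (fst z) (snd z))" and Brc: "continuous_on ?Q (\<lambda>z. Br (fst z) (snd z))"
    unfolding As_def Br_def by (intro continuous_on_inner continuous_on_add continuous_on_cross Pc Wc DWc)+
  have IQ: "integral ?Q (\<lambda>z. As (fst z) (snd z) - Br (fst z) (snd z)) = integral {0..1} (\<lambda>s. B s \<rho>)"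
  proof (rule integral_iterated_derivative[OF _ _ Asc Brc])
    show "A 1 r = A 0 r" for r
      using tube_periodic[of 0 r] by (simp add: A_def)
    show "B s r1 = 0" for s by (simp add: B_def zero)
  qed (use dA dB \<rho> in auto)
  \<comment> \<open>The area formula involves \<open>\<bar>J\<bar>\<close>, the exterior derivative
    the signed \<open>J\<close>; this is where the factor \<open>\<sigma>\<close> in the boundary
    integrals originates.\<close>
  have Jabs: "\<bar>J s r\<bar> = \<sigma> * J s r" if "0 \<le> s" "s \<le> 1" "\<rho> \<le> r" "r \<le> r1" for s r
  proof -
    define j where "j = speed s * (cos r - curv s * sin r)"
    have "0 < cos r - curv s * sin r" using jac_pos[of s r] that \<rho> by auto
    then have "0 < j" using speed_pos[of s] by (simp add: j_def)
    moreover have "J s r = \<sigma> * j"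
      by (simp add: J_def j_def tube_jacobian)
    moreover have "\<sigma> = 1 \<or> \<sigma> = -1"
      using sign square_eq_1_iff[of \<sigma>] by blast
    ultimately show ?thesis by auto
  qed
  have hQ: "\<bar>?P z \<bullet> cross3 (?Ps z) (?Pr z)\<bar> * ?g (?P z) = \<sigma> * (As (fst z) (snd z) - Br (fst z) (snd z))" if "z \<in> ?Q" for z
    using that AB[of "snd z" "fst z"] Jabs[of "fst z" "snd z"] by (auto simp: J_def)
  have RQ: "?R \<subseteq> ?Q" by auto
  have Rb: "?R \<in> sets borel" by (simp add: borel_Times)
  have iQ: "set_integrable lborel ?Q (\<lambda>z. \<sigma> * (As (fst z) (snd z) - Br (fst z) (snd z)))"
    unfolding set_integrable_def
    by (intro borel_integrable_compact compact_Times compact_Icc continuous_intros Asc Brc)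
  have iR: "set_integrable lborel ?R (\<lambda>z. \<sigma> * (As (fst z) (snd z) - Br (fst z) (snd z)))"
    by (rule set_integrable_subset[OF iQ _ RQ]) (use Rb in simp)
  have iR': "set_integrable lborel ?R (\<lambda>z. \<bar>?P z \<bullet> cross3 (?Ps z) (?Pr z)\<bar> * ?g (?P z))"
    using iR hQ RQ by (subst set_integrable_cong[OF refl]) auto
  have Ab: "?A \<in> sets borel"
  proof -
    have "?A = inner_region (chord \<rho>) - {x. infdist x (range \<gamma>) \<ge> chord r1}"
      by (auto simp: inner_region_def)
    also have "\<dots> \<in> sets borel"
      by (intro sets.Diff inner_region_borel borel_closed closed_Collect_le continuous_intros)
    finally show ?thesis .
  qed
  have gA: "set_integrable sphere_measure ?A ?g"
  proof (rule set_integrable_sphere_subcompact[OF compact_inner _ _ Ab])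
    show "0 < chord \<rho>" using chord_pos \<rho> by auto
    show "continuous_on {x \<in> \<Omega>. chord \<rho> \<le> infdist x (range \<gamma>)} ?g"
      by (intro continuous_intros continuous_on_subset[OF Kc]) auto
  qed auto
  have inj: "inj_on ?P ?R"
  proof (rule inj_onI)
    fix z z' assume "z \<in> ?R" "z' \<in> ?R" "?P z = ?P z'"
    then show "z = z'"
      using tube_inj[of "fst z" "fst z'" "snd z" "snd z'"] \<rho> by (auto simp: prod_eq_iff mem_Times_iff)
  qed
  have "(LINT x:?A|sphere_measure. ?g x) = (LINT x:?P ` ?R|sphere_measure. ?g x)"
    unfolding tube_annulus[OF \<rho>] ..
  also have "\<dots> = (LINT z:?R|lborel. \<bar>?P z \<bullet> cross3 (?Ps z) (?Pr z)\<bar> * ?g (?P z))"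
    by (rule integral_sphere_parametrization[OF Rb _ has_derivative_tube inj _ iR'])
       (use Ab gA in \<open>simp_all only: tube_annulus[OF \<rho>] sph\<close>)
  also have "\<dots> = (LINT z:?R|lborel. \<sigma> * (As (fst z) (snd z) - Br (fst z) (snd z)))"
    by (rule set_lebesgue_integral_cong) (use Rb hQ RQ in auto)
  also have "\<dots> = integral ?R (\<lambda>z. \<sigma> * (As (fst z) (snd z) - Br (fst z) (snd z)))"
    by (rule set_borel_integral_eq_integral(2)[OF iR])
  also have "\<dots> = integral ?Q (\<lambda>z. \<sigma> * (As (fst z) (snd z) - Br (fst z) (snd z)))"
  proof (rule integral_spike_set)
    have Q: "?Q = cbox (0 :: real, \<rho>) (1, r1)" and bR: "box (0 :: real, \<rho>) (1, r1) \<subseteq> ?R"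
      by (auto simp: cbox_Pair_eq box_def Basis_prod_def inner_Pair)
    show "negligible {z \<in> ?Q - ?R. \<sigma> * (As (fst z) (snd z) - Br (fst z) (snd z)) \<noteq> 0}"
      by (rule negligible_subset[OF negligible_frontier_interval[of "(0 :: real, \<rho>)" "(1, r1)"]])
         (use Q bR in blast)
    have "{z \<in> ?R - ?Q. \<sigma> * (As (fst z) (snd z) - Br (fst z) (snd z)) \<noteq> 0} = {}" using RQ by blast
    then show "negligible {z \<in> ?R - ?Q. \<sigma> * (As (fst z) (snd z) - Br (fst z) (snd z)) \<noteq> 0}"
      by (simp only: negligible_empty)
  qed
  also have "\<dots> = \<sigma> * integral {0..1} (\<lambda>s. B s \<rho>)"
    by (simp add: IQ)
  finally show ?thesis by (simp add: B_def)
qed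

lemma green_inner_region:
  assumes W: "\<And>i x. x \<in> \<Omega> \<Longrightarrow> has_surface_gradient (\<lambda>y. W y $ i) (K i x) x"
    and Kc: "\<And>i. continuous_on \<Omega> (K i)" and tan: "\<And>x. x \<in> \<Omega> \<Longrightarrow> W x \<bullet> x = 0"
    and \<rho>: "0 < \<rho>" "\<rho> < r0"
  shows "(LINT x:inner_region (chord \<rho>)|sphere_measure. (\<Sum>i\<in>UNIV. K i x $ i)) =
    \<sigma> * integral {0..1} (\<lambda>s. cross3 (tube s \<rho>) (W (tube s \<rho>)) \<bullet> tube_s s \<rho>)"
proof -
  \<comment> \<open>Equally spaced radii between \<open>\<rho>\<close> and \<open>r0\<close>. The
    cutoff falls from 1 to 0 between \<open>\<rho>1\<close> and \<open>r2\<close>; the margins leave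
    it 1 around the inner edge \<open>\<rho>\<close> and 0 around the outer edge
    \<open>r1\<close>.\<close>
  define \<rho>1 r2 r1 where "\<rho>1 = (3 * \<rho> + r0) / 4" and "r2 = (2 * \<rho> + 2 * r0) / 4" and "r1 = (\<rho> + 3 * r0) / 4"
  have ord: "\<rho> < \<rho>1" "\<rho>1 < r2" "r2 < r1" "r1 < r0"
    using \<rho> by (auto simp: \<rho>1_def r2_def r1_def)
  have ch: "0 < chord \<rho>" "chord \<rho> < chord \<rho>1" "chord \<rho>1 < chord r2" "chord r2 < chord r1"
    using ord \<rho> by (auto intro!: chord_pos chord_mono)
  let ?d = "\<lambda>x. infdist x (range \<gamma>)"
  obtain \<psi> G where \<psi>: "\<And>x. x \<in> unit_sphere \<Longrightarrow> has_surface_gradient \<psi> (G x) x" "continuous_on unit_sphere G"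
    "\<And>x. x \<in> unit_sphere \<Longrightarrow> ?d x \<le> chord \<rho>1 \<Longrightarrow> \<psi> x = 1"
    "\<And>x. x \<in> unit_sphere \<Longrightarrow> ?d x \<ge> chord r2 \<Longrightarrow> \<psi> x = 0"
    "\<And>x. x \<in> unit_sphere \<Longrightarrow> ?d x < chord \<rho>1 \<or> ?d x > chord r2 \<Longrightarrow> G x = 0"
    using sphere_cutoff[OF ch(3)] by blast
  have \<Omega>S: "x \<in> unit_sphere" if "x \<in> \<Omega>" for x using \<Omega>_sub that by auto
  have \<psi>c: "continuous_on unit_sphere \<psi>"
    by (rule has_surface_gradient_continuous_on[OF \<psi>(1)]) auto
  have Wc: "continuous_on \<Omega> (\<lambda>x. W x $ i)" for i
    using \<Omega>_sub by (intro has_surface_gradient_continuous_on[OF W]) auto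
  define V where "V x = \<psi> x *\<^sub>R W x" for x
  define KV where "KV i x = \<psi> x *\<^sub>R K i x + W x $ i *\<^sub>R G x" for i x
  define X where "X x = (if x \<in> \<Omega> then (1 - \<psi> x) *\<^sub>R W x else 0)" for x
  define KX where "KX i x = (if x \<in> \<Omega> then (1 - \<psi> x) *\<^sub>R K i x - W x $ i *\<^sub>R G x else 0)" for i x
  have V: "has_surface_gradient (\<lambda>y. V y $ i) (KV i x) x" if "x \<in> \<Omega>" for i x
    using has_surface_gradient_mult[OF \<psi>(1)[OF \<Omega>S[OF that]] W[OF that]] by (simp add: V_def KV_def)
  have KVc: "continuous_on \<Omega> (KV i)" for i
    unfolding KV_def
    using \<Omega>S by (intro continuous_intros Kc Wc continuous_on_subset[OF \<psi>c] continuous_on_subset[OF \<psi>(2)]) auto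
  have Vt: "V x \<bullet> x = 0" if "x \<in> \<Omega>" for x using tan[OF that] by (simp add: V_def)
  have V0: "V (tube s r1) = 0" for s
  proof -
    have "?d (tube s r1) = chord r1" using infdist_tube[of r1 s] ord \<rho> by (simp add: chord_def)
    then have "\<psi> (tube s r1) = 0" using ch by (intro \<psi>(4)) (auto simp: norm_tube)
    then show ?thesis by (simp add: V_def)
  qed
  let ?g = "\<lambda>x. \<Sum>i\<in>UNIV. K i x $ i" and ?gV = "\<lambda>x. \<Sum>i\<in>UNIV. KV i x $ i" and ?gX = "\<lambda>x. \<Sum>i\<in>UNIV. KX i x $ i"
  let ?E = "inner_region (chord \<rho>)" and ?A = "{x \<in> \<Omega>. chord \<rho> < ?d x \<and> ?d x < chord r1}"
  have "(LINT x:?A|sphere_measure. ?gV x) =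
      \<sigma> * integral {0..1} (\<lambda>s. cross3 (tube s \<rho>) (V (tube s \<rho>)) \<bullet> tube_s s \<rho>)"
    by (rule tube_boundary_integral[OF V KVc Vt]) (use ord \<rho> V0 in auto)
  also have "(\<lambda>s. cross3 (tube s \<rho>) (V (tube s \<rho>)) \<bullet> tube_s s \<rho>) = (\<lambda>s. cross3 (tube s \<rho>) (W (tube s \<rho>)) \<bullet> tube_s s \<rho>)"
  proof
    fix s
    have "?d (tube s \<rho>) = chord \<rho>" using infdist_tube[of \<rho> s] \<rho> by (simp add: chord_def)
    then have "\<psi> (tube s \<rho>) = 1" using ch by (intro \<psi>(3)) (auto simp: norm_tube)
    then show "cross3 (tube s \<rho>) (V (tube s \<rho>)) \<bullet> tube_s s \<rho> = cross3 (tube s \<rho>) (W (tube s \<rho>)) \<bullet> tube_s s \<rho>"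
      by (simp add: V_def)
  qed
  also have "(LINT x:?A|sphere_measure. ?gV x) = (LINT x:?E|sphere_measure. ?gV x)"
  proof -
    have "KV i x = 0" if "x \<in> \<Omega>" "chord r1 \<le> ?d x" for i x
      using that ch \<psi>(4)[OF \<Omega>S[OF that(1)]] \<psi>(5)[OF \<Omega>S[OF that(1)]] by (simp add: KV_def)
    then have "indicator ?A x *\<^sub>R ?gV x = indicator ?E x *\<^sub>R ?gV x" for x
      by (auto simp: inner_region_def indicator_def)
    then show ?thesis by (simp only: set_lebesgue_integral_def)
  qed
  finally have 1: "(LINT x:?E|sphere_measure. ?gV x) =
      \<sigma> * integral {0..1} (\<lambda>s. cross3 (tube s \<rho>) (W (tube s \<rho>)) \<bullet> tube_s s \<rho>)" .
  \<comment> \<open>An open set on which the part away from the curve vanishes. Together with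
    \<open>\<Omega>\<close> it covers the sphere, so the extension by zero is continuously
    differentiable.\<close>
  define Z where "Z = unit_sphere - {x \<in> \<Omega>. ?d x \<ge> chord \<rho>1}"
  have Zo: "openin (top_of_set unit_sphere) Z"
    unfolding Z_def using compact_inner[of "chord \<rho>1"] ch \<Omega>S
    by (intro openin_diff closed_subset compact_imp_closed) auto
  have Z0: "X x = 0" "KX i x = 0" if "x \<in> Z" for i x
    using that \<psi>(3)[of x] \<psi>(5)[of x] by (auto simp: X_def KX_def Z_def not_le)
  have XS: "has_surface_gradient (\<lambda>y. X y $ i) (KX i x) x" if x: "x \<in> unit_sphere" for i x
  proof (cases "x \<in> \<Omega>")
    case True
    have "has_surface_gradient (\<lambda>y. (1 - \<psi> y) * W y $ i) ((1 - \<psi> x) *\<^sub>R K i x + W x $ i *\<^sub>R (0 - G x)) x"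
      by (rule has_surface_gradient_mult[OF has_surface_gradient_diff[OF has_surface_gradient_const \<psi>(1)[OF x]] W[OF True]])
    then have "has_surface_gradient (\<lambda>y. (1 - \<psi> y) * W y $ i) (KX i x) x"
      using True by (simp add: KX_def)
    then show ?thesis
      by (rule has_surface_gradient_cong_ev[OF _ x \<Omega>_open True]) (simp add: X_def)
  next
    case False
    then have xZ: "x \<in> Z" using x by (simp add: Z_def)
    have "has_surface_gradient (\<lambda>_. 0) (KX i x) x"
      using Z0(2)[OF xZ] by (simp add: has_surface_gradient_const)
    then show ?thesis
      by (rule has_surface_gradient_cong_ev[OF _ x Zo xZ]) (simp add: Z0)
  qed
  have KXc: "continuous_on unit_sphere (KX i)" for i
  proof -
    have "continuous_on \<Omega> (KX i)"
    proof (rule continuous_on_eq)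
      show "continuous_on \<Omega> (\<lambda>x. (1 - \<psi> x) *\<^sub>R K i x - W x $ i *\<^sub>R G x)"
        using \<Omega>S by (intro continuous_intros Kc Wc continuous_on_subset[OF \<psi>c] continuous_on_subset[OF \<psi>(2)]) auto
    qed (simp add: KX_def)
    moreover have "continuous_on Z (KX i)"
      by (rule continuous_on_eq[of _ "\<lambda>_. 0"]) (auto simp: Z0)
    moreover have U: "\<Omega> \<union> Z = unit_sphere" using \<Omega>S by (auto simp: Z_def)
    ultimately have "continuous_on (\<Omega> \<union> Z) (KX i)"
      using \<Omega>_open Zo by (intro continuous_on_Un_local_open) (simp_all only: U)
    then show ?thesis by (simp only: U)
  qed
  have "(LINT x:unit_sphere|sphere_measure. ?gX x) = 0"
    by (rule integral_sphere_divergence_eq_0[OF XS KXc]) (use tan in \<open>auto simp: X_def\<close>)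
  also have "(LINT x:unit_sphere|sphere_measure. ?gX x) = (LINT x:?E|sphere_measure. ?gX x)"
  proof -
    have "indicator unit_sphere x *\<^sub>R ?gX x = indicator ?E x *\<^sub>R ?gX x" for x
    proof (cases "x \<in> unit_sphere \<and> x \<notin> ?E")
      case True
      then have "x \<in> Z" using ch by (auto simp: Z_def inner_region_def)
      then show ?thesis by (simp add: Z0)
    qed (use \<Omega>S in \<open>auto simp: indicator_def inner_region_def\<close>)
    then show ?thesis by (simp only: set_lebesgue_integral_def)
  qed
  finally have 2: "(LINT x:?E|sphere_measure. ?gX x) = 0" .
  have int: "set_integrable sphere_measure ?E f" if "continuous_on \<Omega> f" for f :: "real^3 \<Rightarrow> real"
    by (rule set_integrable_sphere_subcompact[OF compact_inner[OF ch(1)] continuous_on_subset[OF that] _ inner_region_borel])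
       (auto simp: inner_region_def)
  have "(LINT x:?E|sphere_measure. ?g x) = (LINT x:?E|sphere_measure. ?gV x + ?gX x)"
  proof (rule set_lebesgue_integral_cong)
    have "K i x = KV i x + KX i x" if "x \<in> \<Omega>" for i x
      using that by (simp add: KV_def KX_def algebra_simps)
    then show "\<forall>x. x \<in> ?E \<longrightarrow> ?g x = ?gV x + ?gX x"
      by (simp add: inner_region_def sum.distrib)
  qed (simp add: inner_region_borel)
  also have "\<dots> = (LINT x:?E|sphere_measure. ?gV x) + (LINT x:?E|sphere_measure. ?gX x)"
    using \<Omega>S by (intro set_integral_add int continuous_intros KVc continuous_on_subset[OF KXc]) auto
  finally show ?thesis using 1 2 by simp
qed

end

section \<open>The representation formula\<close>

locale sphere_representation = sphere_region +
  fixes u :: "real^3 \<Rightarrow> real" and G :: "real^3 \<Rightarrow> real^3" and H :: "3 \<Rightarrow> real^3 \<Rightarrow> real^3" and x0 :: "real^3"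
  assumes grad: "\<And>x. x \<in> \<Omega> \<Longrightarrow> has_surface_gradient u (G x) x"
    and hess: "\<And>i x. x \<in> \<Omega> \<Longrightarrow> has_surface_gradient (\<lambda>y. G y $ i) (H i x) x"
    and cont_H: "\<And>i. continuous_on \<Omega> (H i)"
    and cont_G: "continuous_on (closure \<Omega>) G"
    and cont_u: "continuous_on (closure \<Omega>) u"
    and x0_sphere: "norm x0 = 1"
    and x0_off_boundary: "x0 \<in> \<Omega> \<or> x0 \<notin> closure \<Omega>"
begin

abbreviation lap :: "real^3 \<Rightarrow> real" where "lap x \<equiv> \<Sum>i\<in>UNIV. H i x $ i"

definition point_value :: real where "point_value = (if x0 \<in> \<Omega> then u x0 else 0)"

text \<open>The boundary integrand of Green's second identity on the parallel curve. As
  \<open>tube_s\<close> is not normalized, the arc length element is already contained; the case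
  \<open>a = 1\<close> is meant off the singularity.\<close>

definition flux :: "real \<Rightarrow> real \<Rightarrow> real \<Rightarrow> real" where
  "flux a r s = cross3 (tube s r) (Ureg a x0 (tube s r) *\<^sub>R G (tube s r)
     - u (tube s r) *\<^sub>R zonal_field (Ureg' a) x0 (tube s r)) \<bullet> tube_s s r"

lemma \<Omega>_sphere: "x \<in> \<Omega> \<Longrightarrow> norm x = 1"
  using \<Omega>_sub by auto

lemma compact_closure_\<Omega>: "compact (closure \<Omega>)"
  unfolding compact_closure using \<Omega>_sub bounded_subset[OF bounded_sphere[of "0 :: real^3" 1]] by blast

lemma tube_in_closure: "0 \<le> r \<Longrightarrow> r < r0 \<Longrightarrow> tube s r \<in> closure \<Omega>"
proof (cases "r = 0")
  case True
  have "((\<lambda>n. tube s (r0 / real (n + 2))) \<longlongrightarrow> tube s 0) sequentially"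
  proof (rule continuous_on_tendsto_compose[of UNIV "\<lambda>r. tube s r"])
    show "continuous_on UNIV (\<lambda>r. tube s r)" by (intro continuous_intros)
    show "(\<lambda>n. r0 / real (n + 2)) \<longlonglongrightarrow> 0"
      using LIMSEQ_ignore_initial_segment[OF lim_const_over_n[of r0], of 2] by simp
  qed auto
  moreover have "tube s (r0 / real (n + 2)) \<in> \<Omega>" for n
    using r0 by (intro tube_pos) (auto simp: divide_simps)
  ultimately show ?thesis
    unfolding True closure_sequential by (intro exI[of _ "\<lambda>n. tube s (r0 / real (n + 2))"]) auto
next
  case False
  assume "0 \<le> r" "r < r0"
  then show ?thesis using False tube_pos[of r s] closure_subset by auto
qed

lemma x0_notin_curve: "0 < infdist x0 (range \<gamma>)"
proof -
  have "x0 \<notin> range \<gamma>"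
    using x0_off_boundary \<Omega>_sub tube_in_closure[of 0] r0 by (auto simp: tube_0)
  moreover have "closed (range \<gamma>)" using compact_range_\<gamma> compact_imp_closed by blast
  ultimately have "infdist x0 (range \<gamma>) \<noteq> 0"
    using in_closed_iff_infdist_zero[of "range \<gamma>" x0] by auto
  then show ?thesis using infdist_nonneg[of x0 "range \<gamma>"] by linarith
qed

text \<open>A chord is no longer than its arc, so half the distance from \<open>x0\<close> to the
  curve keeps all parallel curves up to \<open>\<rho>0\<close> away from \<open>x0\<close>.\<close>

definition \<rho>0 :: real where "\<rho>0 = min (r0 / 2) (infdist x0 (range \<gamma>) / 2)"

lemma \<rho>0: "0 < \<rho>0" "\<rho>0 < r0"
  using r0 x0_notin_curve by (auto simp: \<rho>0_def)

lemma chord_less_infdist: "0 \<le> r \<Longrightarrow> r \<le> \<rho>0 \<Longrightarrow> chord r < infdist x0 (range \<gamma>)"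
  using sin_x_le_x[of "r / 2"] x0_notin_curve by (auto simp: chord_def \<rho>0_def)

lemma tube_inner_x0: "0 \<le> r \<Longrightarrow> r \<le> \<rho>0 \<Longrightarrow> tube s r \<bullet> x0 < 1"
proof (rule inner_unit_lt_1[OF norm_tube x0_sphere], rule notI)
  assume r: "0 \<le> r" "r \<le> \<rho>0" and "tube s r = x0"
  then show False
    using infdist_tube[of r s] chord_less_infdist[OF r] \<rho>0 by (auto simp: chord_def)
qed

text \<open>Joint continuity up to \<open>a = 1\<close> and up to the curve serves both limits. It
  holds because these curves avoid \<open>x0\<close> and because \<open>u\<close> and
  \<open>G\<close> extend continuously to the closure.\<close>

lemma continuous_on_flux_integral:
  "continuous_on ({1..} \<times> {0..\<rho>0}) (\<lambda>z. integral {0..1} (\<lambda>s. flux (fst z) (snd z) s))"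
proof -
  let ?U = "{1 :: real..} \<times> {0..\<rho>0}"
  let ?D = "?U \<times> {0 :: real..1}"
  let ?P = "\<lambda>w :: (real \<times> real) \<times> real. tube (snd w) (snd (fst w))"
  have P: "continuous_on ?D ?P" and Ps: "continuous_on ?D (\<lambda>w. tube_s (snd w) (snd (fst w)))"
    by (intro continuous_intros)+
  have in_cl: "?P ` ?D \<subseteq> closure \<Omega>" using tube_in_closure \<rho>0 by auto
  have GP: "continuous_on ?D (\<lambda>w. G (?P w))" and uP: "continuous_on ?D (\<lambda>w. u (?P w))"
    by (rule continuous_on_compose2[OF cont_G P in_cl], rule continuous_on_compose2[OF cont_u P in_cl])
  have pos: "fst (fst w) - ?P w \<bullet> x0 > 0" if "w \<in> ?D" for w
    using that tube_inner_x0[of "snd (fst w)" "snd w"] by auto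
  have UP: "continuous_on ?D (\<lambda>w. Ureg (fst (fst w)) x0 (?P w))"
    unfolding Ureg_def using pos by (intro continuous_intros P) force+
  have U'P: "continuous_on ?D (\<lambda>w. Ureg' (fst (fst w)) (?P w \<bullet> x0))"
    unfolding Ureg'_def using pos by (intro continuous_intros P) force+
  have "continuous_on ?D (\<lambda>w. flux (fst (fst w)) (snd (fst w)) (snd w))"
    unfolding flux_def zonal_field_def
    by (intro continuous_on_inner continuous_on_cross P Ps continuous_on_diff continuous_on_scaleR UP GP uP U'P
        continuous_on_const)
  then have "continuous_on (?U \<times> cbox 0 1) (\<lambda>(z, s). flux (fst z) (snd z) s)"
    by (simp add: case_prod_beta')
  from integral_continuous_on_param[OF this] show ?thesis by simp
qed

lemma inner_region_subset: "inner_region d \<subseteq> \<Omega>"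
  by (auto simp: inner_region_def)

lemma integrable_inner_region:
  assumes "continuous_on \<Omega> f" "0 < d"
  shows "set_integrable sphere_measure (inner_region d) (f :: real^3 \<Rightarrow> real)"
  by (rule set_integrable_sphere_subcompact[OF compact_inner[OF assms(2)] continuous_on_subset[OF assms(1)] _ inner_region_borel])
     (auto simp: inner_region_def)

lemma bounded_inner_region:
  assumes "continuous_on \<Omega> f" "0 < d"
  obtains B where "\<And>x. \<bar>indicator (inner_region d) x * f x\<bar> \<le> (B :: real)"
    "(\<lambda>x. indicator (inner_region d) x * f x) \<in> borel_measurable borel"
proof -
  let ?Z = "{x \<in> \<Omega>. infdist x (range \<gamma>) \<ge> d}"
  have "continuous_on ?Z f" by (rule continuous_on_subset[OF assms(1)]) auto
  from compact_imp_bounded[OF compact_continuous_image[OF this compact_inner[OF assms(2)]]]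
  obtain B where B: "B > 0" "\<forall>x\<in>?Z. \<bar>f x\<bar> \<le> B" by (auto simp: bounded_pos)
  have 1: "\<bar>indicator (inner_region d) x * f x\<bar> \<le> B" for x
    using B by (auto simp: indicator_def inner_region_def)
  have "(\<lambda>x. indicator (inner_region d) x *\<^sub>R f x) \<in> borel_measurable borel"
    by (rule borel_measurable_continuous_on_indicator[OF inner_region_borel continuous_on_subset[OF assms(1) inner_region_subset]])
  then show ?thesis using that[OF 1] by simp
qed

lemma continuous_on_u: "continuous_on \<Omega> u" and continuous_on_G: "continuous_on \<Omega> G"
  and continuous_on_lap: "continuous_on \<Omega> lap"
  using continuous_on_subset[OF cont_u closure_subset] continuous_on_subset[OF cont_G closure_subset]
  by (auto intro!: continuous_intros cont_H)

lemma green_Ureg: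
  assumes a: "1 < a" and \<rho>: "0 < \<rho>" "\<rho> < r0"
  shows "(LINT x:inner_region (chord \<rho>)|sphere_measure.
      Ureg a x0 x * lap x - u x * (1 / (4 * pi) - sphere_kernel a x0 x)) =
    \<sigma> * integral {0..1} (flux a \<rho>)"
proof -
  let ?U = "Ureg a x0" and ?V = "zonal_field (Ureg' a) x0" and ?Q = "zonal_hess (Ureg' a) (Ureg'' a) x0"
  define W where "W x = ?U x *\<^sub>R G x - u x *\<^sub>R ?V x" for x
  define K where "K i x = (?U x *\<^sub>R H i x + G x $ i *\<^sub>R ?V x) - (u x *\<^sub>R ?Q i x + ?V x $ i *\<^sub>R G x)" for i x
  have lt: "x \<bullet> x0 < a" if "x \<in> \<Omega>" for x
    using inner_unit_sphere_bounds[OF \<Omega>_sphere[OF that] x0_sphere] a by linarith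
  have dU: "has_surface_gradient ?U (?V x) x" if "x \<in> \<Omega>" for x
    unfolding Ureg_def[abs_def]
    by (rule has_surface_gradient_zonal[where f = "\<lambda>t. - (1 / (4 * pi)) * ln (a - t)" and p = "Ureg' a",
          OF \<Omega>_sphere[OF that] Ureg_derivs(1)[OF lt[OF that]]])
  have dV: "has_surface_gradient (\<lambda>y. ?V y $ i) (?Q i x) x" if "x \<in> \<Omega>" for i x
    by (rule has_surface_gradient_zonal_field[where p = "Ureg' a" and p' = "Ureg'' a", OF \<Omega>_sphere[OF that] Ureg_derivs(2)[OF lt[OF that]]])
  have dW: "has_surface_gradient (\<lambda>y. W y $ i) (K i x) x" if "x \<in> \<Omega>" for i x
  proof -
    have "has_surface_gradient (\<lambda>y. ?U y * G y $ i - u y * ?V y $ i) (K i x) x"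
      unfolding K_def
      by (intro has_surface_gradient_diff has_surface_gradient_mult dU dV grad hess that)
    then show ?thesis by (simp add: W_def)
  qed
  have Uc: "continuous_on \<Omega> ?U"
    using \<Omega>_sphere by (intro has_surface_gradient_continuous_on[OF dU]) auto
  have im: "(\<lambda>x. x \<bullet> x0) ` \<Omega> \<subseteq> {..<a}" using lt by auto
  have c': "continuous_on {..<a} (Ureg' a)" "continuous_on {..<a} (Ureg'' a)"
    unfolding Ureg'_def Ureg''_def by (auto intro!: continuous_intros)
  have Kc: "continuous_on \<Omega> (K i)" for i
    unfolding K_def
    by (intro continuous_intros Uc cont_H continuous_on_G continuous_on_u
        continuous_on_zonal_field[OF c'(1) im] continuous_on_zonal_hess[OF c' im])
  have tan: "W x \<bullet> x = 0" if "x \<in> \<Omega>" for x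
    using grad[OF that] zonal_field_tangent[OF \<Omega>_sphere[OF that]]
    by (simp add: W_def inner_diff_left has_surface_gradient_def)
  \<comment> \<open>The two mixed terms are the inner product of the gradients of \<open>u\<close>
    and \<open>Ureg\<close>, with opposite signs.\<close>
  have tr: "(\<Sum>i\<in>UNIV. K i x $ i) = Ureg a x0 x * lap x - u x * (1 / (4 * pi) - sphere_kernel a x0 x)"
    if "x \<in> \<Omega>" for x
  proof -
    have "(\<Sum>i\<in>UNIV. K i x $ i) = ?U x * lap x - u x * (\<Sum>i\<in>UNIV. ?Q i x $ i)"
      by (simp add: K_def sum.distrib sum_subtractf sum_distrib_left mult.commute)
    also have "(\<Sum>i\<in>UNIV. ?Q i x $ i) = 1 / (4 * pi) - sphere_kernel a x0 x"
      unfolding zonal_hess_trace[OF \<Omega>_sphere[OF that] x0_sphere] sphere_kernel_def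
      by (rule Ureg_trace[OF lt[OF that]])
    finally show ?thesis .
  qed
  have "(LINT x:inner_region (chord \<rho>)|sphere_measure. (\<Sum>i\<in>UNIV. K i x $ i)) =
      \<sigma> * integral {0..1} (\<lambda>s. cross3 (tube s \<rho>) (W (tube s \<rho>)) \<bullet> tube_s s \<rho>)"
    by (rule green_inner_region[OF dW Kc tan \<rho>])
  also have "(LINT x:inner_region (chord \<rho>)|sphere_measure. (\<Sum>i\<in>UNIV. K i x $ i)) =
    (LINT x:inner_region (chord \<rho>)|sphere_measure. Ureg a x0 x * lap x - u x * (1 / (4 * pi) - sphere_kernel a x0 x))"
    by (rule set_lebesgue_integral_cong) (use inner_region_borel tr inner_region_subset in auto)
  finally show ?thesis by (simp add: W_def flux_def[abs_def])
qed

text \<open>The limit \<open>a \<rightarrow> 1\<close> at a fixed distance from the curve: on the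
  inner region both \<open>u\<close> and \<open>lap\<close> are bounded, as the convergence of the
  logarithmic and of the kernel integrals requires.\<close>

lemma representation_inner_region:
  assumes \<rho>: "0 < \<rho>" "\<rho> \<le> \<rho>0"
  shows "(LINT x:inner_region (chord \<rho>)|sphere_measure. Ustar x x0 * lap x) =
    1 / (4 * pi) * (LINT x:inner_region (chord \<rho>)|sphere_measure. u x) - point_value
    + \<sigma> * integral {0..1} (flux 1 \<rho>)"
proof -
  let ?E = "inner_region (chord \<rho>)"
  have \<rho>r: "\<rho> < r0" using \<rho> \<rho>0 by linarith
  have ch: "0 < chord \<rho>" using chord_pos \<rho> \<rho>r by auto
  let ?h1 = "\<lambda>x. indicator ?E x * lap x" and ?h2 = "\<lambda>x. indicator ?E x * u x"
  obtain B1 where B1: "\<And>x. \<bar>?h1 x\<bar> \<le> B1" and m1: "?h1 \<in> borel_measurable borel"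
    using bounded_inner_region[OF continuous_on_lap ch] by blast
  obtain B2 where B2: "\<And>x. \<bar>?h2 x\<bar> \<le> B2" and m2: "?h2 \<in> borel_measurable borel"
    using bounded_inner_region[OF continuous_on_u ch] by blast
  \<comment> \<open>The cut-off function is continuous at \<open>x0\<close>: either
    \<open>x0\<close> is interior to the inner region, by the choice of \<open>\<rho>0\<close>, or
    the region stays away from it and the value is 0.\<close>
  have lim: "\<exists>d>0. \<forall>x\<in>unit_sphere. dist x x0 < d \<longrightarrow> \<bar>?h2 x - point_value\<bar> < e" if e: "e > 0" for e
  proof (cases "x0 \<in> \<Omega>")
    case True
    have o: "openin (top_of_set unit_sphere) (\<Omega> \<inter> (unit_sphere \<inter> {x. infdist x (range \<gamma>) > chord \<rho>}))"
      by (intro openin_Int \<Omega>_open openin_open_Int open_Collect_less continuous_intros)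
    moreover have "x0 \<in> \<Omega> \<inter> (unit_sphere \<inter> {x. infdist x (range \<gamma>) > chord \<rho>})"
      using True x0_sphere chord_less_infdist[of \<rho>] \<rho> by auto
    ultimately obtain d1 where d1: "d1 > 0" "\<And>x. x \<in> unit_sphere \<Longrightarrow> dist x x0 < d1 \<Longrightarrow> x \<in> ?E"
      unfolding openin_euclidean_subtopology_iff inner_region_def by blast
    obtain d2 where d2: "d2 > 0" "\<And>x. x \<in> \<Omega> \<Longrightarrow> dist x x0 < d2 \<Longrightarrow> dist (u x) (u x0) < e"
      using continuous_on_u True e unfolding continuous_on_iff by blast
    show ?thesis
    proof (intro exI[of _ "min d1 d2"] conjI ballI impI)
      fix x :: "real^3" assume x: "x \<in> unit_sphere" "dist x x0 < min d1 d2"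
      then have "x \<in> ?E" using d1(2) by simp
      then show "\<bar>?h2 x - point_value\<bar> < e"
        using d2(2)[of x] x inner_region_subset True by (auto simp: point_value_def dist_real_def)
    qed (use d1 d2 in auto)
  next
    case False
    then have "x0 \<in> - closure \<Omega>" using x0_off_boundary by auto
    then obtain d where d: "d > 0" "ball x0 d \<subseteq> - closure \<Omega>"
      using open_contains_ball[of "- closure \<Omega>"] by auto
    show ?thesis
    proof (intro exI[of _ d] conjI ballI impI)
      fix x :: "real^3" assume "dist x x0 < d"
      then have "x \<notin> \<Omega>" using d(2) closure_subset[of \<Omega>] by (auto simp: dist_commute subset_iff)
      then have "x \<notin> ?E" using inner_region_subset by blast
      then show "\<bar>?h2 x - point_value\<bar> < e"
        using e False by (simp add: point_value_def)
    qed (use d in auto)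
  qed
  note T1 = tendsto_integral_Ureg[OF x0_sphere m1 B1]
  note T2 = tendsto_integral_sphere_kernel[OF x0_sphere m2 B2 lim]
  have i2: "integrable sphere_measure ?h2"
    by (rule integrable_sphere_borel_bounded[OF m2 B2])
  have key: "(LINT x|sphere_measure. Ureg (areg n) x0 x * ?h1 x) + (LINT x|sphere_measure. sphere_kernel (areg n) x0 x * ?h2 x)
      - 1 / (4 * pi) * integral\<^sup>L sphere_measure ?h2 = \<sigma> * integral {0..1} (flux (areg n) \<rho>)" for n
  proof -
    have a: "1 < areg n" by (rule areg_bounds)
    have pos: "x \<bullet> x0 < areg n" if "norm x = 1" for x
      using inner_unit_sphere_bounds[OF that x0_sphere] a by linarith
    have c: "continuous_on \<Omega> (Ureg (areg n) x0)" "continuous_on \<Omega> (sphere_kernel (areg n) x0)"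
      unfolding Ureg_def sphere_kernel_def using pos \<Omega>_sphere by (intro continuous_intros; force)+
    have i: "integrable sphere_measure (\<lambda>x. Ureg (areg n) x0 x * ?h1 x)"
      "integrable sphere_measure (\<lambda>x. sphere_kernel (areg n) x0 x * ?h2 x)"
      using integrable_inner_region[OF continuous_on_mult[OF c(1) continuous_on_lap] ch]
        integrable_inner_region[OF continuous_on_mult[OF c(2) continuous_on_u] ch]
      by (simp_all add: set_integrable_def mult.left_commute)
    have "(LINT x|sphere_measure. Ureg (areg n) x0 x * ?h1 x) + (LINT x|sphere_measure. sphere_kernel (areg n) x0 x * ?h2 x)
      - 1 / (4 * pi) * integral\<^sup>L sphere_measure ?h2 =
      (LINT x|sphere_measure. Ureg (areg n) x0 x * ?h1 x + sphere_kernel (areg n) x0 x * ?h2 x - 1 / (4 * pi) * ?h2 x)"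
      using i i2 by simp
    also have "\<dots> = (LINT x:?E|sphere_measure. Ureg (areg n) x0 x * lap x - u x * (1 / (4 * pi) - sphere_kernel (areg n) x0 x))"
      unfolding set_lebesgue_integral_def
      by (rule Bochner_Integration.integral_cong) (auto simp: indicator_def algebra_simps)
    also have "\<dots> = \<sigma> * integral {0..1} (flux (areg n) \<rho>)"
      by (rule green_Ureg[OF a \<rho>(1) \<rho>r])
    finally show ?thesis .
  qed
  have "(\<lambda>n. (areg n, \<rho>)) \<longlonglongrightarrow> (1, \<rho>)"
    by (intro tendsto_intros areg_tendsto)
  from continuous_on_tendsto_compose[OF continuous_on_flux_integral this]
  have T3: "(\<lambda>n. integral {0..1} (flux (areg n) \<rho>)) \<longlonglongrightarrow> integral {0..1} (flux 1 \<rho>)"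
    using \<rho> areg_bounds(1) by (auto intro!: always_eventually less_imp_le)
  have "(\<lambda>n. \<sigma> * integral {0..1} (flux (areg n) \<rho>)) \<longlonglongrightarrow>
      (LINT x|sphere_measure. Ustar x x0 * ?h1 x) + point_value - 1 / (4 * pi) * integral\<^sup>L sphere_measure ?h2"
    unfolding key[symmetric] by (intro tendsto_intros T1 T2)
  from LIMSEQ_unique[OF this tendsto_mult_left[OF T3]]
  have "(LINT x|sphere_measure. Ustar x x0 * ?h1 x) + point_value - 1 / (4 * pi) * integral\<^sup>L sphere_measure ?h2
      = \<sigma> * integral {0..1} (flux 1 \<rho>)" .
  moreover have "(LINT x:?E|sphere_measure. Ustar x x0 * lap x) = (LINT x|sphere_measure. Ustar x x0 * ?h1 x)"
    by (simp add: set_lebesgue_integral_def mult.left_commute)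
  ultimately show ?thesis
    by (simp add: set_lebesgue_integral_def)
qed

lemma tendsto_inner_region:
  fixes f :: "real^3 \<Rightarrow> real"
  assumes f: "set_integrable sphere_measure \<Omega> f" and d: "d \<longlonglongrightarrow> 0" "\<And>n. d n > 0"
  shows "(\<lambda>n. LINT x:inner_region (d n)|sphere_measure. f x) \<longlonglongrightarrow> (LINT x:\<Omega>|sphere_measure. f x)"
  unfolding set_lebesgue_integral_def
proof (rule integral_dominated_convergence[where w = "\<lambda>x. \<bar>indicator \<Omega> x *\<^sub>R f x\<bar>"])
  have fi: "integrable sphere_measure (\<lambda>x. indicator \<Omega> x *\<^sub>R f x)" using f by (simp add: set_integrable_def)
  then show "integrable sphere_measure (\<lambda>x. \<bar>indicator \<Omega> x *\<^sub>R f x\<bar>)"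
    "(\<lambda>x. indicator \<Omega> x *\<^sub>R f x) \<in> borel_measurable sphere_measure" by auto
  show "(\<lambda>x. indicator (inner_region (d n)) x *\<^sub>R f x) \<in> borel_measurable sphere_measure" for n
    using set_integrable_subset[OF f, of "inner_region (d n)"] inner_region_borel inner_region_subset
    by (auto simp: set_integrable_def)
  show "AE x in sphere_measure. (\<lambda>n. indicator (inner_region (d n)) x *\<^sub>R f x) \<longlonglongrightarrow> indicator \<Omega> x *\<^sub>R f x"
  proof (rule AE_I2)
    fix x
    show "(\<lambda>n. indicator (inner_region (d n)) x *\<^sub>R f x) \<longlonglongrightarrow> indicator \<Omega> x *\<^sub>R f x"
    proof (cases "x \<in> \<Omega>")
      case True
      have "closed (range \<gamma>)" using compact_range_\<gamma> compact_imp_closed by blast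
      then have "infdist x (range \<gamma>) \<noteq> 0"
        using in_closed_iff_infdist_zero[of "range \<gamma>" x] True \<Omega>_sub by auto
      then have "0 < infdist x (range \<gamma>)" using infdist_nonneg[of x "range \<gamma>"] by linarith
      then have "\<forall>\<^sub>F n in sequentially. d n < infdist x (range \<gamma>)"
        by (rule order_tendstoD(2)[OF d(1)])
      then have "\<forall>\<^sub>F n in sequentially. indicator (inner_region (d n)) x *\<^sub>R f x = indicator \<Omega> x *\<^sub>R f x"
        by eventually_elim (simp add: inner_region_def True)
      then show ?thesis by (rule tendsto_eventually)
    next
      case False
      then have "x \<notin> inner_region (d n)" for n using inner_region_subset by blast
      then show ?thesis using False by simp
    qed
  qed
  show "AE x in sphere_measure. norm (indicator (inner_region (d n)) x *\<^sub>R f x) \<le> \<bar>indicator \<Omega> x *\<^sub>R f x\<bar>" for n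
    using inner_region_subset by (auto simp: indicator_def)
qed

text \<open>Existence of the limit is a conclusion: for each small distance the integral equals an
  expression in \<open>u\<close> and the flux alone, and this converges because \<open>u\<close> is
  bounded and the flux is continuous up to the curve.\<close>

lemma tendsto_representation:
  "((\<lambda>d. LINT x:inner_region d|sphere_measure. Ustar x x0 * lap x) \<longlongrightarrow>
     1 / (4 * pi) * (LINT x:\<Omega>|sphere_measure. u x) - point_value + \<sigma> * integral {0..1} (flux 1 0)) (at_right 0)"
proof (rule tendsto_at_right_sequentially[of 0 1])
  show "(0 :: real) < 1" by simp
  fix d :: "nat \<Rightarrow> real" assume d: "\<And>n. 0 < d n" "\<And>n. d n < 1" "decseq d" "d \<longlonglongrightarrow> 0"
  \<comment> \<open>The arc whose chord is \<open>d n\<close>, so that the Euclidean inner region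
    becomes one bounded by a parallel curve.\<close>
  define \<rho> where "\<rho> n = 2 * arcsin (d n / 2)" for n
  have ch: "chord (\<rho> n) = d n" for n
    using d(1,2)[of n] by (simp add: chord_def \<rho>_def)
  have "isCont arcsin 0" by (intro isCont_arcsin) auto
  then have "(\<lambda>n. arcsin (d n / 2)) \<longlonglongrightarrow> arcsin 0"
    by (rule isCont_tendsto_compose) (auto intro!: tendsto_eq_intros d(4))
  then have \<rho>l: "\<rho> \<longlonglongrightarrow> 0"
    unfolding \<rho>_def[abs_def] by (auto intro!: tendsto_eq_intros)
  have \<rho>p: "0 < \<rho> n" for n
    using arcsin_less_mono[of 0 "d n / 2"] d(1,2)[of n] by (simp add: \<rho>_def)
  have ev: "\<forall>\<^sub>F n in sequentially. \<rho> n < \<rho>0"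
    by (rule order_tendstoD(2)[OF \<rho>l \<rho>0(1)])
  have ui: "set_integrable sphere_measure \<Omega> u"
    by (rule set_integrable_sphere_subcompact[OF compact_closure_\<Omega> cont_u closure_subset openin_sphere_borel[OF \<Omega>_open]])
  have "(\<lambda>n. (1 :: real, \<rho> n)) \<longlonglongrightarrow> (1, 0)" by (intro tendsto_intros \<rho>l)
  note * = continuous_on_tendsto_compose[OF continuous_on_flux_integral this]
  have F: "(\<lambda>n. integral {0..1} (flux 1 (\<rho> n))) \<longlonglongrightarrow> integral {0..1} (flux 1 0)"
  proof -
    have "\<forall>\<^sub>F n in sequentially. 0 \<le> \<rho> n \<and> \<rho> n \<le> \<rho>0"
      using ev by eventually_elim (use \<rho>p in \<open>auto intro: less_imp_le\<close>)
    with * \<rho>0 show ?thesis by simp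
  qed
  have "(\<lambda>n. 1 / (4 * pi) * (LINT x:inner_region (d n)|sphere_measure. u x) - point_value + \<sigma> * integral {0..1} (flux 1 (\<rho> n)))
    \<longlonglongrightarrow> 1 / (4 * pi) * (LINT x:\<Omega>|sphere_measure. u x) - point_value + \<sigma> * integral {0..1} (flux 1 0)"
    by (intro tendsto_intros tendsto_inner_region[OF ui d(4,1)] F)
  then show "(\<lambda>n. LINT x:inner_region (d n)|sphere_measure. Ustar x x0 * lap x) \<longlonglongrightarrow>
      1 / (4 * pi) * (LINT x:\<Omega>|sphere_measure. u x) - point_value + \<sigma> * integral {0..1} (flux 1 0)"
  proof (rule Lim_transform_eventually)
    show "\<forall>\<^sub>F n in sequentially. 1 / (4 * pi) * (LINT x:inner_region (d n)|sphere_measure. u x) - point_value + \<sigma> * integral {0..1} (flux 1 (\<rho> n))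
      = (LINT x:inner_region (d n)|sphere_measure. Ustar x x0 * lap x)"
      using ev
    proof eventually_elim
      case (elim n)
      then show ?case using representation_inner_region[of "\<rho> n"] \<rho>p[of n] by (simp add: ch)
    qed
  qed
qed


section \<open>From the trace back to the coordinate Laplacian\<close>

lemma lap_eq_off_poles:
  assumes x: "x \<in> \<Omega>" and np: "x \<notin> {axis 3 1, - axis 3 1}"
  shows "laplace_beltrami u x = lap x"
proof -
  have "x $ 1 \<noteq> 0 \<or> x $ 2 \<noteq> 0"
  proof (rule ccontr)
    assume "\<not> ?thesis"
    then have z: "x $ 1 = 0" "x $ 2 = 0" by auto
    then have "(x $ 3)\<^sup>2 = 1"
      using \<Omega>_sphere[OF x] by (simp add: norm_eq_1 inner_vec_def sum_3 power2_eq_square)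
    then have "x $ 3 = 1 \<or> x $ 3 = -1" by (simp add: power2_eq_1_iff)
    then have "x = axis 3 1 \<or> x = - axis 3 1"
      using z by (auto simp: vec_eq_iff forall_3 axis_def)
    then show False using np by auto
  qed
  then show ?thesis
    by (rule laplace_beltrami_eq_divergence[OF \<Omega>_open x _ grad hess])
qed

lemma lap_eq_AE: "AE x in sphere_measure. x \<in> \<Omega> \<longrightarrow> laplace_beltrami u x = lap x"
proof -
  have n: "norm (axis 3 1 :: real^3) = 1" "norm (- axis 3 1 :: real^3) = 1"
    by (simp_all add: norm_axis_1)
  show ?thesis
    using AE_sphere_neq[OF n(1)] AE_sphere_neq[OF n(2)]
    by eventually_elim (use lap_eq_off_poles in auto)
qed

lemma
  assumes E: "E \<in> sets borel" "E \<subseteq> \<Omega>"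
  shows set_integrable_laplace_iff: "set_integrable sphere_measure E (\<lambda>x. Ustar x x0 * laplace_beltrami u x) \<longleftrightarrow>
      set_integrable sphere_measure E (\<lambda>x. Ustar x x0 * lap x)" (is ?A)
    and integral_laplace_eq: "(LINT x:E|sphere_measure. Ustar x x0 * laplace_beltrami u x) =
      (LINT x:E|sphere_measure. Ustar x x0 * lap x)" (is ?B)
proof -
  let ?f = "\<lambda>x. indicator E x *\<^sub>R (Ustar x x0 * laplace_beltrami u x)"
  let ?g = "\<lambda>x. indicator E x *\<^sub>R (Ustar x x0 * lap x)"
  have "(\<lambda>x. indicator E x *\<^sub>R lap x) \<in> borel_measurable borel"
    by (rule borel_measurable_continuous_on_indicator[OF E(1) continuous_on_subset[OF continuous_on_lap E(2)]])
  then have "(\<lambda>x. Ustar x x0 * (indicator E x *\<^sub>R lap x)) \<in> borel_measurable borel"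
    by measurable
  then have g: "?g \<in> borel_measurable sphere_measure"
    by (simp add: mult.left_commute measurable_cong_sets[OF sets_sphere_measure refl])
  \<comment> \<open>Measurability of an expression built from nested \<open>deriv\<close> is
    obtained indirectly: it differs from the measurable \<open>?g\<close> at two points at
    most.\<close>
  have f: "?f \<in> borel_measurable sphere_measure"
    by (rule measurable_discrete_difference[OF g, of "{axis 3 1, - axis 3 1}"])
       (use E(2) lap_eq_off_poles in \<open>auto simp: indicator_def\<close>)
  have ae: "AE x in sphere_measure. ?f x = ?g x"
    using lap_eq_AE by eventually_elim (use E(2) in \<open>auto simp: indicator_def\<close>)
  show ?A unfolding set_integrable_def by (rule integrable_cong_AE[OF f g ae])
  show ?B unfolding set_lebesgue_integral_def by (rule integral_cong_AE[OF f g ae])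
qed

text \<open>The limit settles the improper case. In the integrable case dominated convergence shows
  that the integrals over inner regions also tend to the Lebesgue integral, and limits are
  unique.\<close>

lemma has_surface_integral_upto_representation:
  "has_surface_integral_upto (\<lambda>x. Ustar x x0 * laplace_beltrami u x)
    (1 / (4 * pi) * (LINT x:\<Omega>|sphere_measure. u x) - point_value + \<sigma> * integral {0..1} (flux 1 0)) \<Omega> (range \<gamma>)"
    (is "has_surface_integral_upto ?f ?I _ _")
proof -
  have lim: "((\<lambda>d. LINT x:inner_region d|sphere_measure. ?f x) \<longlongrightarrow> ?I) (at_right 0)"
    using tendsto_representation integral_laplace_eq[OF inner_region_borel inner_region_subset] by simp
  have int: "set_integrable sphere_measure (inner_region d) ?f" if d: "d > 0" for d
  proof -
    obtain B where B: "\<And>x. \<bar>indicator (inner_region d) x * lap x\<bar> \<le> B"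
      "(\<lambda>x. indicator (inner_region d) x * lap x) \<in> borel_measurable borel"
      using bounded_inner_region[OF continuous_on_lap d] by blast
    have "set_integrable sphere_measure (inner_region d) (\<lambda>x. Ustar x x0 * lap x)"
      using integrable_Ustar_times[OF x0_sphere B(2,1)] by (simp add: set_integrable_def mult.left_commute)
    then show ?thesis
      using set_integrable_laplace_iff[OF inner_region_borel inner_region_subset] by blast
  qed
  have "?I = (LINT x:\<Omega>|sphere_measure. ?f x)" if f: "set_integrable sphere_measure \<Omega> ?f"
  proof -
    define d where "d n = inverse (real (Suc n))" for n
    have d: "d \<longlonglongrightarrow> 0" "\<And>n. d n > 0"
      using LIMSEQ_inverse_real_of_nat by (simp_all add: d_def[abs_def])
    then have "filterlim d (at_right 0) sequentially"
      by (auto simp: filterlim_at intro!: always_eventually less_imp_neq[symmetric])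
    from filterlim_compose[OF lim this] tendsto_inner_region[OF f d]
    show ?thesis by (rule LIMSEQ_unique)
  qed
  then show ?thesis
    using lim int unfolding has_surface_integral_upto_def inner_region_def by simp
qed

section \<open>The two boundary integrals\<close>

lemma boundary_value_curl:
  "boundary_value \<Omega> (surface_curl u) (\<gamma> s) = - cross3 (\<gamma> s) (G (\<gamma> s))"
proof -
  have cl: "\<gamma> s \<in> closure \<Omega>" using tube_in_closure[of 0 s] r0 by (simp add: tube_0)
  have "\<gamma> s \<notin> \<Omega>" using \<Omega>_sub by auto
  then have lp: "\<gamma> s islimpt \<Omega>" using cl by (simp add: closure_def)
  have "continuous_on (closure \<Omega>) (\<lambda>y. - cross3 y (G y))"
    by (intro continuous_intros continuous_on_cross cont_G)
  then have "((\<lambda>y. - cross3 y (G y)) \<longlongrightarrow> - cross3 (\<gamma> s) (G (\<gamma> s))) (at (\<gamma> s) within closure \<Omega>)"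
    using cl by (simp add: continuous_on_def)
  then have "((\<lambda>y. - cross3 y (G y)) \<longlongrightarrow> - cross3 (\<gamma> s) (G (\<gamma> s))) (at (\<gamma> s) within \<Omega>)"
    by (rule tendsto_within_subset[OF _ closure_subset])
  then have "(surface_curl u \<longlongrightarrow> - cross3 (\<gamma> s) (G (\<gamma> s))) (at (\<gamma> s) within \<Omega>)"
  proof (rule Lim_transform_within[OF _ zero_less_one])
    fix y assume "y \<in> \<Omega>"
    then show "- cross3 y (G y) = surface_curl u y"
      using \<Omega>_sphere by (simp add: surface_curl_def surface_gradient_eq[OF grad])
  qed
  then show ?thesis
    unfolding boundary_value_def using lp by (intro tendsto_Lim) (simp_all add: trivial_limit_within)
qed

lemma curve_inner_x0: "\<gamma> s \<bullet> x0 < 1"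
  using tube_inner_x0[of 0 s] \<rho>0 by (simp add: tube_0)

lemma curl_Ustar:
  "surface_curl (\<lambda>y. Ustar y x0) (\<gamma> s) = - cross3 (\<gamma> s) (zonal_field (Ureg' 1) x0 (\<gamma> s))"
proof -
  let ?t = "\<gamma> s \<bullet> x0"
  have "((\<lambda>t. - (1 / (4 * pi)) * ln (1 - t)) has_real_derivative Ureg' 1 ?t) (at ?t)"
    by (rule Ureg_derivs(1)[OF curve_inner_x0])
  then have "((\<lambda>t. - (1 / (4 * pi)) * ln \<bar>1 - t\<bar>) has_real_derivative Ureg' 1 ?t) (at ?t)"
    by (rule has_field_derivative_transform_within_open[of _ _ _ "{..<1}"]) (use curve_inner_x0 in auto)
  then have "has_surface_gradient (\<lambda>y. - (1 / (4 * pi)) * ln \<bar>1 - y \<bullet> x0\<bar>) (zonal_field (Ureg' 1) x0 (\<gamma> s)) (\<gamma> s)"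
    by (rule has_surface_gradient_zonal[OF on_sphere, where f = "\<lambda>t. - (1 / (4 * pi)) * ln \<bar>1 - t\<bar>"])
  then have "has_surface_gradient (\<lambda>y. Ustar y x0) (zonal_field (Ureg' 1) x0 (\<gamma> s)) (\<gamma> s)"
    by (simp add: Ustar_def)
  then show ?thesis
    by (simp add: surface_curl_def surface_gradient_eq on_sphere)
qed

text \<open>Multiplying \<open>t\<close> by the speed gives
  \<open>\<sigma> *\<^sub>R \<gamma>'\<close>, so the arc length element cancels the normalization
  and both integrals equal \<open>\<sigma>\<close> times parameter integrals of unnormalized
  expressions.\<close>

lemma boundary_integrals:
  assumes t: "\<And>s. t (\<gamma> s) = (\<sigma> / speed s) *\<^sub>R \<gamma>' s"
  shows "arc_length_integral \<gamma> (\<lambda>x. u x * (surface_curl (\<lambda>y. Ustar y x0) x \<bullet> t x))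
      - arc_length_integral \<gamma> (\<lambda>x. Ustar x x0 * (boundary_value \<Omega> (surface_curl u) x \<bullet> t x))
    = \<sigma> * integral {0..1} (flux 1 0)"
proof -
  let ?V = "zonal_field (Ureg' 1) x0"
  define f where "f s = u (\<gamma> s) * (- cross3 (\<gamma> s) (?V (\<gamma> s)) \<bullet> \<gamma>' s)" for s
  define g where "g s = Ustar (\<gamma> s) x0 * (- cross3 (\<gamma> s) (G (\<gamma> s)) \<bullet> \<gamma>' s)" for s
  have vd: "norm (vector_derivative \<gamma> (at s)) = speed s" for s
    using vector_derivative_at[OF deriv1[of s]] by (simp add: speed_def)
  have cl: "\<gamma> s \<in> closure \<Omega>" for s using tube_in_closure[of 0 s] r0 by (simp add: tube_0)
  have gc: "continuous_on {0..1} \<gamma>" by (rule cont0)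
  have pos: "1 - \<gamma> s \<bullet> x0 > 0" for s using curve_inner_x0[of s] by simp
  have uG: "continuous_on {0..1} (\<lambda>s. u (\<gamma> s))" "continuous_on {0..1} (\<lambda>s. G (\<gamma> s))"
    using cl by (auto intro!: continuous_on_compose2[OF cont_u gc] continuous_on_compose2[OF cont_G gc])
  have U: "continuous_on {0..1} (\<lambda>s. Ustar (\<gamma> s) x0)"
    unfolding Ustar_def using pos by (intro continuous_intros cont0) (auto simp: less_imp_neq[symmetric])
  have V: "continuous_on {0..1} (\<lambda>s. ?V (\<gamma> s))"
    unfolding zonal_field_def Ureg'_def using pos by (intro continuous_intros cont0) (auto simp: less_imp_neq[symmetric])
  have fc: "continuous_on {0..1} f" and gc: "continuous_on {0..1} g"
    unfolding f_def g_def by (intro continuous_intros continuous_on_cross cont0 cont1 uG U V)+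
  have "arc_length_integral \<gamma> (\<lambda>x. u x * (surface_curl (\<lambda>y. Ustar y x0) x \<bullet> t x)) = integral {0..1} (\<lambda>s. \<sigma> * f s)"
    unfolding arc_length_integral_def vd curl_Ustar t f_def
    using speed_pos by (intro integral_cong) (simp add: less_imp_neq[symmetric])
  moreover have "arc_length_integral \<gamma> (\<lambda>x. Ustar x x0 * (boundary_value \<Omega> (surface_curl u) x \<bullet> t x)) = integral {0..1} (\<lambda>s. \<sigma> * g s)"
    unfolding arc_length_integral_def vd boundary_value_curl t g_def
    using speed_pos by (intro integral_cong) (simp add: less_imp_neq[symmetric])
  moreover have "flux 1 0 = (\<lambda>s. f s - g s)"
  proof
    fix s
    have "Ureg 1 x0 (\<gamma> s) = Ustar (\<gamma> s) x0" using pos[of s] by (simp add: Ureg_def Ustar_def)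
    then show "flux 1 0 s = f s - g s"
      unfolding flux_def tube_0 f_def g_def Cross3.right_diff_distrib
      by (simp add: cross_mult_right inner_diff_left)
  qed
  ultimately show ?thesis
    using fc gc
    by (simp add: Henstock_Kurzweil_Integration.integral_diff integrable_continuous_real right_diff_distrib)
qed

end

theorem proposition2p2:
  fixes C S1 S2 :: "(real^3) set" and \<gamma> :: "real \<Rightarrow> real^3" and t :: "real^3 \<Rightarrow> real^3"
    and u :: "real^3 \<Rightarrow> real" and x0 :: "real^3"
  assumes "C \<subseteq> unit_sphere"
    and "parametrizes_C2_curve \<gamma> C"
    and "components (unit_sphere - C) = {S1, S2}" and "S1 \<noteq> S2"
    and "unit_tangent_field \<gamma> t"
    and "positively_oriented C t S2"
    and "C2_on_surface S2 u" and "C1_on_closure S2 u"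
    and "x0 \<in> S2 \<union> (unit_sphere - closure S2)"
  shows "\<exists>I. has_surface_integral_upto (\<lambda>x. Ustar x x0 * laplace_beltrami u x) I S2 C \<and>
     1 / (4 * pi) * (LINT x:S2|sphere_measure. u x)
     - I
     - arc_length_integral \<gamma>
         (\<lambda>x. Ustar x x0 * (boundary_value S2 (surface_curl u) x \<bullet> t x))
     + arc_length_integral \<gamma>
         (\<lambda>x. u x * (surface_curl (\<lambda>y. Ustar y x0) x \<bullet> t x))
     = (if x0 \<in> S2 then u x0 else 0)"
proof -
  obtain \<gamma>' \<gamma>'' where per: "\<And>s. \<gamma> (s + 1) = \<gamma> s"
    and d1: "\<And>s. (\<gamma> has_vector_derivative \<gamma>' s) (at s)"
    and d2: "\<And>s. (\<gamma>' has_vector_derivative \<gamma>'' s) (at s)"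
    and reg: "\<And>s. \<gamma>' s \<noteq> 0" and c2: "continuous_on UNIV \<gamma>''"
    using assms(2) unfolding parametrizes_C2_curve_def C2_periodic_regular_def by blast
  have sp: "simple_path \<gamma>" and C: "\<gamma> ` {0..1} = C"
    using assms(2) by (auto simp: parametrizes_C2_curve_def path_image_def)
  have inC: "\<gamma> s \<in> C" for s
    using periodic_frac[of \<gamma>, OF per, of s] frac_ge_0[of s] frac_lt_1[of s]
    unfolding C[symmetric] by (metis atLeastAtMost_iff imageI less_imp_le)
  have tang: "\<exists>c. t (\<gamma> s) = c *\<^sub>R \<gamma>' s \<and> \<bar>c\<bar> * norm (\<gamma>' s) = 1" for s
  proof -
    obtain c where "t (\<gamma> s) = c *\<^sub>R \<gamma>' s" "norm (t (\<gamma> s)) = 1"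
      using assms(5) vector_derivative_at[OF d1[of s]] unfolding unit_tangent_field_def by metis
    then show ?thesis by auto
  qed
  obtain c where c: "\<And>s. t (\<gamma> s) = c s *\<^sub>R \<gamma>' s" "\<And>s. \<bar>c s\<bar> * norm (\<gamma>' s) = 1"
    using tang by metis
  \<comment> \<open>The direction of \<open>t\<close> relative to the parametrization, read off at
    parameter 0. It makes \<open>nv 0\<close> the normal to the left of \<open>t\<close>.\<close>
  define \<sigma> where "\<sigma> = c 0 * norm (\<gamma>' 0)"
  have pm: "c s * norm (\<gamma>' s) = 1 \<or> c s * norm (\<gamma>' s) = -1" for s
    using c(2)[of s] by (auto simp: abs_if split: if_splits)
  interpret sphere_curve \<gamma> \<gamma>' \<gamma>'' \<sigma>
  proof
    show "norm (\<gamma> s) = 1" for s using inC[of s] assms(1) by auto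
    show "s = s'" if "0 \<le> s" "s < 1" "0 \<le> s'" "s' < 1" "\<gamma> s = \<gamma> s'" for s s'
      using sp that unfolding simple_path_def loop_free_def by force
    show "\<sigma> * \<sigma> = 1" using pm[of 0] by (auto simp: \<sigma>_def)
  qed (use per d1 d2 reg c2 in auto)
  obtain r0 where "sphere_tube \<gamma> \<gamma>' \<gamma>'' \<sigma> r0" using ex_sphere_tube by blast
  then interpret sphere_tube \<gamma> \<gamma>' \<gamma>'' \<sigma> r0 .
  have rC: "range \<gamma> = C" using C range_\<gamma>(1) by simp
  have comp: "components (unit_sphere - range \<gamma>) = {S1, S2}" using assms(3) rC by simp
  have clC: "closed (range \<gamma>)" using compact_range_\<gamma> compact_imp_closed by blast
  \<comment> \<open>The great circle of the orientation condition is a normal geodesic of the tube,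
    run through forwards or backwards according to the sign of \<open>t\<close> at this
    point.\<close>
  have orient: "\<forall>\<^sub>F \<epsilon> in at_right 0. tube s (c s * speed s * \<sigma> * \<epsilon>) \<in> S2" for s
  proof -
    have e: "c s * speed s * \<sigma> = 1 \<or> c s * speed s * \<sigma> = -1"
      using pm[of s] pm[of 0] by (auto simp: \<sigma>_def speed_def)
    have "cross3 (\<gamma> s) (t (\<gamma> s)) = (c s * speed s * \<sigma>) *\<^sub>R nv s"
      by (simp add: c(1) cross_mult_right cross_\<gamma>_\<gamma>' ac_simps)
    then have eq: "cos \<epsilon> *\<^sub>R \<gamma> s + sin \<epsilon> *\<^sub>R cross3 (\<gamma> s) (t (\<gamma> s)) = tube s (c s * speed s * \<sigma> * \<epsilon>)" for \<epsilon>
      using e by (auto simp: tube_def)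
    show ?thesis
      using bspec[OF assms(6)[unfolded positively_oriented_def] inC[of s]] by (simp only: eq)
  qed
  have small: "\<forall>\<^sub>F \<epsilon> in at_right 0. 0 < \<epsilon> \<and> \<epsilon> < r0"
    using eventually_at_right_less[of 0] order_tendstoD(2)[OF tendsto_ident_at r0(1)]
    by eventually_elim simp
  have "c 0 * speed 0 * \<sigma> = 1"
    using sign by (simp add: \<sigma>_def speed_def)
  with eventually_happens'[OF _ eventually_conj[OF orient[of 0] small]]
  obtain r1 where r1: "0 < r1" "r1 < r0" "tube 0 r1 \<in> S2" by auto
  note sides = tube_sides[OF comp assms(4) r1]
  \<comment> \<open>The sign is the same along the whole curve: the opposite one would put a point
    with negative normal coordinate into \<open>S2\<close>, which lies on the positive side
    only.\<close>
  have t_eq: "t (\<gamma> s) = (\<sigma> / speed s) *\<^sub>R \<gamma>' s" for s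
  proof -
    obtain r where r: "0 < r" "r < r0" "tube s (c s * speed s * \<sigma> * r) \<in> S2"
      using eventually_happens'[OF _ eventually_conj[OF orient[of s] small]] by auto
    have "c s * speed s * \<sigma> \<noteq> -1" using r sides(2)[of "- r" s] by auto
    moreover have "c s * speed s * \<sigma> = 1 \<or> c s * speed s * \<sigma> = -1"
      using pm[of s] pm[of 0] by (auto simp: \<sigma>_def speed_def)
    ultimately have "c s * speed s * \<sigma> * \<sigma> = \<sigma>" by auto
    then have "c s * speed s = \<sigma>" by (simp add: sign mult.assoc)
    then show ?thesis using speed_pos[of s] by (simp add: c(1) field_simps)
  qed
  have S2: "S2 \<in> components (unit_sphere - range \<gamma>)" using comp by simp
  note S2' = component_of_sphere_complement[OF S2 clC range_\<gamma>_sphere]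
  interpret sphere_region \<gamma> \<gamma>' \<gamma>'' \<sigma> r0 S2
    by unfold_locales (use S2' sides in auto)
  obtain G0 where G0: "\<And>x. x \<in> S2 \<Longrightarrow> has_surface_gradient u (G0 x) x" "\<And>i. C1_on_surface S2 (\<lambda>x. G0 x $ i)"
    using assms(7) unfolding C2_on_surface_def by blast
  then obtain H where H: "\<And>i x. x \<in> S2 \<Longrightarrow> has_surface_gradient (\<lambda>y. G0 y $ i) (H i x) x"
      "\<And>i. continuous_on S2 (H i)"
    unfolding C1_on_surface_def by metis
  obtain G where G: "\<And>x. x \<in> S2 \<Longrightarrow> has_surface_gradient u (G x) x" "continuous_on (closure S2) G"
    and uc: "continuous_on (closure S2) u"
    using assms(8) unfolding C1_on_closure_def by blast
  have sph: "x \<in> unit_sphere" if "x \<in> S2" for x using S2'(3) that by auto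
  \<comment> \<open>The gradient field with differentiable components and the one extending to the
    closure come from different hypotheses; uniqueness merges them.\<close>
  have GG: "G0 x = G x" if "x \<in> S2" for x
    by (rule has_surface_gradient_unique[OF G0(1)[OF that] G(1)[OF that] sph[OF that]])
  interpret sphere_representation \<gamma> \<gamma>' \<gamma>'' \<sigma> r0 S2 u G H x0
  proof
    show "has_surface_gradient (\<lambda>y. G y $ i) (H i x) x" if "x \<in> S2" for i x
      by (rule has_surface_gradient_cong_ev[OF H(1)[OF that] sph[OF that] S2'(1) that]) (simp add: GG)
    show "norm x0 = 1" "x0 \<in> S2 \<or> x0 \<notin> closure S2" using assms(9) sph by auto
  qed (use G uc H in auto)
  show ?thesis
    using has_surface_integral_upto_representation boundary_integrals[of t, OF t_eq]
    unfolding rC point_value_def by (intro exI conjI) (assumption, simp)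
qed

end
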